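(* Let $W=W(X)$ be a star reducible Coxeter group with Coxeter graph $X$. Let $w\in W_c$ and let $x=sw\notin W_c$ for some $s\in S$. Then $\widetilde{t}_x\in v^{-1}\mathcal{L}$.
   Context: $(W,S)$ is a Coxeter system with Coxeter matrix $m$, length function $\ell$; $W_c$ is the set of fully commutative elements (any two reduced expressions related by swapping adjacent commuting generators). Star reducibility: for noncommuting $s,t$, $I=\{s,t\}$, each $w$ factors uniquely as $w=w_Iw^I$ with $w_I\in\langle s,t\rangle$, $w^I$ having no left descent in $I$, lengths adding. Left $\{s,t\}$-strings are $sw^I,tsw^I,stsw^I,\dots$ and $tw^I,stw^I,\dots$ ($m(s,t)-1$ elements each); if $x,y$ are in a common string with $\ell(x)=\ell(y)-1$, $y$ is left star reducible to $x$; right star reducibility is symmetric. $W$ is star reducible if every element of $W_c$ can be brought to a product of pairwise commuting generators by a sequence of left/right star reductions. Let $\mathcal{A}=\mathbb{Z}[v,v^{-1}]$, $q=v^2$. The Hecke algebra $\mathcal{H}$ is the $\mathcal{A}$-algebra with basis $\{T_w:w\in W\}$ and $T_sT_w=T_{sw}$ if $\ell(sw)>\ell(w)$, $T_sT_w=qT_{sw}+(q-1)T_w$ if $\ell(sw)<\ell(w)$. Put $\widetilde T_w=v^{-\ell(w)}T_w$. Let $J(X)$ be the two-sided ideal generated by $\sum_{u\in\langle s,t\rangle}T_u$ over pairs $s,t$ with $3\le m(s,t)<\infty$. The generalized Temperley--Lieb algebra is $TL(X)=\mathcal{H}/J(X)$, and $\widetilde t_w$ is the image of $\widetilde T_w$.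 $\mathcal{L}$ is the $\mathbb{Z}[v^{-1}]$-submodule of $TL(X)$ generated by $\{\widetilde t_w: w\in W_c\}$. *)

theory Defs
  imports
    "HOL-Algebra.Algebra"
    "HOL-Algebra.Algebraic_Closure_Type"
    "HOL-Library.Poly_Mapping"
    "HOL-Library.Extended_Nat"
begin

section \<open>Coxeter systems\<close>

definition word_prod :: "('w, 'x) monoid_scheme \<Rightarrow> 'w list \<Rightarrow> 'w" where
  "word_prod G ws = foldr (\<otimes>\<^bsub>G\<^esub>) ws \<one>\<^bsub>G\<^esub>"

text \<open>
  The congruence on words over \<open>S\<close> generated by \<open>(s t)^m(s, t) = 1\<close> for \<open>m(s, t) < \<infinity>\<close>.
  The relations for \<open>s = t\<close> read \<open>s s = 1\<close>, so the quotient of the free monoid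
  on \<open>S\<close> is already the group presented by these relations.
\<close>

inductive coxeter_cong :: "'w set \<Rightarrow> ('w \<Rightarrow> 'w \<Rightarrow> enat) \<Rightarrow> 'w list \<Rightarrow> 'w list \<Rightarrow> bool"
  for S :: "'w set" and m :: "'w \<Rightarrow> 'w \<Rightarrow> enat" where
  relator: "\<lbrakk>s \<in> S; t \<in> S; m s t = enat k; us \<in> lists S; vs \<in> lists S\<rbrakk>
    \<Longrightarrow> coxeter_cong S m (us @ concat (replicate k [s, t]) @ vs) (us @ vs)"
| refl: "us \<in> lists S \<Longrightarrow> coxeter_cong S m us us"
| sym: "coxeter_cong S m us vs \<Longrightarrow> coxeter_cong S m vs us"
| trans: "\<lbrakk>coxeter_cong S m us vs; coxeter_cong S m vs ws\<rbrakk> \<Longrightarrow> coxeter_cong S m us ws"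

locale coxeter_system = group G
  for G :: "('w, 'x) monoid_scheme" (structure) and S :: "'w set" and m :: "'w \<Rightarrow> 'w \<Rightarrow> enat" +
  assumes gens_subset: "S \<subseteq> carrier G"
    and gens_generate: "generate G S = carrier G"
    and matrix_diag: "s \<in> S \<Longrightarrow> m s s = 1"
    and matrix_sym: "\<lbrakk>s \<in> S; t \<in> S\<rbrakk> \<Longrightarrow> m s t = m t s"
    and matrix_off_diag: "\<lbrakk>s \<in> S; t \<in> S; s \<noteq> t\<rbrakk> \<Longrightarrow> 2 \<le> m s t"
    and presentation: "\<lbrakk>us \<in> lists S; vs \<in> lists S\<rbrakk>
      \<Longrightarrow> word_prod G us = word_prod G vs \<longleftrightarrow> coxeter_cong S m us vs"

definition cox_length :: "('w, 'x) monoid_scheme \<Rightarrow> 'w set \<Rightarrow> 'w \<Rightarrow> nat" where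
  "cox_length G S w = (LEAST n. \<exists>ws \<in> lists S. length ws = n \<and> word_prod G ws = w)"

definition reduced_expressions :: "('w, 'x) monoid_scheme \<Rightarrow> 'w set \<Rightarrow> 'w \<Rightarrow> 'w list set" where
  "reduced_expressions G S w =
    {ws \<in> lists S. word_prod G ws = w \<and> length ws = cox_length G S w}"

definition commutation_step :: "('w, 'x) monoid_scheme \<Rightarrow> 'w list \<Rightarrow> 'w list \<Rightarrow> bool" where
  "commutation_step G xs ys \<longleftrightarrow>
    (\<exists>us vs s t. s \<otimes>\<^bsub>G\<^esub> t = t \<otimes>\<^bsub>G\<^esub> s \<and> xs = us @ [s, t] @ vs \<and> ys = us @ [t, s] @ vs)"

definition fully_commutative :: "('w, 'x) monoid_scheme \<Rightarrow> 'w set \<Rightarrow> 'w set" where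
  "fully_commutative G S = {w \<in> carrier G.
    \<forall>xs \<in> reduced_expressions G S w. \<forall>ys \<in> reduced_expressions G S w.
      (commutation_step G)\<^sup>*\<^sup>* xs ys}"

section \<open>Star reducibility\<close>

fun alt_word :: "'w \<Rightarrow> 'w \<Rightarrow> nat \<Rightarrow> 'w list" where
  "alt_word s t 0 = []"
| "alt_word s t (Suc n) = s # alt_word t s n"

definition no_left_descent :: "('w, 'x) monoid_scheme \<Rightarrow> 'w set \<Rightarrow> 'w set \<Rightarrow> 'w set" where
  "no_left_descent G S I =
    {w \<in> carrier G. \<forall>s \<in> I. cox_length G S w < cox_length G S (s \<otimes>\<^bsub>G\<^esub> w)}"

definition no_right_descent :: "('w, 'x) monoid_scheme \<Rightarrow> 'w set \<Rightarrow> 'w set \<Rightarrow> 'w set" where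
  "no_right_descent G S I =
    {w \<in> carrier G. \<forall>s \<in> I. cox_length G S w < cox_length G S (w \<otimes>\<^bsub>G\<^esub> s)}"

text \<open>
  For \<open>u\<close> without left descents in \<open>{s, t}\<close>, \<open>left_string G m s t u\<close> is the string
  \<open>s u, t s u, s t s u, \<dots>\<close> with \<open>m(s, t) - 1\<close> elements (infinite if \<open>m(s, t) = \<infinity>\<close>);
  the other string of the coset, \<open>t u, s t u, \<dots>\<close>, is \<open>left_string G m t s u\<close>.
  Such a \<open>u\<close> is the factor \<open>w\<^sup>I\<close> of every element \<open>w\<close> of these strings.
\<close>

definition left_string ::
  "('w, 'x) monoid_scheme \<Rightarrow> ('w \<Rightarrow> 'w \<Rightarrow> enat) \<Rightarrow> 'w \<Rightarrow> 'w \<Rightarrow> 'w \<Rightarrow> 'w set" where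
  "left_string G m s t u =
    {word_prod G (rev (alt_word s t i)) \<otimes>\<^bsub>G\<^esub> u | i. 1 \<le> i \<and> enat i < m s t}"

definition right_string ::
  "('w, 'x) monoid_scheme \<Rightarrow> ('w \<Rightarrow> 'w \<Rightarrow> enat) \<Rightarrow> 'w \<Rightarrow> 'w \<Rightarrow> 'w \<Rightarrow> 'w set" where
  "right_string G m s t u =
    {u \<otimes>\<^bsub>G\<^esub> word_prod G (alt_word s t i) | i. 1 \<le> i \<and> enat i < m s t}"

definition left_star_reducible_to ::
  "('w, 'x) monoid_scheme \<Rightarrow> 'w set \<Rightarrow> ('w \<Rightarrow> 'w \<Rightarrow> enat) \<Rightarrow> 'w \<Rightarrow> 'w \<Rightarrow> bool" where
  "left_star_reducible_to G S m y x \<longleftrightarrow>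
    (\<exists>s \<in> S. \<exists>t \<in> S. s \<otimes>\<^bsub>G\<^esub> t \<noteq> t \<otimes>\<^bsub>G\<^esub> s \<and>
      (\<exists>u \<in> no_left_descent G S {s, t}. x \<in> left_string G m s t u \<and> y \<in> left_string G m s t u) \<and>
      cox_length G S y = cox_length G S x + 1)"

definition right_star_reducible_to ::
  "('w, 'x) monoid_scheme \<Rightarrow> 'w set \<Rightarrow> ('w \<Rightarrow> 'w \<Rightarrow> enat) \<Rightarrow> 'w \<Rightarrow> 'w \<Rightarrow> bool" where
  "right_star_reducible_to G S m y x \<longleftrightarrow>
    (\<exists>s \<in> S. \<exists>t \<in> S. s \<otimes>\<^bsub>G\<^esub> t \<noteq> t \<otimes>\<^bsub>G\<^esub> s \<and>
      (\<exists>u \<in> no_right_descent G S {s, t}. x \<in> right_string G m s t u \<and> y \<in> right_string G m s t u) \<and>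
      cox_length G S y = cox_length G S x + 1)"

definition commuting_products :: "('w, 'x) monoid_scheme \<Rightarrow> 'w set \<Rightarrow> 'w set" where
  "commuting_products G S = {word_prod G ws | ws. ws \<in> lists S \<and> distinct ws \<and>
    (\<forall>s \<in> set ws. \<forall>t \<in> set ws. s \<otimes>\<^bsub>G\<^esub> t = t \<otimes>\<^bsub>G\<^esub> s)}"

definition star_reducible ::
  "('w, 'x) monoid_scheme \<Rightarrow> 'w set \<Rightarrow> ('w \<Rightarrow> 'w \<Rightarrow> enat) \<Rightarrow> bool" where
  "star_reducible G S m \<longleftrightarrow>
    (\<forall>w \<in> fully_commutative G S. \<exists>z \<in> commuting_products G S.
      (\<lambda>y x. left_star_reducible_to G S m y x \<or> right_star_reducible_to G S m y x)\<^sup>*\<^sup>* w z)"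

section \<open>Hecke algebras\<close>

text \<open>
  Finitely supported functions \<open>\<int> \<rightarrow> \<int>\<close> under convolution: \<open>\<Sum>\<^sub>k a\<^sub>k v\<^sup>k\<close> is represented
  by \<open>k \<mapsto> a\<^sub>k\<close>.
\<close>

type_synonym laurent = "int \<Rightarrow>\<^sub>0 int"

definition vpow :: "int \<Rightarrow> laurent" where
  "vpow k = Poly_Mapping.single k 1"

definition laurent_ring :: "laurent ring" where
  "laurent_ring = ring_of_type_algebra"

definition laurent_neg_ring :: "laurent ring" where \<comment> \<open>\<open>\<int>[v\<^sup>-\<^sup>1]\<close>\<close>
  "laurent_neg_ring = laurent_ring\<lparr>carrier := {a. \<forall>k \<in> Poly_Mapping.keys a. k \<le> 0}\<rparr>"

text \<open>
  \<open>H\<close> is an associative unital algebra over the Laurent polynomials (the library locale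
  \<open>algebra\<close> is restricted to commutative algebras), with basis \<open>T w\<close> for \<open>w\<close> in \<open>W\<close>,
  unit \<open>T 1\<close>, and the multiplication rule with \<open>q = v\<^sup>2\<close>.  These conditions determine
  \<open>(H, T)\<close> up to unique isomorphism.
\<close>

locale hecke_algebra =
  H: ring H + H: module laurent_ring H
  for G :: "('w, 'x) monoid_scheme" and S :: "'w set"
    and H :: "(laurent, 'h, 'y) module_scheme" and T :: "'w \<Rightarrow> 'h" +
  assumes smult_mult_left: "\<lbrakk>x \<in> carrier H; y \<in> carrier H\<rbrakk>
      \<Longrightarrow> (a \<odot>\<^bsub>H\<^esub> x) \<otimes>\<^bsub>H\<^esub> y = a \<odot>\<^bsub>H\<^esub> (x \<otimes>\<^bsub>H\<^esub> y)"
    and smult_mult_right: "\<lbrakk>x \<in> carrier H; y \<in> carrier H\<rbrakk>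
      \<Longrightarrow> x \<otimes>\<^bsub>H\<^esub> (a \<odot>\<^bsub>H\<^esub> y) = a \<odot>\<^bsub>H\<^esub> (x \<otimes>\<^bsub>H\<^esub> y)"
    and T_closed: "w \<in> carrier G \<Longrightarrow> T w \<in> carrier H"
    and T_basis: "h \<in> carrier H \<Longrightarrow>
      \<exists>!c :: 'w \<Rightarrow>\<^sub>0 laurent. Poly_Mapping.keys c \<subseteq> carrier G \<and>
        h = (\<Oplus>\<^bsub>H\<^esub>w \<in> Poly_Mapping.keys c. Poly_Mapping.lookup c w \<odot>\<^bsub>H\<^esub> T w)"
    and T_one: "T \<one>\<^bsub>G\<^esub> = \<one>\<^bsub>H\<^esub>"
    and T_mult_up: "\<lbrakk>s \<in> S; w \<in> carrier G; cox_length G S (s \<otimes>\<^bsub>G\<^esub> w) > cox_length G S w\<rbrakk>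
      \<Longrightarrow> T s \<otimes>\<^bsub>H\<^esub> T w = T (s \<otimes>\<^bsub>G\<^esub> w)"
    and T_mult_down: "\<lbrakk>s \<in> S; w \<in> carrier G; cox_length G S (s \<otimes>\<^bsub>G\<^esub> w) < cox_length G S w\<rbrakk>
      \<Longrightarrow> T s \<otimes>\<^bsub>H\<^esub> T w = vpow 2 \<odot>\<^bsub>H\<^esub> T (s \<otimes>\<^bsub>G\<^esub> w) \<oplus>\<^bsub>H\<^esub> (vpow 2 - 1) \<odot>\<^bsub>H\<^esub> T w"

definition T_tilde ::
  "('w, 'x) monoid_scheme \<Rightarrow> 'w set \<Rightarrow> (laurent, 'h, 'y) module_scheme \<Rightarrow> ('w \<Rightarrow> 'h) \<Rightarrow> 'w \<Rightarrow> 'h" where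
  "T_tilde G S H T w = vpow (- int (cox_length G S w)) \<odot>\<^bsub>H\<^esub> T w"

section \<open>Generalized Temperley--Lieb algebras\<close>

definition quotient_algebra ::
  "('a, 'h, 'y) module_scheme \<Rightarrow> 'h set \<Rightarrow> ('a, 'h set) module" where
  "quotient_algebra H J =
    \<lparr>carrier = carrier (H Quot J), monoid.mult = monoid.mult (H Quot J),
     one = \<one>\<^bsub>H Quot J\<^esub>, ring.zero = \<zero>\<^bsub>H Quot J\<^esub>, add = ring.add (H Quot J),
     module.smult = (\<lambda>a K. \<Union>x \<in> K. J +>\<^bsub>H\<^esub> (a \<odot>\<^bsub>H\<^esub> x))\<rparr>"

text \<open>The union in the scalar action is over equal cosets when \<open>J\<close> is an ideal.\<close>

lemma (in hecke_algebra) quotient_algebra_smult: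
  assumes J: "ideal J H" and x: "x \<in> carrier H"
  shows "a \<odot>\<^bsub>quotient_algebra H J\<^esub> (J +>\<^bsub>H\<^esub> x) = J +>\<^bsub>H\<^esub> (a \<odot>\<^bsub>H\<^esub> x)"
proof -
  interpret J: ideal J H by fact
  have a: "a \<in> carrier laurent_ring" by (simp add: laurent_ring_def ring_of_type_algebra_def)
  have *: "J +>\<^bsub>H\<^esub> (a \<odot>\<^bsub>H\<^esub> y) = J +>\<^bsub>H\<^esub> (a \<odot>\<^bsub>H\<^esub> x)" if y: "y \<in> J +>\<^bsub>H\<^esub> x" for y
  proof -
    obtain j where j: "j \<in> J" "y = j \<oplus>\<^bsub>H\<^esub> x" using y by (auto simp: a_r_coset_def r_coset_def)
    have jc: "j \<in> carrier H" using j J.a_subset by auto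
    have "a \<odot>\<^bsub>H\<^esub> j = (a \<odot>\<^bsub>H\<^esub> \<one>\<^bsub>H\<^esub>) \<otimes>\<^bsub>H\<^esub> j"
      using smult_mult_left[of "\<one>\<^bsub>H\<^esub>" j a] jc by simp
    hence aj: "a \<odot>\<^bsub>H\<^esub> j \<in> J" using j a by (simp add: J.I_l_closed)
    have "a \<odot>\<^bsub>H\<^esub> y = a \<odot>\<^bsub>H\<^esub> j \<oplus>\<^bsub>H\<^esub> a \<odot>\<^bsub>H\<^esub> x"
      using j jc x a by (simp add: H.smult_r_distr)
    hence ay: "a \<odot>\<^bsub>H\<^esub> y \<in> J +>\<^bsub>H\<^esub> (a \<odot>\<^bsub>H\<^esub> x)"
      using aj unfolding a_r_coset_def r_coset_def by auto
    have ax: "a \<odot>\<^bsub>H\<^esub> x \<in> carrier H" using a x by (rule H.smult_closed)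
    show ?thesis
      using J.a_repr_independence'[OF ay ax] by (rule HOL.sym)
  qed
  have x': "x \<in> J +>\<^bsub>H\<^esub> x" using x by (rule J.a_rcos_self)
  have "(\<Union>y \<in> J +>\<^bsub>H\<^esub> x. J +>\<^bsub>H\<^esub> (a \<odot>\<^bsub>H\<^esub> y)) = J +>\<^bsub>H\<^esub> (a \<odot>\<^bsub>H\<^esub> x)"
    using * x' by blast
  thus ?thesis by (simp only: quotient_algebra_def module.simps)
qed

text \<open>
  For \<open>m(s, t) < \<infinity>\<close> the subgroup generated by \<open>s\<close> and \<open>t\<close> is a finite dihedral group, so the
  sums below are genuine finite sums.
\<close>

definition TL_ideal ::
  "('w, 'x) monoid_scheme \<Rightarrow> 'w set \<Rightarrow> ('w \<Rightarrow> 'w \<Rightarrow> enat) \<Rightarrow>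
   (laurent, 'h, 'y) module_scheme \<Rightarrow> ('w \<Rightarrow> 'h) \<Rightarrow> 'h set" where
  "TL_ideal G S m H T =
    Idl\<^bsub>H\<^esub> {\<Oplus>\<^bsub>H\<^esub>u \<in> generate G {s, t}. T u | s t. s \<in> S \<and> t \<in> S \<and> 3 \<le> m s t \<and> m s t < \<infinity>}"

definition TL ::
  "('w, 'x) monoid_scheme \<Rightarrow> 'w set \<Rightarrow> ('w \<Rightarrow> 'w \<Rightarrow> enat) \<Rightarrow>
   (laurent, 'h, 'y) module_scheme \<Rightarrow> ('w \<Rightarrow> 'h) \<Rightarrow> (laurent, 'h set) module" where
  "TL G S m H T = quotient_algebra H (TL_ideal G S m H T)"

definition t_tilde ::
  "('w, 'x) monoid_scheme \<Rightarrow> 'w set \<Rightarrow> ('w \<Rightarrow> 'w \<Rightarrow> enat) \<Rightarrow>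
   (laurent, 'h, 'y) module_scheme \<Rightarrow> ('w \<Rightarrow> 'h) \<Rightarrow> 'w \<Rightarrow> 'h set" where
  "t_tilde G S m H T w = TL_ideal G S m H T +>\<^bsub>H\<^esub> T_tilde G S H T w"

definition TL_lattice ::
  "('w, 'x) monoid_scheme \<Rightarrow> 'w set \<Rightarrow> ('w \<Rightarrow> 'w \<Rightarrow> enat) \<Rightarrow>
   (laurent, 'h, 'y) module_scheme \<Rightarrow> ('w \<Rightarrow> 'h) \<Rightarrow> 'h set set" where
  "TL_lattice G S m H T =
    \<Inter>{N. submodule N laurent_neg_ring (TL G S m H T) \<and>
        t_tilde G S m H T ` fully_commutative G S \<subseteq> N}"

end

theory Submission
  imports
    Defs
    "HOL-Library.Sublist"
    "HOL-Library.Function_Algebras"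
begin

text \<open>
  Write \<open>L\<^sub>x\<close> for the span over \<open>\<int>[v\<^sup>-\<^sup>1]\<close> of the \<open>t\<^sub>z\<close> with \<open>z\<close> fully commutative and below \<open>x\<close> in the
  Bruhat order.  By induction on the length of \<open>w\<close>, simultaneously for left and right multiplication,
  \<open>t\<^sub>x\<close> lies in \<open>v\<^sup>-\<^sup>1 L\<^sub>x\<close> for \<open>x = s w\<close>.

  If \<open>x\<close> starts with the longest element of \<open>\<langle>s, r\<rangle>\<close>, the defining relation of the quotient expresses
  \<open>t\<^sub>x\<close> through shorter elements of the same coset.  Otherwise a star reduction of \<open>w\<close> produces
  \<open>x = q y\<close> (or \<open>x = y q\<close>) with \<open>y\<close> covered by the induction hypothesis, and \<open>y\<close> has a descent \<open>p\<close> not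
  commuting with \<open>q\<close>.  Comparing both sides of \<open>t\<^sub>p t\<^sub>y = t\<^sub>p\<^sub>y + (v - v\<^sup>-\<^sup>1) t\<^sub>y\<close> shows that, modulo
  \<open>v\<^sup>-\<^sup>2 L\<^sub>y\<close>, the element \<open>t\<^sub>y\<close> only involves \<open>v\<^sup>-\<^sup>1 t\<^sub>p\<^sub>y\<close> and terms \<open>v\<^sup>-\<^sup>1 t\<^sub>z\<close> for which \<open>p\<close> is a descent
  of \<open>z\<close>.  A fully commutative \<open>z\<close> cannot have both \<open>p\<close> and \<open>q\<close> as descents, so multiplication by \<open>t\<^sub>q\<close>
  does not raise the degree of these terms.
\<close>

section \<open>Words, lengths and the exchange condition\<close>

text \<open>Knowing \<open>t_y\<close> in \<open>v^-1 L_y\<close> does not suffice: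
  \<open>t_q\<close> multiplies each \<open>t_z\<close> with descent \<open>q\<close> by
  \<open>v - v^-1\<close> up to a harmless term, which may consume the whole gain. The second
  generator \<open>p\<close> controls exactly these \<open>z\<close>. On terms with descent
  \<open>p\<close>, \<open>t_p\<close> acts as \<open>v - v^-1\<close> up to \<open>L_y\<close>,
  just as it does on \<open>t_y\<close> up to \<open>t_(py)\<close>; such terms cancel from the
  comparison. What remains are the terms without descent \<open>p\<close>, now known to be one
  degree smaller apart from the explicit \<open>t_(py)\<close>. These include all terms with descent
  \<open>q\<close>.

  A star reduction enters through its first step: a descent \<open>q\<close> of \<open>w\<close>
  followed by a descent \<open>p\<close> of \<open>q w\<close> not commuting with \<open>q\<close>.

  The group is given by a presentation. Exchange comes from the parity of reflections. That
  \<open>s t\<close> has order exactly \<open>m s t\<close>, on which all lengths in dihedral cosets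
  rest, comes from the geometric representation. Right-handed facts are left-handed facts for the
  opposite group.\<close>

lemma word_prod_Nil [simp]: "word_prod G [] = \<one>\<^bsub>G\<^esub>"
  and word_prod_Cons [simp]: "word_prod G (x # xs) = x \<otimes>\<^bsub>G\<^esub> word_prod G xs"
  by (simp_all add: word_prod_def)

text \<open>For \<open>[s1, ..., sk]\<close> these are the conjugates
  \<open>s1 ... si ... s1\<close>. If the word is reduced they are the left inversions of its
  product; in general the parity of each multiplicity depends on the product alone, which is what
  yields exchange.\<close>

primrec reflections :: "('w, 'x) monoid_scheme \<Rightarrow> 'w list \<Rightarrow> 'w list" where
  "reflections G [] = []"
| "reflections G (s # ws) = s # map (\<lambda>r. s \<otimes>\<^bsub>G\<^esub> r \<otimes>\<^bsub>G\<^esub> s) (reflections G ws)"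

context coxeter_system
begin

abbreviation wprod :: "'w list \<Rightarrow> 'w" where "wprod \<equiv> word_prod G"
abbreviation len :: "'w \<Rightarrow> nat" where "len \<equiv> cox_length G S"
abbreviation FC :: "'w set" where "FC \<equiv> fully_commutative G S"

definition ldesc :: "'w \<Rightarrow> 'w set" where
  "ldesc w = {s \<in> S. len (s \<otimes> w) < len w}"

definition reduced :: "'w list \<Rightarrow> bool" where
  "reduced ws \<longleftrightarrow> ws \<in> lists S \<and> len (wprod ws) = length ws"

declare in_lists_conv_set [simp] ball_Un [simp]

lemma inv_cancel_left [simp]:
  "g \<in> carrier G \<Longrightarrow> w \<in> carrier G \<Longrightarrow> inv g \<otimes> (g \<otimes> w) = w"
  by (simp flip: m_assoc)

lemma gen_closed [simp, intro]: "s \<in> S \<Longrightarrow> s \<in> carrier G"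
  using gens_subset by auto

lemma wprod_closed [simp, intro]: "ws \<in> lists S \<Longrightarrow> wprod ws \<in> carrier G"
  by (induction ws) auto

lemma wprod_append:
  "us \<in> lists S \<Longrightarrow> vs \<in> lists S \<Longrightarrow> wprod (us @ vs) = wprod us \<otimes> wprod vs"
  by (induction us) (auto simp: m_assoc)

lemma gen_square [simp]:
  assumes "s \<in> S" shows "s \<otimes> s = \<one>"
proof -
  have "coxeter_cong S m ([] @ concat (replicate 1 [s, s]) @ []) ([] @ [])"
    using assms matrix_diag[OF assms] by (intro coxeter_cong.relator) (auto simp: one_enat_def)
  hence "coxeter_cong S m [s, s] []" by simp
  thus ?thesis using presentation[of "[s, s]" "[]"] assms by simp
qed

lemma gen_cancel [simp]:
  assumes "s \<in> S" "w \<in> carrier G" shows "s \<otimes> (s \<otimes> w) = w"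
  using assms by (simp flip: m_assoc)

lemma gen_cancel_right [simp]:
  assumes "s \<in> S" "w \<in> carrier G" shows "w \<otimes> s \<otimes> s = w"
  using assms by (simp add: m_assoc)

lemma gen_inv [simp]: "s \<in> S \<Longrightarrow> inv s = s"
  by (simp add: inv_equality)

lemma wprod_rev:
  "ws \<in> lists S \<Longrightarrow> wprod (rev ws) = inv (wprod ws)"
  by (induction ws) (auto simp: wprod_append inv_mult_group)

lemma word_exists:
  assumes "w \<in> carrier G" shows "\<exists>ws \<in> lists S. wprod ws = w"
proof -
  have "w \<in> generate G S" using assms gens_generate by simp
  thus ?thesis
  proof induction
    case one thus ?case by (intro bexI[of _ "[]"]) auto
  next
    case (incl h) thus ?case by (intro bexI[of _ "[h]"]) auto
  next
    case (inv h) thus ?case by (intro bexI[of _ "[h]"]) auto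
  next
    case (eng h1 h2)
    then obtain us vs where "us \<in> lists S" "vs \<in> lists S" "wprod us = h1" "wprod vs = h2" by blast
    thus ?case by (intro bexI[of _ "us @ vs"]) (auto simp: wprod_append)
  qed
qed

lemma len_le: "ws \<in> lists S \<Longrightarrow> len (wprod ws) \<le> length ws"
  unfolding cox_length_def by (rule Least_le) auto

lemma reduced_exists:
  assumes "w \<in> carrier G" shows "\<exists>ws. reduced ws \<and> wprod ws = w"
proof -
  obtain ws where "ws \<in> lists S" "wprod ws = w" using word_exists[OF assms] by blast
  hence "\<exists>n. \<exists>ws \<in> lists S. length ws = n \<and> wprod ws = w" by blast
  from LeastI_ex[OF this] have "\<exists>ws \<in> lists S. length ws = len w \<and> wprod ws = w"
    by (simp only: cox_length_def)
  thus ?thesis by (auto simp: reduced_def)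
qed

lemma reduced_lists: "reduced ws \<Longrightarrow> ws \<in> lists S"
  and reduced_len: "reduced ws \<Longrightarrow> len (wprod ws) = length ws"
  by (simp_all add: reduced_def)

lemma reduced_expressions_eq:
  "reduced_expressions G S w = {ws. reduced ws \<and> wprod ws = w}"
  by (auto simp: reduced_expressions_def reduced_def)

lemma len_one [simp]: "len \<one> = 0"
  using len_le[of "[]"] by simp

lemma len_mult_le:
  assumes "x \<in> carrier G" "y \<in> carrier G" shows "len (x \<otimes> y) \<le> len x + len y"
proof -
  obtain us vs where "reduced us" "wprod us = x" "reduced vs" "wprod vs = y"
    using reduced_exists assms by metis
  thus ?thesis using len_le[of "us @ vs"] by (auto simp: reduced_def wprod_append)
qed

lemma length_relator_even: "length (concat (replicate k [s, t])) = 2 * k"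
  by (induction k) auto

lemma cong_lists: "coxeter_cong S m us vs \<Longrightarrow> us \<in> lists S \<and> vs \<in> lists S"
proof (induction rule: coxeter_cong.induct)
  case (relator s t k us vs)
  have "concat (replicate k [s, t]) \<in> lists S" using relator by (induction k) auto
  thus ?case using relator by auto
qed auto

text \<open>Every relator \<open>(s t)^k\<close> has even length, so the presentation carries a sign
  character. It forces multiplication by a generator to change the length.\<close>

lemma cong_even: "coxeter_cong S m us vs \<Longrightarrow> even (length us) = even (length vs)"
  by (induction rule: coxeter_cong.induct) (auto simp: length_relator_even)

lemma len_even:
  assumes "ws \<in> lists S" shows "even (len (wprod ws)) = even (length ws)"
proof -
  obtain vs where vs: "reduced vs" "wprod vs = wprod ws"
    using reduced_exists[OF wprod_closed[OF assms]] by blast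
  hence "coxeter_cong S m vs ws" using presentation assms by (auto simp: reduced_def)
  thus ?thesis using cong_even vs by (fastforce simp: reduced_def)
qed

lemma len_gen [simp]: "s \<in> S \<Longrightarrow> len s = 1"
  using len_even[of "[s]"] len_le[of "[s]"] by (cases "len s") auto

lemma len_mult_gen:
  assumes "s \<in> S" "w \<in> carrier G"
  shows "len (s \<otimes> w) = Suc (len w) \<or> len w = Suc (len (s \<otimes> w))"
proof -
  obtain ws where ws: "reduced ws" "wprod ws = w" using reduced_exists assms by blast
  have 1: "len (s \<otimes> w) \<le> Suc (len w)" using len_mult_le[of s w] assms by simp
  have 2: "len w \<le> Suc (len (s \<otimes> w))" using len_mult_le[of s "s \<otimes> w"] assms by simp
  have "even (len (s \<otimes> w)) \<noteq> even (len w)"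
    using len_even[of "s # ws"] len_even[of ws] ws assms by (auto simp: reduced_def)
  hence "len (s \<otimes> w) \<noteq> len w" by metis
  thus ?thesis using 1 2 by linarith
qed

section \<open>Left descents and reduced words\<close>

lemma ldescD: "s \<in> ldesc w \<Longrightarrow> s \<in> S" "s \<in> ldesc w \<Longrightarrow> len (s \<otimes> w) < len w"
  by (auto simp: ldesc_def)

lemma len_ldesc: "w \<in> carrier G \<Longrightarrow> s \<in> ldesc w \<Longrightarrow> len w = Suc (len (s \<otimes> w))"
  using len_mult_gen[of s w] by (auto simp: ldesc_def)

lemma len_not_ldesc:
  "w \<in> carrier G \<Longrightarrow> s \<in> S \<Longrightarrow> s \<notin> ldesc w \<Longrightarrow> len (s \<otimes> w) = Suc (len w)"
  using len_mult_gen[of s w] by (auto simp: ldesc_def)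

lemma not_ldesc_mult: "w \<in> carrier G \<Longrightarrow> s \<in> ldesc w \<Longrightarrow> s \<notin> ldesc (s \<otimes> w)"
  by (auto simp: ldesc_def)

lemma ldesc_mult_iff: "w \<in> carrier G \<Longrightarrow> s \<in> S \<Longrightarrow> s \<in> ldesc (s \<otimes> w) \<longleftrightarrow> s \<notin> ldesc w"
  using len_mult_gen[of s w] by (auto simp: ldesc_def)

lemma reduced_Cons_iff:
  assumes "reduced ws" "s \<in> S"
  shows "reduced (s # ws) \<longleftrightarrow> s \<notin> ldesc (wprod ws)"
proof -
  have l: "ws \<in> lists S" "len (wprod ws) = length ws" using assms by (auto simp: reduced_def)
  have "reduced (s # ws) \<longleftrightarrow> len (s \<otimes> wprod ws) = Suc (length ws)"
    using assms l by (auto simp: reduced_def)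
  moreover have "s \<in> ldesc (wprod ws) \<longleftrightarrow> len (s \<otimes> wprod ws) < length ws"
    using assms l by (simp add: ldesc_def)
  moreover have "len (s \<otimes> wprod ws) = Suc (length ws) \<or> length ws = Suc (len (s \<otimes> wprod ws))"
    using len_mult_gen[of s "wprod ws"] assms l by simp
  ultimately show ?thesis by linarith
qed

lemma reduced_appendD:
  assumes "reduced (us @ vs)" shows "reduced us" "reduced vs"
proof -
  have l: "us \<in> lists S" "vs \<in> lists S" using assms by (auto simp: reduced_def)
  hence "len (wprod (us @ vs)) \<le> len (wprod us) + len (wprod vs)"
    by (simp add: wprod_append len_mult_le)
  thus "reduced us" "reduced vs" using l len_le[of us] len_le[of vs] assms
    by (auto simp: reduced_def)
qed

lemma reduced_ConsD:
  assumes "reduced (s # ws)"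
  shows "s \<in> S" "reduced ws" "s \<in> ldesc (wprod (s # ws))" "s \<notin> ldesc (wprod ws)"
proof -
  show 1: "s \<in> S" "reduced ws"
    using assms reduced_appendD(2)[of "[s]" ws] by (auto simp: reduced_def)
  thus "s \<notin> ldesc (wprod ws)" using assms reduced_Cons_iff by blast
  show "s \<in> ldesc (wprod (s # ws))" using 1 assms by (auto simp: ldesc_def reduced_def)
qed

lemma reduced_Cons_exists:
  assumes "w \<in> carrier G" "s \<in> ldesc w"
  shows "\<exists>ws. reduced (s # ws) \<and> wprod ws = s \<otimes> w"
proof -
  have s: "s \<in> S" using assms by (simp add: ldesc_def)
  then obtain ws where "reduced ws" "wprod ws = s \<otimes> w"
    using reduced_exists[of "s \<otimes> w"] assms by auto
  moreover have "reduced (s # ws)" using calculation assms s not_ldesc_mult reduced_Cons_iff by simp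
  ultimately show ?thesis by blast
qed

subsection \<open>Parity of reflections\<close>

lemma wprod_relator:
  assumes "s \<in> S" "t \<in> S"
  shows "wprod (concat (replicate k [s, t])) = (s \<otimes> t) [^] k"
proof (induction k)
  case (Suc k)
  have "(s \<otimes> t) [^] Suc k = s \<otimes> t \<otimes> (s \<otimes> t) [^] k"
    by (rule nat_pow_Suc2) (use assms in auto)
  thus ?case using Suc assms by (simp add: m_assoc del: nat_pow_Suc)
qed simp

lemma relator_one:
  assumes "s \<in> S" "t \<in> S" "m s t = enat n" shows "(s \<otimes> t) [^] n = \<one>"
proof -
  let ?R = "concat (replicate n [s, t])"
  have "coxeter_cong S m ([] @ ?R @ []) ([] @ [])"
    using assms by (intro coxeter_cong.relator) auto
  hence "wprod ?R = \<one>" using presentation[of ?R "[]"] cong_lists by fastforce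
  thus ?thesis by (simp add: wprod_relator assms)
qed

lemma reflections_carrier: "ws \<in> lists S \<Longrightarrow> set (reflections G ws) \<subseteq> carrier G"
  by (induction ws) auto

lemma reflections_append:
  assumes "us \<in> lists S" "vs \<in> lists S"
  shows "reflections G (us @ vs)
    = reflections G us @ map (\<lambda>r. wprod us \<otimes> r \<otimes> inv (wprod us)) (reflections G vs)"
  using assms reflections_carrier[OF assms(2)]
  by (induction us)
    (auto simp: inv_mult_group m_assoc subset_iff intro!: map_idI[symmetric])

lemma reflections_relator:
  assumes "s \<in> S" "t \<in> S"
  shows "reflections G (concat (replicate k [s, t])) = map (\<lambda>i. (s \<otimes> t) [^] i \<otimes> s) [0..<2 * k]"
proof (induction k)
  case (Suc k)
  have "s \<otimes> (t \<otimes> ((s \<otimes> t) [^] i \<otimes> s) \<otimes> t) \<otimes> s = (s \<otimes> t) [^] Suc (Suc i) \<otimes> s" for i :: nat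
  proof -
    have "(s \<otimes> t) [^] Suc (Suc i) = s \<otimes> t \<otimes> (s \<otimes> t) [^] i \<otimes> (s \<otimes> t)"
      using assms nat_pow_mult[of "s \<otimes> t" 1 i] by (simp add: nat_pow_Suc)
    thus ?thesis using assms by (simp add: m_assoc)
  qed
  hence "map (\<lambda>r. s \<otimes> (t \<otimes> r \<otimes> t) \<otimes> s) (reflections G (concat (replicate k [s, t])))
    = map (\<lambda>i. (s \<otimes> t) [^] i \<otimes> s) (map (\<lambda>i. Suc (Suc i)) [0..<2 * k])"
    by (simp add: Suc.IH)
  moreover have "[0..<Suc (Suc n)] = 0 # 1 # map (\<lambda>i. Suc (Suc i)) [0..<n]" for n
    by (induction n) auto
  hence "[0..<2 * Suc k] = 0 # 1 # map (\<lambda>i. Suc (Suc i)) [0..<2 * k]" by simp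
  ultimately show ?case using assms by (simp add: o_def)
qed simp

text \<open>Because \<open>(s t)^k = 1\<close>, the reflections \<open>(s t)^i s\<close> have period
  \<open>k\<close> in \<open>i\<close>, so the second half of the list copies the first.\<close>

lemma count_relator_even:
  assumes "s \<in> S" "t \<in> S" "m s t = enat k"
  shows "even (count_list (reflections G (concat (replicate k [s, t]))) r)"
proof -
  let ?f = "\<lambda>i::nat. (s \<otimes> t) [^] i \<otimes> s"
  note p = relator_one[OF assms]
  have f: "?f (i + k) = ?f i" for i
    using assms nat_pow_mult[of "s \<otimes> t" i k] by (simp add: p)
  have "[0..<2 * k] = [0..<k] @ map (\<lambda>i. i + k) [0..<k]"
    using upt_add_eq_append[of 0 k k] by (simp add: map_add_upt mult_2)
  hence "map ?f [0..<2 * k] = map ?f [0..<k] @ map ?f [0..<k]"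
    by (simp add: o_def f)
  thus ?thesis by (simp add: reflections_relator assms)
qed

lemma count_list_map_inj:
  "inj_on f (insert x (set xs)) \<Longrightarrow> count_list (map f xs) (f x) = count_list xs x"
  by (induction xs) (auto simp: inj_on_def)

lemma count_list_conj:
  assumes "g \<in> carrier G" "r \<in> carrier G" "set rs \<subseteq> carrier G"
  shows "count_list (map (\<lambda>r. g \<otimes> r \<otimes> inv g) rs) r = count_list rs (inv g \<otimes> r \<otimes> g)"
proof -
  have inj: "inj_on (\<lambda>r. g \<otimes> r \<otimes> inv g) (carrier G)"
    using assms by (auto simp: inj_on_def)
  have "g \<otimes> (inv g \<otimes> r \<otimes> g) \<otimes> inv g = r"
    using assms by (simp add: m_assoc flip: m_assoc[of g "inv g"])
  moreover have "inj_on (\<lambda>r. g \<otimes> r \<otimes> inv g) (insert (inv g \<otimes> r \<otimes> g) (set rs))"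
    by (rule inj_on_subset[OF inj]) (use assms in auto)
  ultimately show ?thesis using count_list_map_inj by fastforce
qed

lemma count_list_append: "count_list (xs @ ys) x = count_list xs x + count_list ys x"
  by (induction xs) auto

text \<open>A relator inserted in a word has product \<open>1\<close>, so it leaves the reflections
  of the suffix unchanged and contributes a conjugate of its own list, in which all multiplicities
  are even.\<close>

lemma cong_reflections_parity:
  assumes "coxeter_cong S m us vs" "r \<in> carrier G"
  shows "even (count_list (reflections G us) r) = even (count_list (reflections G vs) r)"
  using assms
proof (induction rule: coxeter_cong.induct)
  case (relator s t k us vs)
  let ?R = "concat (replicate k [s, t])"
  have R: "?R \<in> lists S" using relator by (induction k) auto
  have "wprod ?R = \<one>" using relator relator_one wprod_relator by simp
  hence "reflections G (?R @ vs) = reflections G ?R @ reflections G vs"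
    using reflections_append[OF R, of vs] reflections_carrier[of vs] relator
    by (auto simp: map_idI subset_iff)
  thus ?case using relator R reflections_carrier[of vs] reflections_carrier[OF R]
    count_relator_even[of s t k "inv (wprod us) \<otimes> r \<otimes> wprod us"]
    by (simp add: reflections_append count_list_append count_list_conj)
qed auto

text \<open>A listed reflection is a letter \<open>a\<close> conjugated by the prefix before it.
  Hence multiplying the word by it deletes that letter.\<close>

lemma reflections_delete:
  assumes "ws \<in> lists S" "r \<in> set (reflections G ws)"
  shows "\<exists>us a vs. ws = us @ a # vs \<and> r \<otimes> wprod us = wprod us \<otimes> a"
  using assms
proof (induction ws arbitrary: r)
  case (Cons s ws)
  show ?case
  proof (cases "r = s")
    case True
    have "s \<in> carrier G" using Cons.hyps by simp
    thus ?thesis using True by (intro exI[of _ "[]"]) auto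
  next
    case False
    then obtain r' where r': "r' \<in> set (reflections G ws)" "r = s \<otimes> r' \<otimes> s" using Cons.prems Cons.hyps by auto
    then obtain us a vs where u: "ws = us @ a # vs" "r' \<otimes> wprod us = wprod us \<otimes> a"
      using Cons.IH[of r'] Cons.prems Cons.hyps by auto
    have c: "r' \<in> carrier G" using r' reflections_carrier[of ws] Cons.prems Cons.hyps by auto
    have l: "us \<in> lists S" "a \<in> S" "s \<in> S" using u Cons.prems Cons.hyps by auto
    have "r \<otimes> wprod (s # us) = s \<otimes> (r' \<otimes> wprod us)" using l r' c by (simp add: m_assoc)
    thus ?thesis using u l by (intro exI[of _ "s # us"]) (auto simp: m_assoc)
  qed
qed simp

text \<open>If the head \<open>s\<close> reappeared as \<open>s r s\<close>, then
  \<open>r = s\<close> would be a reflection of the tail, so \<open>s\<close> times the tail would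
  lose a letter, although \<open>s # ws\<close> is reduced.\<close>

lemma reduced_distinct: "reduced ws \<Longrightarrow> distinct (reflections G ws)"
proof (induction ws)
  case (Cons s ws)
  note s = reduced_ConsD[OF Cons.prems]
  have ws: "ws \<in> lists S" using s by (simp add: reduced_def)
  have c: "set (reflections G ws) \<subseteq> carrier G" using ws by (rule reflections_carrier)
  have "inj_on (\<lambda>r. s \<otimes> r \<otimes> s) (carrier G)" using s by (auto simp: inj_on_def)
  hence "distinct (map (\<lambda>r. s \<otimes> r \<otimes> s) (reflections G ws))"
    using Cons.IH s c by (auto simp: distinct_map intro: inj_on_subset)
  moreover have "s \<noteq> s \<otimes> r \<otimes> s" if r: "r \<in> set (reflections G ws)" for r
  proof
    assume "s = s \<otimes> r \<otimes> s"
    hence "s \<otimes> s \<otimes> s = s \<otimes> (s \<otimes> r \<otimes> s) \<otimes> s" by simp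
    hence "r = s" using r c s by (auto simp: m_assoc subset_iff)
    then obtain us a vs where u: "ws = us @ a # vs" "s \<otimes> wprod us = wprod us \<otimes> a"
      using reflections_delete[OF ws] r by blast
    have l: "us \<in> lists S" "vs \<in> lists S" "a \<in> S" using u ws by auto
    have "s \<otimes> wprod ws = s \<otimes> wprod us \<otimes> (a \<otimes> wprod vs)"
      using u(1) l s by (simp add: wprod_append m_assoc)
    also have "\<dots> = wprod (us @ vs)" using u(2) l s by (simp add: wprod_append m_assoc)
    finally have "len (s \<otimes> wprod ws) \<le> length (us @ vs)" using len_le[of "us @ vs"] l
      by (metis append_in_lists_conv)
    thus False using Cons.prems u(1) by (simp add: reduced_def)
  qed
  ultimately show ?case by auto
qed simp

text \<open>In a reduced word starting with \<open>s\<close> the reflection \<open>s\<close> occurs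
  exactly once. By parity it then occurs in every word for the same element, reduced or not. The
  equation for the prefix \<open>us\<close> is kept because it locates the deleted letter, which
  later arguments exploit.\<close>

theorem exchange:
  assumes "ws \<in> lists S" "s \<in> ldesc (wprod ws)"
  shows "\<exists>us a vs. ws = us @ a # vs \<and> s \<otimes> wprod us = wprod us \<otimes> a \<and> s \<otimes> wprod ws = wprod (us @ vs)"
proof -
  have s: "s \<in> S" using assms by (simp add: ldesc_def)
  obtain vs where vs: "reduced (s # vs)" "wprod vs = s \<otimes> wprod ws"
    using reduced_Cons_exists assms by blast
  have "wprod (s # vs) = wprod ws" using vs s assms by simp
  hence "coxeter_cong S m (s # vs) ws"
    using presentation[of "s # vs" ws] assms vs(1) by (auto simp: reduced_def)
  moreover have "odd (count_list (reflections G (s # vs)) s)"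
    using reduced_distinct[OF vs(1)] by (auto simp: count_list_0_iff)
  ultimately have "odd (count_list (reflections G ws) s)"
    using cong_reflections_parity s by blast
  hence "s \<in> set (reflections G ws)" using count_list_0_iff by (metis even_zero)
  then obtain us a vs where u: "ws = us @ a # vs" "s \<otimes> wprod us = wprod us \<otimes> a"
    using reflections_delete[OF assms(1)] by blast
  have l: "us \<in> lists S" "vs \<in> lists S" "a \<in> S" using u assms by auto
  have "s \<otimes> wprod ws = s \<otimes> wprod us \<otimes> (a \<otimes> wprod vs)"
    using u(1) l s by (simp add: wprod_append m_assoc)
  also have "\<dots> = wprod (us @ vs)" using u(2) l s by (simp add: wprod_append m_assoc)
  finally show ?thesis using u by blast
qed

text \<open>Reading from the right, a letter either extends the reduced subword or, by exchange, is
  dropped together with one of its letters. This gives transitivity of the Bruhat order.\<close>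

lemma reduced_subseq:
  assumes "ws \<in> lists S"
  shows "\<exists>vs. subseq vs ws \<and> reduced vs \<and> wprod vs = wprod ws"
  using assms
proof (induction ws)
  case Nil thus ?case by (auto simp: reduced_def)
next
  case (Cons s ws)
  then obtain vs where vs: "subseq vs ws" "reduced vs" "wprod vs = wprod ws" by auto
  have s: "s \<in> S" using Cons by simp
  show ?case
  proof (cases "s \<in> ldesc (wprod vs)")
    case True
    then obtain as a bs where e: "vs = as @ a # bs" "s \<otimes> wprod vs = wprod (as @ bs)"
      using exchange vs by (metis reduced_lists)
    have "subseq (as @ bs) vs" using e list_emb_append_mono[of "(=)" as as bs "a # bs"] by auto
    hence "subseq (as @ bs) (s # ws)" using vs by (meson subseq_Cons' subseq_order.order_trans list_emb_Cons)
    moreover have "as @ bs \<in> lists S" using e vs by (auto simp: reduced_def)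
    moreover have "len (s \<otimes> wprod vs) = length (as @ bs)"
      using len_ldesc[OF wprod_closed[OF reduced_lists[OF vs(2)]] True] reduced_len[OF vs(2)] e(1)
      by simp
    ultimately have "reduced (as @ bs)" using e by (simp add: reduced_def)
    moreover have "wprod (as @ bs) = wprod (s # ws)" using e vs by simp
    ultimately show ?thesis using \<open>subseq (as @ bs) (s # ws)\<close> by blast
  next
    case False
    thus ?thesis using vs s reduced_Cons_iff by (intro exI[of _ "s # vs"]) auto
  qed
qed

end

section \<open>The order of a product of two generators\<close>

text \<open>The recurrence of the Chebyshev polynomials of the second kind. The solution is stated
  multiplied by \<open>sin \<theta>\<close>, which avoids a division.\<close>

lemma sin_recurrence_closed_form:
  fixes z :: "nat \<Rightarrow> real"
  assumes "\<And>j. z (Suc (Suc j)) = 2 * cos \<theta> * z (Suc j) - z j"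
  shows "sin \<theta> * z j = sin (real j * \<theta>) * z 1 - sin ((real j - 1) * \<theta>) * z 0"
proof (induction j rule: less_induct)
  case (less j)
  consider "j = 0" | "j = 1" | i where "j = Suc (Suc i)" by (cases j; cases "j - 1") auto
  thus ?case
  proof cases
    case 3
    have *: "sin (x + \<theta>) = 2 * cos \<theta> * sin x - sin (x - \<theta>)" for x
      by (simp add: sin_add sin_diff)
    have "sin \<theta> * z j = 2 * cos \<theta> * (sin \<theta> * z (Suc i)) - sin \<theta> * z i"
      using 3 arg_cong[OF assms[of i], of "\<lambda>x. sin \<theta> * x"] by (simp add: algebra_simps)
    also have "sin \<theta> * z (Suc i) = sin (real (Suc i) * \<theta>) * z 1 - sin (real i * \<theta>) * z 0"
      using less.IH[of "Suc i"] 3 by simp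
    also have "sin \<theta> * z i = sin (real (Suc i) * \<theta> - \<theta>) * z 1 - sin (real i * \<theta> - \<theta>) * z 0"
      using less.IH[of i] 3 by (simp add: algebra_simps)
    also have "2 * cos \<theta> * (sin (real (Suc i) * \<theta>) * z 1 - sin (real i * \<theta>) * z 0)
        - (sin (real (Suc i) * \<theta> - \<theta>) * z 1 - sin (real i * \<theta> - \<theta>) * z 0)
      = (2 * cos \<theta> * sin (real (Suc i) * \<theta>) - sin (real (Suc i) * \<theta> - \<theta>)) * z 1
        - (2 * cos \<theta> * sin (real i * \<theta>) - sin (real i * \<theta> - \<theta>)) * z 0"
      by (simp only: algebra_simps)
    also have "\<dots> = sin (real (Suc i) * \<theta> + \<theta>) * z 1 - sin (real i * \<theta> + \<theta>) * z 0"
      by (simp only: *)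
    finally show ?thesis using 3 by (simp add: algebra_simps)
  qed (auto simp: algebra_simps)
qed

text \<open>This is \<open>-2 B(s, u)\<close> for the standard bilinear form with
  \<open>B(s, u) = - cos (pi / m s u)\<close>, where an infinite entry of the matrix counts as
  \<open>B = -1\<close>.\<close>

definition geom_coeff :: "('w \<Rightarrow> 'w \<Rightarrow> enat) \<Rightarrow> 'w \<Rightarrow> 'w \<Rightarrow> real" where
  "geom_coeff m s u =
    (if s = u then -2 else case m s u of enat n \<Rightarrow> 2 * cos (pi / real n) | \<infinity> \<Rightarrow> 2)"

text \<open>
  The dual of the geometric representation, on functions on the set of generators.
\<close>

definition geom_refl :: "('w \<Rightarrow> 'w \<Rightarrow> enat) \<Rightarrow> 'w \<Rightarrow> ('w \<Rightarrow> real) \<Rightarrow> 'w \<Rightarrow> real" where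
  "geom_refl m s f = (\<lambda>u. f u + geom_coeff m s u * f s)"

abbreviation geom_act :: "('w \<Rightarrow> 'w \<Rightarrow> enat) \<Rightarrow> 'w list \<Rightarrow> ('w \<Rightarrow> real) \<Rightarrow> 'w \<Rightarrow> real" where
  "geom_act m ws \<equiv> foldr (geom_refl m) ws"

fun chebyshev_seq :: "real \<Rightarrow> real \<Rightarrow> real \<Rightarrow> nat \<Rightarrow> real" where
  "chebyshev_seq c a b 0 = a"
| "chebyshev_seq c a b (Suc 0) = b"
| "chebyshev_seq c a b (Suc (Suc j)) = c * chebyshev_seq c a b (Suc j) - chebyshev_seq c a b j"

context coxeter_system
begin

text \<open>A generator adds to \<open>f\<close> a multiple of a fixed function, namely its row of
  coefficients. Along the alternating word the successive multipliers depend only on the values at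
  \<open>s\<close> and \<open>t\<close> and satisfy the recurrence defining \<open>z\<close>; the
  values after \<open>k\<close> rounds are read off from the next two multipliers.\<close>

lemma geom_act_relator:
  fixes f :: "'w \<Rightarrow> real"
  assumes "s \<in> S" "t \<in> S" "s \<noteq> t"
  defines "c \<equiv> geom_coeff m s t"
  defines "z \<equiv> chebyshev_seq c (f t) (f s + c * f t)"
  shows "geom_act m (concat (replicate k [s, t])) f = (\<lambda>u. f u
      + geom_coeff m t u * (\<Sum>i<k. z (2 * i)) + geom_coeff m s u * (\<Sum>i<k. z (2 * i + 1)))
    \<and> geom_act m (concat (replicate k [s, t])) f t = z (2 * k)
    \<and> geom_act m (concat (replicate k [s, t])) f s = z (2 * k + 1) - c * z (2 * k)"
proof (induction k)
  case 0 thus ?case by (simp add: z_def)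
next
  case (Suc k)
  let ?g = "geom_act m (concat (replicate k [s, t])) f"
  have st: "geom_coeff m t s = c" "geom_coeff m s t = c"
    using assms matrix_sym[of s t] by (auto simp: geom_coeff_def)
  have d: "geom_coeff m x x = -2" for x by (simp add: geom_coeff_def)
  have z2: "z (Suc (Suc j)) = c * z (Suc j) - z j" for j by (simp add: z_def)
  have g: "?g t = z (2 * k)" "?g s = z (2 * k + 1) - c * z (2 * k)" using Suc by blast+
  have h: "geom_act m (concat (replicate (Suc k) [s, t])) f u
      = ?g u + geom_coeff m t u * z (2 * k) + geom_coeff m s u * z (2 * k + 1)" for u
    by (simp add: geom_refl_def g st)
  have "geom_act m (concat (replicate (Suc k) [s, t])) f = (\<lambda>u. f u
      + geom_coeff m t u * (\<Sum>i<Suc k. z (2 * i)) + geom_coeff m s u * (\<Sum>i<Suc k. z (2 * i + 1)))"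
    using Suc h by (auto simp: algebra_simps fun_eq_iff)
  moreover have "geom_act m (concat (replicate (Suc k) [s, t])) f t = z (2 * Suc k)"
    unfolding h g st d using z2[of "2 * k"] by simp
  moreover have "geom_act m (concat (replicate (Suc k) [s, t])) f s
      = z (2 * Suc k + 1) - c * z (2 * Suc k)"
    unfolding h g st d using z2[of "2 * k"] z2[of "2 * k + 1"] by simp
  ultimately show ?case by blast
qed

text \<open>With \<open>c = 2 cos (pi / k)\<close> the multipliers have period \<open>2 k\<close>,
  so it remains to see that the even and the odd multipliers each sum to zero over a period.\<close>

lemma geom_act_relator_trivial:
  assumes "s \<in> S" "t \<in> S" "m s t = enat k"
  shows "geom_act m (concat (replicate k [s, t])) f = f"
proof (cases "s = t")
  case True
  hence "k = 1" using assms matrix_diag[of s] by (simp add: one_enat_def)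
  thus ?thesis using True by (auto simp: geom_refl_def geom_coeff_def fun_eq_iff)
next
  case False
  define c where "c = geom_coeff m s t"
  define z where "z = chebyshev_seq c (f t) (f s + c * f t)"
  define \<theta> where "\<theta> = pi / real k"
  have k: "2 \<le> k" using matrix_off_diag[OF assms(1,2) False] assms(3)
    by (metis enat_ord_simps(1) numeral_eq_enat)
  have c: "c = 2 * cos \<theta>" using False assms by (simp add: c_def geom_coeff_def \<theta>_def)
  have \<theta>: "0 < \<theta>" "\<theta> < pi" using k by (auto simp: \<theta>_def divide_simps)
  have s0: "sin \<theta> > 0" using \<theta> by (rule sin_gt_zero)
  have z2: "z (Suc (Suc j)) = 2 * cos \<theta> * z (Suc j) - z j" for j by (simp add: z_def c)
  note closed = sin_recurrence_closed_form[of z, OF z2]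
  have k\<theta>: "real (2 * k) * \<theta> = 2 * pi" using k by (simp add: \<theta>_def)
  have e: "(real (2 * k) - 1) * \<theta> = 2 * pi - \<theta>" "real (2 * k + 1) * \<theta> = 2 * pi + \<theta>"
    "(real (2 * k + 1) - 1) * \<theta> = 2 * pi"
    using k\<theta> by (simp_all add: algebra_simps)
  have "sin \<theta> * z (2 * k) = sin \<theta> * z 0"
    unfolding closed[of "2 * k"] e k\<theta> by simp
  moreover have "sin \<theta> * z (2 * k + 1) = sin \<theta> * z 1"
    unfolding closed[of "2 * k + 1"] e by (simp add: sin_add)
  ultimately have zk: "z (2 * k) = z 0" "z (2 * k + 1) = z 1" using s0 by simp_all
  define E where "E = (\<Sum>i<k. z (2 * i))"
  define O' where "O' = (\<Sum>i<k. z (2 * i + 1))"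
  \<comment> \<open>Shifting the index by two over a full period preserves both sums. The recurrence
    turns this into \<open>2 E = c O'\<close> and \<open>2 O' = c E\<close>, whose only solution is
    zero because \<open>c^2\<close> differs from \<open>4\<close>.\<close>
  have "(\<Sum>i<k. z (2 * i + 2)) = E"
    using sum.lessThan_Suc_shift[of "\<lambda>i. z (2 * i)" k] zk by (simp add: E_def)
  moreover have "(\<Sum>i<k. z (2 * i + 2)) = c * O' - E"
    by (simp add: E_def O'_def z2 c sum_subtractf sum_distrib_left)
  ultimately have 1: "2 * E = c * O'" by simp
  have "(\<Sum>i<k. z (2 * i + 3)) = O'"
    using sum.lessThan_Suc_shift[of "\<lambda>i. z (2 * i + 1)" k] zk
    by (simp add: O'_def numeral_3_eq_3)
  moreover have "z (2 * i + 3) = c * z (2 * i + 2) - z (2 * i + 1)" for i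
    using z2[of "2 * i + 1"] by (simp add: c numeral_3_eq_3)
  hence "(\<Sum>i<k. z (2 * i + 3)) = c * (\<Sum>i<k. z (2 * i + 2)) - O'"
    by (simp add: O'_def sum_subtractf sum_distrib_left)
  ultimately have 2: "2 * O' = c * E" using \<open>(\<Sum>i<k. z (2 * i + 2)) = E\<close> by simp
  have "(cos \<theta>)\<^sup>2 \<noteq> 1" using s0 sin_cos_squared_add[of \<theta>] zero_less_power[OF s0, of 2] by linarith
  hence "c\<^sup>2 \<noteq> 4" by (simp add: c power_mult_distrib)
  moreover have "4 * E = c * (2 * O')" using 1 by simp
  hence "4 * E = c\<^sup>2 * E" using 2 by (simp add: power2_eq_square)
  ultimately have "E = 0" by auto
  hence "O' = 0" using 2 by simp
  have "geom_act m (concat (replicate k [s, t])) f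
    = (\<lambda>u. f u + geom_coeff m t u * E + geom_coeff m s u * O')"
    using geom_act_relator[OF assms(1,2) False, of k f] by (simp add: E_def O'_def z_def c_def)
  thus ?thesis using \<open>E = 0\<close> \<open>O' = 0\<close> by simp
qed

lemma geom_act_cong: "coxeter_cong S m us vs \<Longrightarrow> geom_act m us f = geom_act m vs f"
  by (induction arbitrary: f rule: coxeter_cong.induct) (simp_all add: geom_act_relator_trivial)

text \<open>The presentation bounds the order of \<open>s t\<close> only from above. For the lower
  bound the action is tested on the indicator function of \<open>s\<close>, for which the
  multipliers are \<open>sin (i \<theta>) / sin \<theta>\<close>, or \<open>i\<close> itself if
  \<open>m s t\<close> is infinite. They return to the initial values at \<open>2 j\<close> only if
  \<open>2 j \<theta>\<close> is a multiple of \<open>2 pi\<close>, and never in the infinite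
  case.\<close>

lemma order_ge_matrix:
  assumes st: "s \<in> S" "t \<in> S" "s \<noteq> t" and j: "0 < j" and one: "(s \<otimes> t) [^] j = \<one>"
  shows "m s t \<le> enat j"
proof (rule ccontr)
  assume less: "\<not> m s t \<le> enat j"
  let ?R = "concat (replicate j [s, t])"
  have R: "?R \<in> lists S" using st by (induction j) auto
  hence cong: "coxeter_cong S m ?R []"
    using presentation[of ?R "[]"] one by (simp add: wprod_relator st)
  define f where "f = (\<lambda>u. if u = s then 1 else 0 :: real)"
  define c where "c = geom_coeff m s t"
  define z where "z = chebyshev_seq c 0 1"
  have f: "f s = 1" "f t = 0" using st by (auto simp: f_def)
  have "geom_act m ?R f = f" using geom_act_cong[OF cong] by simp
  moreover have "geom_act m ?R f t = z (2 * j) \<and> geom_act m ?R f s = z (2 * j + 1) - c * z (2 * j)"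
    using conjunct2[OF geom_act_relator[OF st, of j f]] by (simp add: f z_def c_def)
  ultimately have "f t = z (2 * j)" "f s = z (2 * j + 1) - c * z (2 * j)" by metis+
  hence z: "z (2 * j) = 0" "z (2 * j + 1) = 1" unfolding f by simp_all
  show False
  proof (cases "m s t")
    case (enat n)
    define \<theta> where "\<theta> = pi / real n"
    have n: "j < n" using less enat by simp
    have "2 \<le> n" using matrix_off_diag[OF st] enat by (metis enat_ord_simps(1) numeral_eq_enat)
    hence s0: "sin \<theta> > 0" by (intro sin_gt_zero) (auto simp: \<theta>_def divide_simps)
    have c: "c = 2 * cos \<theta>" using st enat by (simp add: c_def geom_coeff_def \<theta>_def)
    have z2: "z (Suc (Suc j)) = 2 * cos \<theta> * z (Suc j) - z j" for j by (simp add: z_def c)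
    have z01: "z 0 = 0" "z 1 = 1" by (simp_all add: z_def)
    have 1: "sin (real (2 * j) * \<theta>) = 0"
      using sin_recurrence_closed_form[of z \<theta> "2 * j", OF z2] z z01 by simp
    have "sin (real (2 * j + 1) * \<theta>) = sin \<theta>"
      using sin_recurrence_closed_form[of z \<theta> "2 * j + 1", OF z2] z z01 by simp
    moreover have "real (2 * j + 1) * \<theta> = real (2 * j) * \<theta> + \<theta>" by (simp add: algebra_simps)
    ultimately have "cos (real (2 * j) * \<theta>) * sin \<theta> = sin \<theta>" using 1 by (simp add: sin_add)
    hence "cos (real (2 * j) * \<theta>) = 1" using s0 by simp
    then obtain i where i: "real (2 * j) * \<theta> = of_int i * 2 * pi"
      using cos_one_2pi_int by (metis mult.assoc mult.commute)
    have "real j = of_int i * real n" using i n by (simp add: \<theta>_def field_simps)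
    hence "int j = i * int n" by (metis of_int_eq_iff of_int_mult of_int_of_nat_eq)
    thus False using n j by (metis dvd_triv_right nat_dvd_not_less of_nat_dvd_iff)
  next
    case infinity
    hence c: "c = 2" using st by (simp add: c_def geom_coeff_def)
    have "z i = real i \<and> z (Suc i) = real (Suc i)" for i
      by (induction i) (auto simp: z_def c)
    thus False using z j by auto
  qed
qed

section \<open>Dihedral cosets\<close>

abbreviation altp :: "'w \<Rightarrow> 'w \<Rightarrow> nat \<Rightarrow> 'w" where
  "altp s t k \<equiv> wprod (alt_word s t k)"

lemma alt_word_lists [simp]: "s \<in> S \<Longrightarrow> t \<in> S \<Longrightarrow> set (alt_word s t k) \<subseteq> S"
  by (induction s t k rule: alt_word.induct) auto

lemma alt_word_in_lists: "s \<in> S \<Longrightarrow> t \<in> S \<Longrightarrow> alt_word s t k \<in> lists S"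
  using alt_word_lists[of s t k] by (auto simp: subset_iff)

lemma altp_closed [simp, intro]: "s \<in> S \<Longrightarrow> t \<in> S \<Longrightarrow> altp s t k \<in> carrier G"
  using alt_word_in_lists by blast

lemma length_alt_word [simp]: "length (alt_word s t k) = k"
  by (induction s t k rule: alt_word.induct) auto

lemma alt_word_snoc:
  "alt_word s t (Suc k) = alt_word s t k @ [if even k then s else t]"
proof (induction k arbitrary: s t)
  case (Suc k)
  show ?case using Suc.IH[of t s] by simp
qed simp

lemma altp_double:
  assumes "s \<in> S" "t \<in> S" shows "altp s t (2 * k) = (s \<otimes> t) [^] k"
proof -
  have "alt_word s t (2 * k) = concat (replicate k [s, t])" by (induction k) auto
  thus ?thesis using wprod_relator[OF assms] by simp
qed

lemma alt_word_add:
  "alt_word s t (i + j) = alt_word s t i @ (if even i then alt_word s t j else alt_word t s j)"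
  by (induction i arbitrary: s t) auto

lemma rev_alt_word:
  "rev (alt_word s t k) = (if even k then alt_word t s k else alt_word s t k)"
proof (induction k arbitrary: s t)
  case (Suc k)
  show ?case using alt_word_snoc[of s t k] alt_word_snoc[of t s k] Suc.IH[of s t] by simp
qed simp

text \<open>The alternating word of length \<open>2 k\<close> is the one of length \<open>k\<close>
  followed by the reverse of its mirror image, so \<open>(s t)^k\<close> is the quotient of the two
  products.\<close>

lemma altp_eq_iff:
  assumes "s \<in> S" "t \<in> S"
  shows "altp s t k = altp t s k \<longleftrightarrow> (s \<otimes> t) [^] k = \<one>"
proof -
  have "alt_word s t (2 * k) = alt_word s t k @ rev (alt_word t s k)"
    using alt_word_add[of s t k k] by (simp add: rev_alt_word mult_2)
  hence "altp s t (2 * k) = altp s t k \<otimes> inv (altp t s k)"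
    using wprod_append[of "alt_word s t k" "rev (alt_word t s k)"] wprod_rev[of "alt_word t s k"]
      alt_word_in_lists[of s t k] alt_word_in_lists[of t s k] assms by simp
  moreover have "altp s t k \<in> carrier G" "altp t s k \<in> carrier G" using assms by auto
  ultimately show ?thesis using altp_double[OF assms, of k]
    by (metis inv_equality inv_closed inv_inv r_inv)
qed

lemma matrix_ge_2: "s \<in> S \<Longrightarrow> t \<in> S \<Longrightarrow> s \<noteq> t \<Longrightarrow> m s t = enat n \<Longrightarrow> 2 \<le> n"
  using matrix_off_diag[of s t] by (metis enat_ord_simps(1) numeral_eq_enat)

lemma braid_relation:
  "s \<in> S \<Longrightarrow> t \<in> S \<Longrightarrow> m s t = enat n \<Longrightarrow> altp s t n = altp t s n"
  using altp_eq_iff relator_one by blast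

lemma commute_iff_matrix:
  assumes "s \<in> S" "t \<in> S" "s \<noteq> t"
  shows "s \<otimes> t = t \<otimes> s \<longleftrightarrow> m s t = 2"
proof -
  have e: "altp s t 2 = s \<otimes> t" "altp t s 2 = t \<otimes> s" using assms by (simp_all add: numeral_2_eq_2)
  have 2: "(2::enat) = enat 2" by (simp add: numeral_eq_enat)
  show ?thesis
  proof
    assume "s \<otimes> t = t \<otimes> s"
    hence "(s \<otimes> t) [^] (2::nat) = \<one>" using altp_eq_iff[of s t 2] assms e by simp
    hence "m s t \<le> 2" using order_ge_matrix[of s t 2] assms 2 by simp
    thus "m s t = 2" using matrix_off_diag[OF assms] by simp
  next
    assume "m s t = 2"
    thus "s \<otimes> t = t \<otimes> s" using braid_relation[of s t 2] assms e 2 by simp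
  qed
qed

lemma matrix_ge_3:
  assumes "s \<in> S" "t \<in> S" "s \<otimes> t \<noteq> t \<otimes> s" "m s t = enat n" shows "3 \<le> n"
proof -
  have "s \<noteq> t" using assms by auto
  hence "2 \<le> n" "n \<noteq> 2" using matrix_ge_2 commute_iff_matrix assms by (auto simp: numeral_eq_enat)
  thus ?thesis by simp
qed

text \<open>The unordered pair \<open>{a, b}\<close> lets either generator come first. With the cap
  at \<open>m s t\<close> the set consists of all alternating products, the two longest ones
  coinciding when \<open>m s t\<close> is finite; it is identified below with the subgroup generated
  by \<open>s\<close> and \<open>t\<close>.\<close>

definition dihedral :: "'w \<Rightarrow> 'w \<Rightarrow> 'w set" where
  "dihedral s t = {altp a b k | a b k. {a, b} = {s, t} \<and> enat k \<le> m s t}"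

lemma dihedral_mult:
  assumes "s \<in> S" "t \<in> S" "x \<in> {s, t}" "y \<in> dihedral s t"
  shows "x \<otimes> y \<in> dihedral s t"
proof -
  obtain a b k where y: "y = altp a b k" "{a, b} = {s, t}" "enat k \<le> m s t"
    using assms by (auto simp: dihedral_def)
  have ab: "a \<in> S" "b \<in> S" "m a b = m s t" using assms y matrix_sym by (auto simp: doubleton_eq_iff)
  have cancel: "a \<otimes> altp a b k \<in> dihedral s t" if "{a, b} = {s, t}" "enat k \<le> m s t" "a \<in> S" "b \<in> S"
    for a b k
  proof (cases k)
    case 0
    have "1 \<le> m s t"
    proof (cases "s = t")
      case False
      have "(1::enat) \<le> 2" by simp
      thus ?thesis using matrix_off_diag[OF assms(1,2) False] by (rule order_trans)
    qed (use matrix_diag assms in simp)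
    hence "enat 1 \<le> m s t" by (simp add: one_enat_def)
    moreover have "a \<otimes> altp a b k = altp a b 1" using 0 by simp
    ultimately show ?thesis unfolding dihedral_def using that(1) by blast
  next
    case (Suc k')
    hence "a \<otimes> altp a b k = altp b a k'" using that by simp
    moreover have "enat k' \<le> m s t" using that Suc by (meson enat_ord_simps(1) le_SucI order_trans order_refl)
    moreover have "{b, a} = {s, t}" using that by blast
    ultimately show ?thesis unfolding dihedral_def by blast
  qed
  consider "x = a" | "x = b" using assms y by blast
  thus ?thesis
  proof cases
    case 1 thus ?thesis using cancel y ab by blast
  next
    case 2
    show ?thesis
    proof (cases "enat k = m s t")
      case True
      hence "altp a b k = altp b a k" using braid_relation[of a b k] ab by simp
      thus ?thesis using cancel[of b a k] 2 y ab by (simp add: insert_commute)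
    next
      case False
      hence "enat (Suc k) \<le> m s t" using y by (simp add: ileI1 flip: eSuc_enat)
      moreover have "x \<otimes> y = altp b a (Suc k)" using y 2 by simp
      moreover have "{b, a} = {s, t}" using y by blast
      ultimately show ?thesis unfolding dihedral_def by blast
    qed
  qed
qed

lemma wprod_dihedral:
  assumes "s \<in> S" "t \<in> S" "ys \<in> lists {s, t}"
  shows "wprod ys \<in> dihedral s t"
  using assms(3)
proof (induction ys)
  case Nil
  have "wprod [] = altp s t 0" "enat 0 \<le> m s t" by (simp_all add: zero_enat_def[symmetric])
  thus ?case unfolding dihedral_def by blast
next
  case (Cons y ys)
  thus ?case using dihedral_mult[OF assms(1,2)] by simp
qed


text \<open>If prefixing \<open>a\<close> did not increase the length, exchange would delete a
  letter either from the alternating part or from a reduced word of \<open>u\<close>. Minimality is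
  required against all words in \<open>a\<close> and \<open>b\<close>, since the second case
  produces an arbitrary element of the coset.\<close>

lemma len_altp_coset:
  assumes "a \<in> S" "b \<in> S" "a \<noteq> b" "u \<in> carrier G" "enat k \<le> m a b"
    and min: "\<And>ys. ys \<in> lists {a, b} \<Longrightarrow> len u \<le> len (wprod ys \<otimes> u)"
  shows "len (altp a b k \<otimes> u) = k + len u"
  using assms
proof (induction k arbitrary: a b)
  case (Suc k)
  let ?A = "alt_word b a k"
  have A: "?A \<in> lists S" using alt_word_in_lists Suc.prems by blast
  obtain us where us: "reduced us" "wprod us = u" using reduced_exists Suc.prems by blast
  have usl: "us \<in> lists S" using us by (simp add: reduced_def)
  have k: "enat k \<le> m a b" using Suc.prems(5) by (meson enat_ord_simps(1) le_SucI order_trans order_refl)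
  have "len (altp b a k \<otimes> u) = k + len u"
    using Suc.prems k matrix_sym[of a b] by (intro Suc.IH) (auto simp: insert_commute)
  moreover have w: "wprod (?A @ us) = altp b a k \<otimes> u" using wprod_append[OF A usl] us by simp
  ultimately have lenA: "len (wprod (?A @ us)) = k + len u" by simp
  have "a \<notin> ldesc (wprod (?A @ us))"
  proof
    assume "a \<in> ldesc (wprod (?A @ us))"
    then obtain as c bs where e: "?A @ us = as @ c # bs" "a \<otimes> wprod as = wprod as \<otimes> c"
      using exchange[of "?A @ us" a] A usl by (metis append_in_lists_conv)
    show False
    proof (cases "length as < k")
      case True
      let ?j = "length as"
      have "alt_word b a (?j + (k - ?j)) = alt_word b a ?j @ (if even ?j then alt_word b a (k - ?j) else alt_word a b (k - ?j))"
        by (rule alt_word_add)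
      hence "alt_word b a ?j = take ?j (?A @ us)" using True by simp
      hence as: "as = alt_word b a ?j" using e by simp
      have "alt_word b a (Suc ?j + (k - Suc ?j)) = alt_word b a (Suc ?j) @ (if even (Suc ?j) then alt_word b a (k - Suc ?j) else alt_word a b (k - Suc ?j))"
        by (rule alt_word_add)
      hence "alt_word b a (Suc ?j) = take (Suc ?j) (?A @ us)" using True by simp
      also have "\<dots> = as @ [c]" using e by simp
      finally have asc: "altp b a (Suc ?j) = wprod as \<otimes> c"
        using e A usl wprod_append[of as "[c]"]
        by (metis Un_iff append_in_lists_conv Cons_in_lists_iff gen_closed lists.Nil r_one word_prod_Cons word_prod_Nil)
      \<comment> \<open>A deletion inside the alternating part amounts to a braid relation of length
        at most \<open>k\<close>, which is below \<open>m a b\<close>.\<close>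
      have "altp a b (Suc ?j) = altp b a (Suc ?j)" using as asc e(2) by simp
      hence "(a \<otimes> b) [^] Suc ?j = \<one>" using altp_eq_iff[of a b "Suc ?j"] Suc.prems by simp
      hence "m a b \<le> enat (Suc ?j)" using order_ge_matrix[of a b "Suc ?j"] Suc.prems by simp
      hence "enat (Suc k) \<le> enat (Suc ?j)" using Suc.prems(5) by (rule order_trans[rotated])
      thus False using True by simp
    next
      case False
      hence "as = ?A @ take (length as - k) us"
        using arg_cong[OF e(1), of "take (length as)"] by simp
      then obtain us' where as: "as = ?A @ us'" by blast
      hence us': "us = us' @ c # bs" using e(1) by simp
      have l: "us' \<in> lists S" "c \<in> S" "bs \<in> lists S" using usl us' by auto
      have Ac: "altp b a k \<in> carrier G" using Suc.prems by auto
      have "altp b a k \<otimes> wprod (us' @ bs) = (wprod as \<otimes> c) \<otimes> c \<otimes> wprod bs"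
        using as l A by (simp add: wprod_append m_assoc)
      also have "\<dots> = a \<otimes> wprod as \<otimes> c \<otimes> wprod bs" using e(2) by simp
      also have "\<dots> = a \<otimes> (altp b a k \<otimes> u)"
        using as l A us us' Suc.prems by (simp add: wprod_append m_assoc flip: us(2))
      finally have "altp b a k \<otimes> wprod (us' @ bs) = a \<otimes> (altp b a k \<otimes> u)" .
      moreover have "us' @ bs \<in> lists S" using l by simp
      ultimately have "wprod (us' @ bs) = inv (altp b a k) \<otimes> (a \<otimes> (altp b a k \<otimes> u))"
        using inv_cancel_left[OF Ac wprod_closed[of "us' @ bs"]] by argo
      also have "\<dots> = wprod (rev ?A @ [a] @ ?A) \<otimes> u"
        using A Suc.prems by (simp add: wprod_append wprod_rev m_assoc)
      finally have "wprod (us' @ bs) = wprod (rev ?A @ [a] @ ?A) \<otimes> u" .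
      moreover have "rev ?A @ [a] @ ?A \<in> lists {a, b}"
      proof -
        have "set (alt_word x y n) \<subseteq> {x, y}" for x y :: 'w and n
          by (induction x y n rule: alt_word.induct) auto
        thus ?thesis by fastforce
      qed
      \<comment> \<open>A deletion inside \<open>u\<close> leaves an element of the coset of
        \<open>u\<close> that is shorter than \<open>u\<close>.\<close>
      ultimately have "len u \<le> len (wprod (us' @ bs))" using Suc.prems(6) by metis
      also have "\<dots> \<le> length (us' @ bs)" by (rule len_le) (use l in auto)
      also have "\<dots> < length us" using us' by simp
      finally show False using us by (simp add: reduced_def)
    qed
  qed
  hence "len (a \<otimes> wprod (?A @ us)) = Suc (k + len u)"
    using len_not_ldesc[of "wprod (?A @ us)" a] lenA A usl Suc.prems by auto
  moreover have "altp a b (Suc k) \<otimes> u = a \<otimes> wprod (?A @ us)"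
    using w Suc.prems by (simp add: m_assoc)
  ultimately show ?case by simp
qed simp

section \<open>Minimal coset representatives and pairs of descents\<close>

lemma coset_decomposition:
  assumes "s \<in> S" "t \<in> S" "s \<noteq> t" "x \<in> carrier G"
  shows "\<exists>a b k u. {a, b} = {s, t} \<and> enat k \<le> m s t \<and> u \<in> carrier G \<and> x = altp a b k \<otimes> u
    \<and> (\<forall>ys \<in> lists {s, t}. len u \<le> len (wprod ys \<otimes> u))"
proof -
  define C where "C = {wprod ys \<otimes> x | ys. ys \<in> lists {s, t}}"
  have "x = wprod [] \<otimes> x" using assms by simp
  hence "x \<in> C" unfolding C_def by blast
  then obtain u where u: "u \<in> C" "\<And>u'. u' \<in> C \<Longrightarrow> len u \<le> len u'"
    using ex_has_least_nat[of "\<lambda>u. u \<in> C" x len] by metis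
  then obtain ys where ys: "ys \<in> lists {s, t}" "u = wprod ys \<otimes> x"
    unfolding C_def by blast
  have sub: "zs \<in> lists S" if "zs \<in> lists {s, t}" for zs using that assms by auto
  have uc: "u \<in> carrier G" using ys sub assms by auto
  have "x = inv (wprod ys) \<otimes> u"
    using inv_cancel_left[OF wprod_closed[OF sub[OF ys(1)]] assms(4)] ys(2) by simp
  hence x: "x = wprod (rev ys) \<otimes> u" by (simp only: wprod_rev[OF sub[OF ys(1)]])
  have "wprod (rev ys) \<in> dihedral s t" using wprod_dihedral[of s t "rev ys"] assms ys by simp
  then obtain a b k where abk: "wprod (rev ys) = altp a b k" "{a, b} = {s, t}" "enat k \<le> m s t"
    by (auto simp: dihedral_def)
  have "len u \<le> len (wprod zs \<otimes> u)" if "zs \<in> lists {s, t}" for zs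
  proof (rule u(2))
    have "wprod zs \<otimes> u = wprod (zs @ ys) \<otimes> x"
      using ys sub[OF that] sub[OF ys(1)] assms wprod_closed by (simp only: wprod_append) (simp add: m_assoc)
    moreover have "zs @ ys \<in> lists {s, t}" using that ys by simp
    ultimately show "wprod zs \<otimes> u \<in> C" unfolding C_def by blast
  qed
  thus ?thesis using abk uc x by (intro exI[of _ a] exI[of _ b] exI[of _ k] exI[of _ u]) auto
qed

abbreviation left_reduced :: "'w \<Rightarrow> 'w \<Rightarrow> 'w \<Rightarrow> bool" where
  "left_reduced s t u \<equiv> u \<in> carrier G \<and> s \<notin> ldesc u \<and> t \<notin> ldesc u"

text \<open>Relative to the shortest element of its coset, an alternating factor of positive length
  would make its first letter a descent. So absence of the two descents is the same as
  minimality.\<close>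

lemma left_reduced_min:
  assumes "s \<in> S" "t \<in> S" "s \<noteq> t" "left_reduced s t u" "ys \<in> lists {s, t}"
  shows "len u \<le> len (wprod ys \<otimes> u)"
proof -
  obtain a b k u' where d: "{a, b} = {s, t}" "enat k \<le> m s t" "u' \<in> carrier G" "u = altp a b k \<otimes> u'"
    "\<forall>ys \<in> lists {s, t}. len u' \<le> len (wprod ys \<otimes> u')"
    using coset_decomposition[of s t u] assms by blast
  have ab: "a \<in> S" "b \<in> S" "a \<noteq> b" "m a b = m s t" "m b a = m s t"
    using assms d(1) matrix_sym[of s t] by (auto simp: doubleton_eq_iff)
  have "k = 0"
  proof (cases k)
    case (Suc k')
    have k': "enat k' \<le> m b a" using d(2) Suc ab by (metis enat_ord_simps(1) le_SucI order_trans order_refl)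
    have "len (altp b a k' \<otimes> u') = k' + len u'"
      by (rule len_altp_coset) (use ab d k' in \<open>auto simp: insert_commute\<close>)
    moreover have "len u = k + len u'"
      unfolding d(4) by (rule len_altp_coset) (use ab d in auto)
    moreover have "a \<otimes> u = altp b a k' \<otimes> u'" using d ab Suc by (simp add: m_assoc)
    ultimately have "a \<in> ldesc u" using ab Suc by (simp add: ldesc_def)
    moreover have "a = s \<or> a = t" using d(1) by (auto simp: doubleton_eq_iff)
    ultimately show ?thesis using assms(4) by auto
  qed simp
  hence "u = u'" using d by simp
  thus ?thesis using d assms by blast
qed

lemma len_altp_mult:
  assumes "s \<in> S" "t \<in> S" "s \<noteq> t" "left_reduced s t u" "{a, b} = {s, t}" "enat k \<le> m s t"
  shows "len (altp a b k \<otimes> u) = k + len u"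
proof (rule len_altp_coset)
  show ab: "a \<in> S" "b \<in> S" "a \<noteq> b" "enat k \<le> m a b" "u \<in> carrier G"
    using assms matrix_sym[of s t] by (auto simp: doubleton_eq_iff)
qed (use left_reduced_min[OF assms(1-4)] assms(5) in auto)

lemma altp_mult_reduced:
  assumes "s \<in> S" "t \<in> S" "s \<noteq> t" "left_reduced s t (wprod us)" "{a, b} = {s, t}" "enat k \<le> m s t"
    "reduced us"
  shows "reduced (alt_word a b k @ us)"
proof -
  have l: "alt_word a b k \<in> lists S" "us \<in> lists S"
    using assms alt_word_in_lists[of a b k] by (auto simp: reduced_def doubleton_eq_iff)
  thus ?thesis using len_altp_mult[OF assms(1-6)] assms(7) by (simp add: reduced_def wprod_append)
qed

text \<open>If the alternating factor of \<open>x\<close> were shorter than \<open>m s t\<close>, it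
  could be prolonged by the other letter with the length going up, although that letter is a
  descent. Hence \<open>m s t\<close> is finite and \<open>x\<close> starts with the longest
  element.\<close>

lemma two_ldesc:
  assumes "x \<in> carrier G" "s \<in> ldesc x" "t \<in> ldesc x" "s \<noteq> t"
  shows "\<exists>n u. m s t = enat n \<and> left_reduced s t u \<and> x = altp s t n \<otimes> u"
proof -
  have st: "s \<in> S" "t \<in> S" using assms ldescD by auto
  obtain a b k u where d: "{a, b} = {s, t}" "enat k \<le> m s t" "u \<in> carrier G" "x = altp a b k \<otimes> u"
    "\<forall>ys \<in> lists {s, t}. len u \<le> len (wprod ys \<otimes> u)"
    using coset_decomposition[of s t x] assms st by blast
  have ab: "a \<in> S" "b \<in> S" "a \<noteq> b" "m a b = m s t" "m b a = m s t"
    using assms st d(1) matrix_sym[of s t] by (auto simp: doubleton_eq_iff)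
  have lx: "len x = k + len u"
    unfolding d(4) by (rule len_altp_coset) (use ab d in auto)
  have k: "enat k = m s t"
  proof (rule ccontr)
    assume "enat k \<noteq> m s t"
    hence k: "enat (Suc k) \<le> m b a" using d(2) ab by (simp add: ileI1 flip: eSuc_enat)
    have "len (altp b a (Suc k) \<otimes> u) = Suc k + len u"
      by (rule len_altp_coset) (use ab d k in \<open>auto simp: insert_commute simp del: alt_word.simps\<close>)
    moreover have "b \<otimes> x = altp b a (Suc k) \<otimes> u" using d ab by (simp add: m_assoc)
    moreover have "b \<in> ldesc x" using d(1) assms by (auto simp: doubleton_eq_iff)
    ultimately show False using lx by (simp add: ldesc_def)
  qed
  have "s \<notin> ldesc u" "t \<notin> ldesc u"
  proof -
    have "len u \<le> len (c \<otimes> u)" if "c \<in> {s, t}" for c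
      using bspec[OF d(5), of "[c]"] that st d(3) by auto
    thus "s \<notin> ldesc u" "t \<notin> ldesc u" by (auto simp: ldesc_def not_less)
  qed
  moreover have "x = altp s t k \<otimes> u"
  proof (cases "a = s")
    case True thus ?thesis using d by (auto simp: doubleton_eq_iff)
  next
    case False
    hence "a = t" "b = s" using d(1) by (auto simp: doubleton_eq_iff)
    thus ?thesis using d braid_relation[of s t k] k st by simp
  qed
  ultimately show ?thesis using k d by (intro exI[of _ k] exI[of _ u]) auto
qed

lemma ldesc_altp_mult:
  assumes "s \<in> S" "t \<in> S" "s \<noteq> t" "left_reduced s t u" "{a, b} = {s, t}" "enat (Suc k) \<le> m s t"
  shows "a \<in> ldesc (altp a b (Suc k) \<otimes> u)"
proof -
  have ab: "a \<in> S" "b \<in> S" "{b, a} = {s, t}" using assms by (auto simp: doubleton_eq_iff)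
  have k: "enat k \<le> m s t" using assms(6) by (meson enat_ord_simps(1) le_SucI order_trans order_refl)
  have "a \<otimes> (altp a b (Suc k) \<otimes> u) = altp b a k \<otimes> u" using ab assms by (simp add: m_assoc)
  thus ?thesis using len_altp_mult[OF assms(1-4) assms(5,6)] len_altp_mult[OF assms(1-4) ab(3) k] ab
    by (simp add: ldesc_def)
qed

text \<open>Both descents make \<open>x\<close> start with an alternating word of length
  \<open>m s t\<close>, which is at least 2, and at least 3 if \<open>s\<close> and \<open>t\<close>
  do not commute. After removing the leading letters the next one is still a descent.\<close>

lemma ldesc_of_two_ldesc:
  assumes "x \<in> carrier G" "s \<in> ldesc x" "t \<in> ldesc x" "s \<noteq> t"
  shows "t \<in> ldesc (s \<otimes> x)"
    and "s \<otimes> t \<noteq> t \<otimes> s \<Longrightarrow> s \<in> ldesc (t \<otimes> (s \<otimes> x))"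
proof -
  have st: "s \<in> S" "t \<in> S" using assms ldescD by auto
  obtain n u where d: "m s t = enat n" "left_reduced s t u" "x = altp s t n \<otimes> u"
    using two_ldesc assms by blast
  obtain k where n: "n = Suc (Suc k)"
    using matrix_ge_2[OF st assms(4) d(1)] by (metis Suc_le_D numeral_2_eq_2 Suc_le_mono)
  have x: "s \<otimes> x = altp t s (Suc k) \<otimes> u" using d st n by (simp add: m_assoc)
  show "t \<in> ldesc (s \<otimes> x)"
    unfolding x by (rule ldesc_altp_mult[OF st assms(4)]) (use d n in auto)
  assume "s \<otimes> t \<noteq> t \<otimes> s"
  hence "3 \<le> n" using matrix_ge_3 st d by blast
  then obtain k' where k': "k = Suc k'" using n by (cases k) auto
  have x': "t \<otimes> (s \<otimes> x) = altp s t (Suc k') \<otimes> u" unfolding x using d st k' by (simp add: m_assoc)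
  show "s \<in> ldesc (t \<otimes> (s \<otimes> x))"
    unfolding x' by (rule ldesc_altp_mult[OF st assms(4)]) (use d n k' in auto)
qed

lemma ldesc_commute:
  assumes "w \<in> carrier G" "p \<in> S" "r \<in> S" "p \<otimes> r = r \<otimes> p" "r \<noteq> p" "p \<notin> ldesc w"
  shows "r \<in> ldesc (p \<otimes> w) \<longleftrightarrow> r \<in> ldesc w"
proof
  have p: "p \<in> ldesc (p \<otimes> w)" using assms ldesc_mult_iff by simp
  assume "r \<in> ldesc (p \<otimes> w)"
  thus "r \<in> ldesc w" using ldesc_of_two_ldesc(1)[of "p \<otimes> w" p r] p assms by simp
next
  assume "r \<in> ldesc w"
  hence "len w = Suc (len (r \<otimes> w))" using len_ldesc assms by simp
  moreover have "len (r \<otimes> (p \<otimes> w)) \<le> Suc (len (r \<otimes> w))"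
    using len_mult_le[of p "r \<otimes> w"] assms by (simp flip: m_assoc)
  moreover have "len (p \<otimes> w) = Suc (len w)" using len_not_ldesc assms by simp
  ultimately show "r \<in> ldesc (p \<otimes> w)" using assms by (simp add: ldesc_def)
qed

end

section \<open>Fully commutative elements\<close>

context coxeter_system
begin

text \<open>The dependence relation of trace theory: pairs of letters whose relative order no
  commutation can change. The case \<open>a = b\<close> makes the projection count occurrences of a
  letter.\<close>

definition indep :: "'w \<Rightarrow> 'w \<Rightarrow> bool" where
  "indep a b \<longleftrightarrow> a = b \<or> a \<otimes> b \<noteq> b \<otimes> a"

abbreviation proj :: "'w \<Rightarrow> 'w \<Rightarrow> 'w list \<Rightarrow> 'w list" where
  "proj a b \<equiv> filter (\<lambda>x. x = a \<or> x = b)"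

abbreviation commutes_to :: "'w list \<Rightarrow> 'w list \<Rightarrow> bool" (infix "\<bowtie>" 50) where
  "xs \<bowtie> ys \<equiv> (commutation_step G)\<^sup>*\<^sup>* xs ys"

lemma commutation_step_proj:
  "commutation_step G xs ys \<Longrightarrow> indep a b \<Longrightarrow> proj a b xs = proj a b ys"
  by (auto simp: commutation_step_def indep_def)

lemma commutes_to_proj: "xs \<bowtie> ys \<Longrightarrow> indep a b \<Longrightarrow> proj a b xs = proj a b ys"
  by (induction rule: rtranclp_induct) (auto dest: commutation_step_proj)

lemma commutation_step_Cons: "commutation_step G xs ys \<Longrightarrow> commutation_step G (x # xs) (x # ys)"
  unfolding commutation_step_def by (metis append_Cons)

lemma commutes_to_Cons: "xs \<bowtie> ys \<Longrightarrow> x # xs \<bowtie> x # ys"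
  by (induction rule: rtranclp_induct) (auto dest: commutation_step_Cons intro: rtranclp.rtrancl_into_rtrancl)

lemma commutes_to_swap: "x \<otimes> y = y \<otimes> x \<Longrightarrow> x # y # zs \<bowtie> y # x # zs"
  unfolding commutation_step_def
  by (intro r_into_rtranclp exI[of _ "[]"] exI[of _ zs] exI[of _ x] exI[of _ y]) auto

lemma commutes_to_move:
  "(\<And>c. c \<in> set as \<Longrightarrow> x \<otimes> c = c \<otimes> x) \<Longrightarrow> x # as @ bs \<bowtie> as @ x # bs"
proof (induction as)
  case (Cons a as)
  have "x # a # as @ bs \<bowtie> a # x # as @ bs" using Cons.prems by (intro commutes_to_swap) auto
  also have "a # x # as @ bs \<bowtie> a # as @ x # bs" using Cons by (intro commutes_to_Cons) auto
  finally show ?case by simp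
qed simp

text \<open>The projection lemma for trace monoids. The letters of \<open>ys\<close> before the
  first \<open>x\<close> must commute with \<open>x\<close>, as otherwise the projection to
  \<open>x\<close> and such a letter would not start with \<open>x\<close>; so \<open>x\<close> can
  be moved to the front and cancelled.\<close>

lemma commutes_to_of_proj:
  "(\<And>a b. indep a b \<Longrightarrow> proj a b xs = proj a b ys) \<Longrightarrow> xs \<bowtie> ys"
proof (induction xs arbitrary: ys)
  case Nil
  have "ys = []"
  proof (cases ys)
    case (Cons y ys')
    thus ?thesis using Nil[of y y] by (auto simp: indep_def)
  qed
  thus ?case by simp
next
  case (Cons x xs)
  have "proj x x ys \<noteq> []" using Cons.prems[of x x] by (auto simp: indep_def)
  hence "x \<in> set ys" by (auto simp: filter_empty_conv)
  then obtain as bs where ys: "ys = as @ x # bs" "x \<notin> set as" by (meson split_list_first)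
  have comm: "x \<otimes> c = c \<otimes> x" if c: "c \<in> set as" for c
  proof (rule ccontr)
    assume "x \<otimes> c \<noteq> c \<otimes> x"
    hence "x # proj x c xs = proj x c as @ x # proj x c bs"
      using Cons.prems[of x c] ys by (auto simp: indep_def)
    moreover have ne: "proj x c as \<noteq> []" using c by (auto simp: filter_empty_conv)
    ultimately have "hd (proj x c as) = x" by (metis hd_append2 list.sel(1))
    hence "x \<in> set (proj x c as)" using hd_in_set[OF ne] by simp
    thus False using ys(2) by simp
  qed
  have "xs \<bowtie> as @ bs"
  proof (rule Cons.IH)
    fix a b assume ab: "indep a b"
    have p: "proj a b (x # xs) = proj a b as @ proj a b (x # bs)"
      using Cons.prems[OF ab] ys by simp
    show "proj a b xs = proj a b (as @ bs)"
    proof (cases "x = a \<or> x = b")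
      case True
      have "c \<noteq> a \<and> c \<noteq> b" if "c \<in> set as" for c
        using True ab comm[OF that] that ys(2) by (auto simp: indep_def)
      hence "proj a b as = []" by (auto simp: filter_empty_conv)
      thus ?thesis using p True by simp
    qed (use p in auto)
  qed
  hence "x # xs \<bowtie> x # as @ bs" by (rule commutes_to_Cons)
  also have "x # as @ bs \<bowtie> ys" unfolding ys by (rule commutes_to_move) (rule comm)
  finally show ?case .
qed

section \<open>Full commutativity in terms of descents\<close>

lemma FC_closed: "w \<in> FC \<Longrightarrow> w \<in> carrier G"
  by (simp add: fully_commutative_def)

lemma FC_I:
  assumes "w \<in> carrier G"
    and "\<And>xs ys. \<lbrakk>reduced xs; reduced ys; wprod xs = w; wprod ys = w\<rbrakk> \<Longrightarrow> xs \<bowtie> ys"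
  shows "w \<in> FC"
  using assms by (auto simp: fully_commutative_def reduced_expressions_eq)

lemma FC_D:
  "\<lbrakk>w \<in> FC; reduced xs; reduced ys; wprod xs = w; wprod ys = w\<rbrakk> \<Longrightarrow> xs \<bowtie> ys"
  by (auto simp: fully_commutative_def reduced_expressions_eq)

text \<open>A leading letter has to be cancelled from two commutation-equivalent words. A chain of
  swaps may move that letter, whereas in the projections the cancellation is immediate.\<close>

lemma FC_ldesc:
  assumes "x \<in> FC" "s \<in> ldesc x" shows "s \<otimes> x \<in> FC"
proof (rule FC_I)
  have x: "x \<in> carrier G" "s \<in> S" using assms FC_closed ldescD by auto
  thus "s \<otimes> x \<in> carrier G" by simp
  fix xs ys assume r: "reduced xs" "reduced ys" "wprod xs = s \<otimes> x" "wprod ys = s \<otimes> x"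
  have "reduced (s # xs)" "reduced (s # ys)"
    using r x reduced_Cons_iff not_ldesc_mult assms by auto
  moreover have "wprod (s # xs) = x" "wprod (s # ys) = x" using r x by auto
  ultimately have "s # xs \<bowtie> s # ys" using FC_D[OF assms(1)] by blast
  hence "proj a b (s # xs) = proj a b (s # ys)" if "indep a b" for a b
    using that by (rule commutes_to_proj)
  hence "proj a b xs = proj a b ys" if "indep a b" for a b
    using that by (fastforce split: if_splits)
  thus "xs \<bowtie> ys" by (rule commutes_to_of_proj)
qed

text \<open>Two noncommuting descents give reduced words beginning with the two longest alternating
  words, and their projections to \<open>s\<close> and \<open>t\<close> already differ in the first
  letter.\<close>

lemma FC_ldesc_commute:
  assumes "x \<in> FC" "s \<in> ldesc x" "t \<in> ldesc x" shows "s \<otimes> t = t \<otimes> s"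
proof (rule ccontr)
  assume nc: "s \<otimes> t \<noteq> t \<otimes> s"
  hence ne: "s \<noteq> t" by auto
  have st: "s \<in> S" "t \<in> S" using assms ldescD by auto
  obtain n u where d: "m s t = enat n" "left_reduced s t u" "x = altp s t n \<otimes> u"
    using two_ldesc[OF FC_closed[OF assms(1)] assms(2,3) ne] by blast
  obtain us where us: "reduced us" "wprod us = u" using reduced_exists d by blast
  have usl: "us \<in> lists S" using us by (simp add: reduced_def)
  have "reduced (alt_word s t n @ us)" "reduced (alt_word t s n @ us)"
    by (rule altp_mult_reduced[OF st ne]; use us d in auto)+
  moreover have "wprod (alt_word s t n @ us) = x" "wprod (alt_word t s n @ us) = x"
    using d us usl st alt_word_in_lists[of s t n] alt_word_in_lists[of t s n]
      braid_relation[of s t n] by (auto simp: wprod_append)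
  ultimately have "alt_word s t n @ us \<bowtie> alt_word t s n @ us" using FC_D[OF assms(1)] by blast
  hence "proj s t (alt_word s t n @ us) = proj s t (alt_word t s n @ us)"
    by (rule commutes_to_proj) (use nc in \<open>simp add: indep_def\<close>)
  moreover obtain k where "n = Suc k" using matrix_ge_2[OF st ne d(1)] by (cases n) auto
  ultimately show False using ne by simp
qed

text \<open>Reduced words with distinct first letters \<open>a\<close> and \<open>b\<close> are
  linked through words beginning with \<open>a b\<close> and \<open>b a\<close>. Such words exist
  because both letters are descents and commute.\<close>

lemma FC_of_ldesc:
  assumes x: "x \<in> carrier G"
    and step: "\<And>r. r \<in> ldesc x \<Longrightarrow> r \<otimes> x \<in> FC"
    and comm: "\<And>r r'. r \<in> ldesc x \<Longrightarrow> r' \<in> ldesc x \<Longrightarrow> r \<otimes> r' = r' \<otimes> r"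
  shows "x \<in> FC"
proof (rule FC_I[OF x])
  fix xs ys assume r: "reduced xs" "reduced ys" "wprod xs = x" "wprod ys = x"
  show "xs \<bowtie> ys"
  proof (cases xs)
    case Nil
    hence "len x = 0" using r by auto
    thus ?thesis using Nil r by (simp add: reduced_def)
  next
    case (Cons a xs')
    have "length xs = length ys" using r by (metis reduced_len)
    then obtain b ys' where ys: "ys = b # ys'" using Cons by (cases ys) auto
    note a = reduced_ConsD[OF r(1)[unfolded Cons]] and b = reduced_ConsD[OF r(2)[unfolded ys]]
    have ad: "a \<in> ldesc x" "b \<in> ldesc x" using a b r Cons ys by auto
    have xs': "wprod xs' = a \<otimes> x" "wprod ys' = b \<otimes> x"
    proof -
      have "x = a \<otimes> wprod xs'" "x = b \<otimes> wprod ys'" using r Cons ys by auto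
      thus "wprod xs' = a \<otimes> x" "wprod ys' = b \<otimes> x"
        using a(1) b(1) reduced_lists[OF a(2)] reduced_lists[OF b(2)] by (metis gen_cancel wprod_closed)+
    qed
    show ?thesis
    proof (cases "a = b")
      case True
      have "xs' \<bowtie> ys'" using FC_D[OF step[OF ad(1)]] a b xs' True by blast
      thus ?thesis using Cons ys True commutes_to_Cons by simp
    next
      case False
      have ab: "a \<otimes> b = b \<otimes> a" using comm ad by blast
      have "b \<in> ldesc (a \<otimes> x)" by (rule ldesc_of_two_ldesc(1)[OF x ad False])
      then obtain us where us: "reduced (b # us)" "wprod us = b \<otimes> (a \<otimes> x)"
        using reduced_Cons_exists[of "a \<otimes> x" b] x a by auto
      have 1: "wprod (b # us) = a \<otimes> x" using us x a b by simp
      have 2: "wprod (a # us) = b \<otimes> x"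
      proof -
        have "wprod (a # us) = (a \<otimes> b) \<otimes> (a \<otimes> x)" using us a b x by (simp add: m_assoc)
        thus ?thesis using ab a b x by (simp add: m_assoc)
      qed
      have "reduced us" using reduced_ConsD us by blast
      have "len (b \<otimes> x) = Suc (length us)"
        using len_ldesc[OF x ad(2)] len_ldesc[OF x ad(1)] reduced_len[OF us(1)] 1 by simp
      hence 3: "reduced (a # us)" using a \<open>reduced us\<close> 2 by (simp add: reduced_def)
      have "xs \<bowtie> a # b # us" unfolding Cons
        by (rule commutes_to_Cons) (rule FC_D[OF step[OF ad(1)] a(2) us(1) xs'(1) 1])
      also have "a # b # us \<bowtie> b # a # us" by (rule commutes_to_swap[OF ab])
      also have "b # a # us \<bowtie> ys" unfolding ys
        by (rule commutes_to_Cons) (rule FC_D[OF step[OF ad(2)] 3 b(2) 2 xs'(2)])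
      finally show ?thesis .
    qed
  qed
qed

lemma FC_suffix: "\<lbrakk>reduced (us @ vs); wprod (us @ vs) \<in> FC\<rbrakk> \<Longrightarrow> wprod vs \<in> FC"
proof (induction us)
  case (Cons s us)
  note s = reduced_ConsD[OF Cons.prems(1)[unfolded append_Cons]]
  have "wprod (us @ vs) = s \<otimes> wprod (s # us @ vs)" using s reduced_lists[OF s(2)] by simp
  hence "wprod (us @ vs) \<in> FC" using FC_ldesc[of "wprod (s # us @ vs)" s] Cons.prems s by simp
  thus ?case using Cons.IH s by simp
qed simp

section \<open>Products with a generator that leave the fully commutative elements\<close>

lemma not_FC_ldesc:
  assumes "w \<in> FC" "p \<in> S" "p \<otimes> w \<notin> FC" shows "p \<notin> ldesc w"
  using assms FC_ldesc by blast

text \<open>By the descent criterion, \<open>p w\<close> fails at a descent \<open>r\<close> whose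
  removal does not help, or at two noncommuting descents. Descents commuting with \<open>p\<close>
  come from \<open>w\<close>, so either a braid involving \<open>p\<close> is visible at the left
  end, or a commuting letter can be stripped off. The inductions below follow this
  alternative.\<close>

lemma not_FC_mult_cases:
  assumes "w \<in> FC" "p \<in> S" "p \<otimes> w \<notin> FC"
  obtains r where "r \<in> ldesc (p \<otimes> w)" "p \<otimes> r \<noteq> r \<otimes> p"
  | r where "r \<in> ldesc w" "r \<noteq> p" "p \<otimes> r = r \<otimes> p" "p \<otimes> (r \<otimes> w) \<notin> FC"
proof -
  have w: "w \<in> carrier G" "p \<notin> ldesc w" using assms FC_closed not_FC_ldesc by auto
  have comm: "r \<in> ldesc w" if "r \<in> ldesc (p \<otimes> w)" "p \<otimes> r = r \<otimes> p" "r \<noteq> p" for r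
    using ldesc_commute[of w p r] that w assms ldescD by blast
  consider r where "r \<in> ldesc (p \<otimes> w)" "r \<otimes> (p \<otimes> w) \<notin> FC"
    | r r' where "r \<in> ldesc (p \<otimes> w)" "r' \<in> ldesc (p \<otimes> w)" "r \<otimes> r' \<noteq> r' \<otimes> r"
    using FC_of_ldesc[of "p \<otimes> w"] assms w by blast
  thus ?thesis
  proof cases
    case (1 r)
    have r: "r \<in> S" "r \<noteq> p" using 1 ldescD assms w by auto
    show ?thesis
    proof (cases "p \<otimes> r = r \<otimes> p")
      case True
      have "r \<otimes> (p \<otimes> w) = p \<otimes> (r \<otimes> w)" using True r assms w by (simp flip: m_assoc)
      thus ?thesis using that(2)[of r] comm[of r] 1 r True by simp
    qed (use that(1) 1 in blast)
  next
    case (2 r r')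
    show ?thesis
    proof (cases "p \<otimes> r = r \<otimes> p \<and> p \<otimes> r' = r' \<otimes> p")
      case True
      hence "r \<noteq> p" "r' \<noteq> p" using 2 by auto
      hence "r \<in> ldesc w" "r' \<in> ldesc w" using comm 2 True by auto
      thus ?thesis using FC_ldesc_commute assms 2 by blast
    qed (use that(1) 2 in blast)
  qed
qed

text \<open>The braid involving \<open>p\<close> has a unique partner. If it were some
  \<open>r\<close> other than \<open>q\<close>, the fully commutative element \<open>r z\<close>
  would have both \<open>p\<close> and \<open>q\<close> as descents. Commuting letters covering the
  braid are stripped off by induction and restored by a length count.\<close>

lemma ldesc_not_FC_mult:
  assumes "z \<in> FC" "p \<in> S" "p \<otimes> z \<notin> FC" "q \<in> ldesc z" "p \<otimes> q \<noteq> q \<otimes> p"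
  shows "q \<in> ldesc (p \<otimes> z)"
  using assms
proof (induction "len z" arbitrary: z rule: less_induct)
  case less
  have z: "z \<in> carrier G" "p \<notin> ldesc z" using less.prems FC_closed not_FC_ldesc by auto
  have q: "q \<in> S" using less.prems ldescD by auto
  have p: "p \<in> ldesc (p \<otimes> z)" using z less.prems ldesc_mult_iff by blast
  from less.prems(1-3) show ?case
  proof (cases rule: not_FC_mult_cases)
    case (1 r)
    have ne: "r \<noteq> p" using 1 by auto
    have r: "r \<in> ldesc z" "p \<in> ldesc (r \<otimes> z)"
      using ldesc_of_two_ldesc[of "p \<otimes> z" p r] p 1 ne z less.prems by auto
    show ?thesis
    proof (cases "r = q")
      case False
      have "q \<in> ldesc (r \<otimes> z)"
        using ldesc_of_two_ldesc(1)[of z r q] z r less.prems False by blast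
      moreover have "r \<otimes> z \<in> FC" using FC_ldesc less.prems r by blast
      ultimately show ?thesis using FC_ldesc_commute r less.prems by blast
    qed (use 1 in simp)
  next
    case (2 r)
    have rS: "r \<in> S" using 2 ldescD by auto
    have ne: "r \<noteq> q" using 2 less.prems by auto
    have rz: "r \<otimes> z \<in> FC" using FC_ldesc less.prems 2 by blast
    have "q \<in> ldesc (r \<otimes> z)" using ldesc_of_two_ldesc(1)[of z r q] z 2 less.prems ne by blast
    moreover have lr: "len z = Suc (len (r \<otimes> z))" using len_ldesc z 2 by blast
    ultimately have "q \<in> ldesc (p \<otimes> (r \<otimes> z))" using less.hyps[of "r \<otimes> z"] rz less.prems 2 by auto
    moreover have rq: "r \<otimes> q = q \<otimes> r" using FC_ldesc_commute less.prems 2 by blast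
    ultimately have l: "len (q \<otimes> (p \<otimes> (r \<otimes> z))) < len (p \<otimes> (r \<otimes> z))" using ldescD by blast
    have "q \<otimes> (p \<otimes> z) = r \<otimes> (q \<otimes> (p \<otimes> (r \<otimes> z)))"
    proof -
      have "r \<otimes> (q \<otimes> (p \<otimes> (r \<otimes> z))) = (q \<otimes> r) \<otimes> (p \<otimes> (r \<otimes> z))"
        using rq rS q z less.prems by (simp flip: m_assoc)
      also have "\<dots> = q \<otimes> ((p \<otimes> r) \<otimes> (r \<otimes> z))" using 2 rS q z less.prems by (simp add: m_assoc)
      also have "\<dots> = q \<otimes> (p \<otimes> z)" using rS q z less.prems by (simp add: m_assoc)
      finally show ?thesis by simp
    qed
    hence "len (q \<otimes> (p \<otimes> z)) \<le> Suc (len (q \<otimes> (p \<otimes> (r \<otimes> z))))"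
      using len_mult_le[of r "q \<otimes> (p \<otimes> (r \<otimes> z))"] rS q z less.prems by simp
    moreover have "len (p \<otimes> (r \<otimes> z)) \<le> Suc (len (r \<otimes> z))"
      using len_mult_le[of p "r \<otimes> z"] rS z less.prems by simp
    moreover have "len (p \<otimes> z) = Suc (len z)" using len_not_ldesc z less.prems by blast
    ultimately show ?thesis using l lr q by (simp add: ldesc_def)
  qed
qed

text \<open>The letter \<open>t\<close> is not part of the braid created by \<open>s\<close>: if
  that braid is visible through a descent \<open>r\<close>, then \<open>r\<close> and
  \<open>s\<close> remain noncommuting descents after \<open>t\<close> is removed.\<close>

lemma not_FC_mult_ldesc:
  assumes "w \<in> FC" "s \<in> S" "s \<otimes> w \<notin> FC" "t \<in> ldesc w" "s \<otimes> t = t \<otimes> s"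
  shows "s \<otimes> (t \<otimes> w) \<notin> FC"
  using assms
proof (induction "len w" arbitrary: w rule: less_induct)
  case less
  have w: "w \<in> carrier G" "s \<notin> ldesc w" using less.prems FC_closed not_FC_ldesc by auto
  have t: "t \<in> S" "t \<noteq> s" using less.prems ldescD w by auto
  have s: "s \<in> ldesc (s \<otimes> w)" using w less.prems ldesc_mult_iff by blast
  have tsw: "t \<in> ldesc (s \<otimes> w)" using ldesc_commute[of w s t] w less.prems t by blast
  have st: "s \<otimes> (t \<otimes> w) = t \<otimes> (s \<otimes> w)" using less.prems t w by (simp flip: m_assoc)
  from less.prems(1-3) show ?case
  proof (cases rule: not_FC_mult_cases)
    case (1 r)
    hence "r \<noteq> t" using less.prems by auto
    have "r \<in> ldesc (t \<otimes> (s \<otimes> w))" "s \<in> ldesc (t \<otimes> (s \<otimes> w))"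
      using ldesc_of_two_ldesc(1)[of "s \<otimes> w" t] tsw 1 s \<open>r \<noteq> t\<close> t w less.prems by auto
    thus ?thesis using FC_ldesc_commute 1 st by metis
  next
    case (2 r)
    have rS: "r \<in> S" using 2 ldescD by auto
    show ?thesis
    proof (cases "r = t")
      case False
      have rt: "r \<otimes> t = t \<otimes> r" using FC_ldesc_commute less.prems 2 by blast
      have "t \<in> ldesc (r \<otimes> w)" "r \<in> ldesc (t \<otimes> w)"
        using ldesc_of_two_ldesc(1)[of w] w 2 less.prems False by auto
      have "s \<otimes> (t \<otimes> (r \<otimes> w)) \<notin> FC"
        by (rule less.hyps)
          (use less.prems 2 FC_ldesc \<open>t \<in> ldesc (r \<otimes> w)\<close> len_ldesc[OF w(1), of r] in auto)
      moreover have "s \<otimes> (t \<otimes> (r \<otimes> w)) = r \<otimes> (s \<otimes> (t \<otimes> w))"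
      proof -
        have "s \<otimes> (t \<otimes> (r \<otimes> w)) = s \<otimes> ((r \<otimes> t) \<otimes> w)"
          using rt rS t w less.prems by (simp add: m_assoc)
        also have "\<dots> = (s \<otimes> r) \<otimes> (t \<otimes> w)" using rS t w less.prems by (simp add: m_assoc)
        finally show ?thesis using 2 rS t w less.prems by (simp add: m_assoc)
      qed
      moreover have "r \<in> ldesc (s \<otimes> (t \<otimes> w))"
      proof (cases "s \<in> ldesc (t \<otimes> w)")
        case True
        hence "s \<in> ldesc w" using ldesc_commute[of "t \<otimes> w" t s] w t less.prems not_ldesc_mult by simp
        thus ?thesis using w by blast
      next
        case False
        thus ?thesis using ldesc_commute[of "t \<otimes> w" s r] \<open>r \<in> ldesc (t \<otimes> w)\<close> w t rS 2 less.prems by simp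
      qed
      ultimately show ?thesis using FC_ldesc by metis
    qed (use 2 in simp)
  qed
qed

lemma ldesc_commuting_word:
  assumes "ws \<in> lists S" "\<And>s t. s \<in> set ws \<Longrightarrow> t \<in> set ws \<Longrightarrow> s \<otimes> t = t \<otimes> s" "r \<in> ldesc (wprod ws)"
  shows "r \<in> set ws"
proof -
  obtain us a vs where e: "ws = us @ a # vs" "r \<otimes> wprod us = wprod us \<otimes> a"
    using exchange assms by blast
  have us: "us \<in> lists S" "a \<in> S" "r \<in> S" using e assms ldescD by auto
  have "wprod us \<otimes> a = a \<otimes> wprod us" if "set us \<subseteq> set ws"
    using that us(1)
  proof (induction us)
    case (Cons u us)
    have "u \<otimes> a = a \<otimes> u" using Cons.prems e by (intro assms(2)) auto
    moreover have "wprod us \<otimes> a = a \<otimes> wprod us" using Cons by auto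
    moreover have "u \<in> S" "us \<in> lists S" using Cons.prems by auto
    ultimately show ?case using us by (metis gen_closed m_assoc wprod_closed word_prod_Cons)
  qed (use us in simp)
  hence "r \<otimes> wprod us = a \<otimes> wprod us" using e by auto
  hence "r = a" using us by (simp add: r_cancel)
  thus ?thesis using e by simp
qed

text \<open>A braid \<open>p r p\<close> at the left end would need both \<open>r\<close> and
  \<open>p\<close> among the letters of \<open>ws\<close>, where they commute. This makes the end
  points of star reduction harmless.\<close>

lemma commuting_products_mult_FC:
  assumes "ws \<in> lists S" "distinct ws" "\<And>s t. s \<in> set ws \<Longrightarrow> t \<in> set ws \<Longrightarrow> s \<otimes> t = t \<otimes> s"
    "wprod ws \<in> FC" "p \<in> S"
  shows "p \<otimes> wprod ws \<in> FC"
  using assms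
proof (induction "length ws" arbitrary: ws rule: less_induct)
  case less
  note w = less.prems
  have ind: "\<exists>vs. wprod vs = r \<otimes> wprod ws \<and> length vs < length ws \<and> distinct vs \<and> set vs = set ws - {r}"
    if r: "r \<in> set ws" for r
  proof -
    obtain us vs where us: "ws = us @ r # vs" using r by (meson split_list)
    have l: "us \<in> lists S" "vs \<in> lists S" "r \<in> S" using us w by auto
    have "r \<otimes> wprod us = wprod us \<otimes> r" if "set us \<subseteq> set ws"
      using that l(1)
    proof (induction us)
      case (Cons u us)
      have "u \<otimes> r = r \<otimes> u" using Cons.prems r by (intro w(3)) auto
      moreover have "r \<otimes> wprod us = wprod us \<otimes> r" using Cons by auto
      moreover have "u \<in> S" "us \<in> lists S" using Cons.prems by auto
      ultimately show ?case using l by (metis gen_closed m_assoc wprod_closed word_prod_Cons)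
    qed (use l in simp)
    hence ru: "r \<otimes> wprod us = wprod us \<otimes> r" using us by auto
    have "r \<otimes> wprod ws = (r \<otimes> wprod us) \<otimes> (r \<otimes> wprod vs)"
      using us l by (simp add: wprod_append m_assoc)
    also have "\<dots> = wprod (us @ vs)" unfolding ru using l by (simp add: wprod_append m_assoc)
    finally show ?thesis using us w(2) by (intro exI[of _ "us @ vs"]) auto
  qed
  have wc: "wprod ws \<in> carrier G" using w by simp
  show ?case
  proof (rule ccontr)
    assume nFC: "p \<otimes> wprod ws \<notin> FC"
    have np: "p \<notin> ldesc (wprod ws)" using not_FC_ldesc w nFC by blast
    hence pd: "p \<in> ldesc (p \<otimes> wprod ws)" using ldesc_mult_iff wc w by blast
    from w(4,5) nFC show False
    proof (cases rule: not_FC_mult_cases)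
      case (1 r)
      have "r \<noteq> p" using 1 by auto
      hence r: "r \<in> ldesc (wprod ws)" "p \<in> ldesc (r \<otimes> wprod ws)"
        using ldesc_of_two_ldesc[of "p \<otimes> wprod ws" p r] pd 1 wc w by auto
      have rw: "r \<in> set ws" using ldesc_commuting_word[OF w(1,3) r(1)] .
      then obtain vs where vs: "wprod vs = r \<otimes> wprod ws" "set vs = set ws - {r}" using ind by blast
      have "p \<in> set vs" using ldesc_commuting_word[of vs p] vs w r by auto
      hence "p \<otimes> r = r \<otimes> p" using vs rw w by auto
      thus False using 1 by blast
    next
      case (2 r)
      have "r \<in> set ws" using ldesc_commuting_word[OF w(1,3) 2(1)] .
      then obtain vs where vs: "wprod vs = r \<otimes> wprod ws" "length vs < length ws" "distinct vs"
        "set vs = set ws - {r}" using ind by blast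
      have "p \<otimes> wprod vs \<in> FC"
        by (rule less.hyps) (use vs w 2 FC_ldesc in auto)
      thus False using 2 vs by simp
    qed
  qed
qed

end

section \<open>The Bruhat order\<close>

lemma subseq_set_subset: "subseq xs ys \<Longrightarrow> set xs \<subseteq> set ys"
  by (induction rule: list_emb.induct) auto

lemma subseq_Cons_right_iff:
  "subseq xs (y # ys) \<longleftrightarrow> subseq xs ys \<or> (\<exists>zs. xs = y # zs \<and> subseq zs ys)"
  by (cases xs) (auto dest: subseq_Cons')

lemma subseq_rev: "subseq xs ys \<Longrightarrow> subseq (rev xs) (rev ys)"
  by (induction rule: list_emb.induct) (auto intro: subseq_rev_drop_many list_emb_append_mono)

context coxeter_system
begin

definition subproducts :: "'w list \<Rightarrow> 'w set" where
  "subproducts ws = {wprod vs | vs. subseq vs ws}"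

lemma subseq_lists: "subseq vs ws \<Longrightarrow> ws \<in> lists S \<Longrightarrow> vs \<in> lists S"
  using subseq_set_subset by fastforce

lemma subproducts_closed: "ws \<in> lists S \<Longrightarrow> subproducts ws \<subseteq> carrier G"
  unfolding subproducts_def using subseq_lists wprod_closed by blast

lemma subproducts_append:
  assumes "us \<in> lists S" "vs \<in> lists S"
  shows "subproducts (us @ vs) = {a \<otimes> b | a b. a \<in> subproducts us \<and> b \<in> subproducts vs}"
proof -
  have e: "wprod (as @ bs) = wprod as \<otimes> wprod bs" if "subseq as us" "subseq bs vs" for as bs
    using wprod_append[OF subseq_lists[OF that(1) assms(1)] subseq_lists[OF that(2) assms(2)]] .
  show ?thesis
  proof (rule subset_antisym; rule subsetI)
    fix x assume "x \<in> subproducts (us @ vs)"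
    then obtain as bs where "x = wprod (as @ bs)" "subseq as us" "subseq bs vs"
      by (auto simp: subproducts_def subseq_append_iff)
    thus "x \<in> {a \<otimes> b | a b. a \<in> subproducts us \<and> b \<in> subproducts vs}"
      using e unfolding subproducts_def by blast
  next
    fix x assume "x \<in> {a \<otimes> b | a b. a \<in> subproducts us \<and> b \<in> subproducts vs}"
    then obtain as bs where "x = wprod (as @ bs)" "subseq as us" "subseq bs vs"
      using e unfolding subproducts_def by force
    thus "x \<in> subproducts (us @ vs)" unfolding subproducts_def subseq_append_iff by blast
  qed
qed

lemma subproducts_Cons:
  "subproducts (s # ws) = subproducts ws \<union> (\<lambda>x. s \<otimes> x) ` subproducts ws"
proof -
  have "subproducts (s # ws) = {wprod vs | vs. subseq vs ws \<or> (\<exists>us. vs = s # us \<and> subseq us ws)}"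
    unfolding subproducts_def subseq_Cons_right_iff ..
  also have "\<dots> = {wprod vs | vs. subseq vs ws} \<union> {wprod (s # us) | us. subseq us ws}" by blast
  finally show ?thesis by (auto simp: subproducts_def)
qed

lemma set_alt_word: "set (alt_word s t k) \<subseteq> {s, t}"
  by (induction s t k rule: alt_word.induct) auto

lemma prefix_alt_word: "i \<le> j \<Longrightarrow> subseq (alt_word s t i) (alt_word s t j)"
  using alt_word_add[of s t i "j - i"] by (simp add: subseq_rev_drop_many)

text \<open>Prefixes give the products starting with \<open>s\<close>, and dropping the first letter
  gives those starting with \<open>t\<close>; the longest product is reached either way. The
  right-hand side is symmetric in the two generators.\<close>

lemma subproducts_alt_word:
  assumes "s \<in> S" "t \<in> S" "m s t = enat (Suc n)"
  shows "subproducts (alt_word s t (Suc n)) = dihedral s t"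
proof (rule subset_antisym; rule subsetI)
  fix x assume "x \<in> subproducts (alt_word s t (Suc n))"
  then obtain vs where "x = wprod vs" "subseq vs (alt_word s t (Suc n))"
    by (auto simp: subproducts_def)
  moreover have "vs \<in> lists {s, t}"
    using calculation set_alt_word[of s t "Suc n"] subseq_set_subset[of vs "alt_word s t (Suc n)"] by auto
  ultimately show "x \<in> dihedral s t" using wprod_dihedral assms by blast
next
  fix x assume "x \<in> dihedral s t"
  then obtain a b k where x: "x = altp a b k" "{a, b} = {s, t}" "k \<le> Suc n"
    using assms by (auto simp: dihedral_def)
  consider "a = s" "b = t" | "a = t" "b = s" "k \<le> n" | "a = t" "b = s" "k = Suc n"
    using x by (auto simp: doubleton_eq_iff le_Suc_eq)
  thus "x \<in> subproducts (alt_word s t (Suc n))"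
  proof cases
    case 1
    thus ?thesis using x prefix_alt_word[OF x(3), of s t] unfolding subproducts_def by blast
  next
    case 2
    have "subseq (alt_word t s k) (alt_word s t (Suc n))"
      using list_emb_Cons[OF prefix_alt_word[OF 2(3), of t s], of s] by simp
    thus ?thesis using x 2 unfolding subproducts_def by blast
  next
    case 3
    hence "x = altp s t (Suc n)" using x braid_relation assms by metis
    thus ?thesis unfolding subproducts_def by blast
  qed
qed

text \<open>When the first letters differ, the element starts with a longest alternating word. By
  induction both words may be replaced by ones starting with such an alternating word, and for these
  the set is the dihedral group times the subproducts of a common remainder.\<close>

lemma subproducts_reduced:
  "\<lbrakk>reduced xs; reduced ys; wprod xs = wprod ys\<rbrakk> \<Longrightarrow> subproducts xs = subproducts ys"
proof (induction "length xs" arbitrary: xs ys rule: less_induct)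
  case less
  have l: "length xs = length ys" using less.prems by (metis reduced_len)
  show ?case
  proof (cases xs)
    case Nil thus ?thesis using l by simp
  next
    case (Cons a xs')
    then obtain b ys' where ys: "ys = b # ys'" using l by (cases ys) auto
    note a = reduced_ConsD[OF less.prems(1)[unfolded Cons]]
      and b = reduced_ConsD[OF less.prems(2)[unfolded ys]]
    have ls: "xs' \<in> lists S" "ys' \<in> lists S" using a b reduced_lists by blast+
    show ?thesis
    proof (cases "a = b")
      case True
      hence "wprod xs' = wprod ys'" using less.prems a ls Cons ys by simp
      hence "subproducts xs' = subproducts ys'" using less.hyps[of xs' ys'] a b Cons by simp
      thus ?thesis using Cons ys True subproducts_Cons by simp
    next
      case False
      have xc: "wprod xs \<in> carrier G" using less.prems reduced_lists by blast
      have "a \<in> ldesc (wprod xs)" "b \<in> ldesc (wprod xs)" using a b less.prems Cons ys by auto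
      then obtain n u where d: "m a b = enat n" "left_reduced a b u" "wprod xs = altp a b n \<otimes> u"
        using two_ldesc[OF xc] False by blast
      obtain us where us: "reduced us" "wprod us = u" using reduced_exists d by blast
      have usl: "us \<in> lists S" using us reduced_lists by blast
      obtain k where n: "n = Suc k" using matrix_ge_2[OF a(1) b(1) False d(1)] by (cases n) auto
      have key: "subproducts zs = {x \<otimes> y | x y. x \<in> dihedral a b \<and> y \<in> subproducts us}"
        if z: "zs = c # zs'" "{c, d} = {a, b}" "reduced zs" "wprod zs = wprod xs" for zs c d zs'
      proof -
        have cd: "c \<in> S" "d \<in> S" "m c d = enat n" "dihedral c d = dihedral a b"
        proof -
          show "c \<in> S" "d \<in> S" "m c d = enat n"
            using z(2) a b d(1) matrix_sym[of a b] by (auto simp: doubleton_eq_iff)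
          show "dihedral c d = dihedral a b"
            unfolding dihedral_def z(2) using \<open>m c d = enat n\<close> d(1) by simp
        qed
        note c = reduced_ConsD[OF z(3)[unfolded z(1)]]
        have zl: "zs' \<in> lists S" using c reduced_lists by blast
        have r: "reduced (alt_word c d n @ us)" "reduced (alt_word d c k @ us)"
          by (rule altp_mult_reduced[OF a(1) b(1) False];
            use d us z(2) n in \<open>simp add: insert_commute\<close>)+
        have al: "alt_word c d n \<in> lists S" "alt_word d c k \<in> lists S" using cd alt_word_in_lists by blast+
        have "wprod xs = altp c d n \<otimes> u"
          using z(2) d braid_relation[of a b n] a b by (auto simp: doubleton_eq_iff)
        hence "c \<otimes> wprod zs' = c \<otimes> (altp d c k \<otimes> u)" using z n cd d by (simp add: m_assoc)
        hence "wprod zs' = altp d c k \<otimes> u" using cd d zl by simp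
        hence "wprod zs' = wprod (alt_word d c k @ us)" using al usl us by (simp add: wprod_append)
        moreover have "length zs' < length xs" using l less.prems(1) z by (metis reduced_len length_Cons lessI)
        ultimately have "subproducts zs' = subproducts (alt_word d c k @ us)"
          using less.hyps[of zs' "alt_word d c k @ us"] c r by simp
        hence "subproducts zs = subproducts (alt_word c d n @ us)"
          using z n subproducts_Cons by simp
        thus ?thesis using subproducts_append[OF al(1) usl] subproducts_alt_word[of c d k] cd n by simp
      qed
      show ?thesis
        using key[of xs a xs' b] key[of ys b ys' a] Cons ys less.prems by (simp add: insert_commute)
    qed
  qed
qed

text \<open>The lower interval in the subword form of the Bruhat order. The union over reduced words
  avoids choosing one; all of them contribute the same set.\<close>

definition bruhat :: "'w \<Rightarrow> 'w set" where
  "bruhat x = (\<Union>ws \<in> {ws. reduced ws \<and> wprod ws = x}. subproducts ws)"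

lemma bruhat_eq: "reduced ws \<Longrightarrow> bruhat (wprod ws) = subproducts ws"
  unfolding bruhat_def using subproducts_reduced by blast

lemma bruhat_closed: "bruhat x \<subseteq> carrier G"
  unfolding bruhat_def using subproducts_closed reduced_lists by blast

lemma bruhat_refl: "x \<in> carrier G \<Longrightarrow> x \<in> bruhat x"
  using reduced_exists[of x] bruhat_eq unfolding subproducts_def by fastforce

lemma bruhat_mult_eq:
  assumes "x \<in> carrier G" "s \<in> ldesc x"
  shows "bruhat x = bruhat (s \<otimes> x) \<union> (\<lambda>z. s \<otimes> z) ` bruhat (s \<otimes> x)"
proof -
  obtain ws where ws: "reduced (s # ws)" "wprod ws = s \<otimes> x" using reduced_Cons_exists assms by blast
  note s = reduced_ConsD[OF ws(1)]
  have "wprod (s # ws) = x" using ws s assms by simp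
  thus ?thesis using bruhat_eq[OF ws(1)] bruhat_eq[OF s(2)] subproducts_Cons ws
    by simp
qed

text \<open>A form of the lifting property. It keeps every product formed in the main estimate below
  the element being estimated.\<close>

lemma bruhat_mult_closed:
  assumes "x \<in> carrier G" "s \<in> ldesc x" "z \<in> bruhat x" shows "s \<otimes> z \<in> bruhat x"
proof -
  have "s \<in> S" "bruhat (s \<otimes> x) \<subseteq> carrier G" using assms ldescD bruhat_closed by auto
  thus ?thesis using assms(3) unfolding bruhat_mult_eq[OF assms(1,2)] by auto
qed

lemma bruhat_mult_subset:
  assumes "x \<in> carrier G" "s \<in> ldesc x" shows "bruhat (s \<otimes> x) \<subseteq> bruhat x"
  using bruhat_mult_eq[OF assms] by blast

lemma bruhat_trans:
  assumes "x \<in> carrier G" "y \<in> bruhat x" shows "bruhat y \<subseteq> bruhat x"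
proof -
  obtain ws where ws: "reduced ws" "wprod ws = x" using reduced_exists assms by blast
  then obtain vs where vs: "subseq vs ws" "y = wprod vs"
    using assms bruhat_eq[OF ws(1)] by (auto simp: subproducts_def)
  have "vs \<in> lists S" using vs ws reduced_lists subseq_lists by blast
  then obtain us where us: "subseq us vs" "reduced us" "wprod us = y" using reduced_subseq vs by blast
  have "subproducts us \<subseteq> subproducts ws"
    using us vs unfolding subproducts_def by (blast intro: subseq_order.order_trans)
  thus ?thesis using bruhat_eq us ws by metis
qed

lemma bruhat_len:
  assumes "x \<in> carrier G" "y \<in> bruhat x" shows "y = x \<or> len y < len x"
proof -
  obtain ws where ws: "reduced ws" "wprod ws = x" using reduced_exists assms by blast
  then obtain vs where vs: "subseq vs ws" "y = wprod vs"
    using assms bruhat_eq[OF ws(1)] by (auto simp: subproducts_def)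
  have "vs \<in> lists S" using subseq_lists[OF vs(1) reduced_lists[OF ws(1)]] .
  hence l: "len y \<le> length vs" using len_le vs(2) by blast
  have lx: "len x = length ws" using reduced_len[OF ws(1)] ws(2) by simp
  show ?thesis
  proof (cases "length vs = length ws")
    case True
    hence "vs = ws" by (rule subseq_same_length[OF vs(1)])
    thus ?thesis using vs ws by simp
  next
    case False
    thus ?thesis using l lx list_emb_length[OF vs(1)] by simp
  qed
qed

lemma altp_bruhat:
  assumes "s \<in> S" "t \<in> S" "s \<noteq> t" "m s t = enat n" "left_reduced s t u" "y \<in> dihedral s t"
  shows "y \<otimes> u \<in> bruhat (altp s t n \<otimes> u)"
proof -
  obtain us where us: "reduced us" "wprod us = u" using reduced_exists assms by blast
  have l: "us \<in> lists S" "alt_word s t n \<in> lists S" using us assms reduced_lists alt_word_in_lists by blast+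
  have r: "reduced (alt_word s t n @ us)"
    by (rule altp_mult_reduced[OF assms(1-3)]) (use assms us in auto)
  obtain k where n: "n = Suc k" using matrix_ge_2[OF assms(1-4)] by (cases n) auto
  have "u \<in> subproducts us" using us unfolding subproducts_def by blast
  moreover have "y \<in> subproducts (alt_word s t n)"
    using subproducts_alt_word[of s t k] assms unfolding n by blast
  ultimately have "y \<otimes> u \<in> subproducts (alt_word s t n @ us)"
    unfolding subproducts_append[OF l(2,1)] by blast
  moreover have "altp s t n \<otimes> u = wprod (alt_word s t n @ us)" using us wprod_append[OF l(2,1)] by simp
  ultimately show ?thesis using bruhat_eq[OF r] by simp
qed

lemma generate_dihedral:
  assumes "s \<in> S" "t \<in> S" shows "generate G {s, t} = dihedral s t"
proof (rule subset_antisym; rule subsetI)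
  fix y assume "y \<in> generate G {s, t}"
  hence "\<exists>ys \<in> lists {s, t}. wprod ys = y"
  proof induction
    case one thus ?case by (intro bexI[of _ "[]"]) auto
  next
    case (incl h) thus ?case using assms by (intro bexI[of _ "[h]"]) auto
  next
    case (inv h) thus ?case using assms by (intro bexI[of _ "[h]"]) auto
  next
    case (eng h1 h2)
    then obtain us vs where l: "us \<in> lists {s, t}" "vs \<in> lists {s, t}" "wprod us = h1" "wprod vs = h2"
      by blast
    have "us \<in> lists S" "vs \<in> lists S" using l assms by auto
    thus ?case using l by (intro bexI[of _ "us @ vs"]) (auto simp: wprod_append)
  qed
  thus "y \<in> dihedral s t" using wprod_dihedral assms by blast
next
  fix y assume "y \<in> dihedral s t"
  then obtain a b k where y: "y = altp a b k" "{a, b} = {s, t}" by (auto simp: dihedral_def)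
  have "wprod ys \<in> generate G {s, t}" if "set ys \<subseteq> {s, t}" for ys
    using that by (induction ys) (auto intro: generate.intros)
  thus "y \<in> generate G {s, t}" using y set_alt_word[of a b k] by simp
qed

end

section \<open>The opposite Coxeter system\<close>

text \<open>Only the multiplication field is updated, so any further record fields survive and
  reversing twice gives back \<open>G\<close> itself. Lengths, full commutativity and Bruhat
  intervals turn out to be the same for both groups.\<close>

definition opposite :: "('w, 'x) monoid_scheme \<Rightarrow> ('w, 'x) monoid_scheme" where
  "opposite G = G\<lparr>monoid.mult := \<lambda>x y. y \<otimes>\<^bsub>G\<^esub> x\<rparr>"

lemma opposite_simps [simp]:
  "carrier (opposite G) = carrier G" "\<one>\<^bsub>opposite G\<^esub> = \<one>\<^bsub>G\<^esub>"
  "x \<otimes>\<^bsub>opposite G\<^esub> y = y \<otimes>\<^bsub>G\<^esub> x" "opposite (opposite G) = G"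
  by (simp_all add: opposite_def)

lemma coxeter_cong_rev:
  assumes "\<And>s t. s \<in> S \<Longrightarrow> t \<in> S \<Longrightarrow> m s t = m t s"
  shows "coxeter_cong S m us vs \<Longrightarrow> coxeter_cong S m (rev us) (rev vs)"
proof (induction rule: coxeter_cong.induct)
  case (relator s t k us vs)
  have c: "concat (replicate k [t, s]) @ [t, s] = [t, s] @ concat (replicate k [t, s])" for k
    by (induction k) auto
  have "rev (concat (replicate k [s, t])) = concat (replicate k [t, s])"
    by (induction k) (use c in auto)
  moreover have "coxeter_cong S m (rev vs @ concat (replicate k [t, s]) @ rev us) (rev vs @ rev us)"
    using relator assms by (intro coxeter_cong.relator) auto
  ultimately show ?case by simp
qed (auto intro: coxeter_cong.intros)

context coxeter_system
begin

lemma opposite_word_prod: "ws \<in> lists S \<Longrightarrow> word_prod (opposite G) ws = wprod (rev ws)"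
  by (induction ws) (auto simp: wprod_append)

lemma coxeter_system_opposite: "coxeter_system (opposite G) S m"
proof -
  interpret op: group "opposite G"
    by (rule groupI) (auto simp: m_assoc intro: exI[of _ "inv _"] bexI[of _ "inv _"] r_inv)
  have "carrier G \<subseteq> generate (opposite G) S"
  proof
    fix x assume "x \<in> carrier G"
    then obtain ws where ws: "ws \<in> lists S" "wprod ws = x" using word_exists by blast
    have "wprod ws \<in> generate (opposite G) S" using ws(1)
    proof (induction ws rule: rev_induct)
      case Nil thus ?case using generate.one[of "opposite G" S] by simp
    next
      case (snoc s ws)
      have "wprod ws \<in> generate (opposite G) S" "s \<in> S" using snoc by auto
      hence "s \<otimes>\<^bsub>opposite G\<^esub> wprod ws \<in> generate (opposite G) S"
        by (intro generate.eng[OF generate.incl])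
      thus ?case using snoc by (simp add: wprod_append)
    qed
    thus "x \<in> generate (opposite G) S" using ws by simp
  qed
  moreover have "generate (opposite G) S \<subseteq> carrier G"
    using op.generate_in_carrier[of S] gens_subset by auto
  moreover have "word_prod (opposite G) us = word_prod (opposite G) vs \<longleftrightarrow> coxeter_cong S m us vs"
    if "us \<in> lists S" "vs \<in> lists S" for us vs
  proof -
    have "word_prod (opposite G) us = word_prod (opposite G) vs \<longleftrightarrow> coxeter_cong S m (rev us) (rev vs)"
      using that presentation[of "rev us" "rev vs"] by (simp add: opposite_word_prod)
    also have "\<dots> \<longleftrightarrow> coxeter_cong S m us vs"
      using coxeter_cong_rev[of S m us vs] coxeter_cong_rev[of S m "rev us" "rev vs"] matrix_sym by auto
    finally show ?thesis .
  qed
  ultimately show ?thesis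
    by unfold_locales (use gens_subset matrix_diag matrix_sym matrix_off_diag in auto)
qed

lemma opposite_len [simp]: "cox_length (opposite G) S w = len w"
proof -
  have "(\<exists>ws \<in> lists S. length ws = n \<and> word_prod (opposite G) ws = w)
    \<longleftrightarrow> (\<exists>ws \<in> lists S. length ws = n \<and> wprod ws = w)" for n
  proof
    assume "\<exists>ws \<in> lists S. length ws = n \<and> word_prod (opposite G) ws = w"
    then obtain ws where "ws \<in> lists S" "length ws = n" "word_prod (opposite G) ws = w" by blast
    thus "\<exists>ws \<in> lists S. length ws = n \<and> wprod ws = w"
      by (intro bexI[of _ "rev ws"]) (auto simp: opposite_word_prod)
  next
    assume "\<exists>ws \<in> lists S. length ws = n \<and> wprod ws = w"
    then obtain ws where "ws \<in> lists S" "length ws = n" "wprod ws = w" by blast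
    thus "\<exists>ws \<in> lists S. length ws = n \<and> word_prod (opposite G) ws = w"
      by (intro bexI[of _ "rev ws"]) (auto simp: opposite_word_prod)
  qed
  thus ?thesis by (simp add: cox_length_def)
qed

lemma opposite_reduced:
  "coxeter_system.reduced (opposite G) S ws \<longleftrightarrow> reduced (rev ws)"
proof -
  interpret op: coxeter_system "opposite G" S m by (rule coxeter_system_opposite)
  show ?thesis unfolding op.reduced_def reduced_def by (auto simp: opposite_word_prod)
qed

lemma opposite_commutation_step:
  "commutation_step (opposite G) (rev xs) (rev ys) \<longleftrightarrow> commutation_step G xs ys"
proof -
  have 1: "commutation_step H (rev xs) (rev ys)"
    if c: "commutation_step H' xs ys" and com: "\<And>s t. s \<otimes>\<^bsub>H'\<^esub> t = t \<otimes>\<^bsub>H'\<^esub> s \<Longrightarrow> s \<otimes>\<^bsub>H\<^esub> t = t \<otimes>\<^bsub>H\<^esub> s"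
    for xs ys and H H' :: "('w, 'x) monoid_scheme"
  proof -
    obtain us vs s t where e: "s \<otimes>\<^bsub>H'\<^esub> t = t \<otimes>\<^bsub>H'\<^esub> s" "xs = us @ [s, t] @ vs" "ys = us @ [t, s] @ vs"
      using c unfolding commutation_step_def by blast
    have "t \<otimes>\<^bsub>H\<^esub> s = s \<otimes>\<^bsub>H\<^esub> t" using com[OF e(1)] by simp
    thus ?thesis unfolding commutation_step_def e
      by (intro exI[of _ "rev vs"] exI[of _ "rev us"] exI[of _ t] exI[of _ s]) simp
  qed
  show ?thesis
    using 1[of G xs ys "opposite G"] 1[of "opposite G" "rev xs" "rev ys" G] by auto
qed

lemma opposite_commutes_to:
  assumes "xs \<bowtie> ys" shows "(commutation_step (opposite G))\<^sup>*\<^sup>* (rev xs) (rev ys)"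
  using assms by (induction rule: rtranclp_induct)
    (auto intro: rtranclp.rtrancl_into_rtrancl simp: opposite_commutation_step)

lemma FC_subset_opposite: "FC \<subseteq> fully_commutative (opposite G) S"
proof
  interpret op: coxeter_system "opposite G" S m by (rule coxeter_system_opposite)
  fix w assume w: "w \<in> FC"
  show "w \<in> fully_commutative (opposite G) S"
  proof (rule op.FC_I)
    show "w \<in> carrier (opposite G)" using w FC_closed by simp
    fix xs ys
    assume r: "op.reduced xs" "op.reduced ys" "op.wprod xs = w" "op.wprod ys = w"
    have "wprod (rev xs) = w" "wprod (rev ys) = w"
      using r op.reduced_lists[OF r(1)] op.reduced_lists[OF r(2)] by (simp_all add: opposite_word_prod)
    hence "rev xs \<bowtie> rev ys" using FC_D[OF w] r by (simp add: opposite_reduced)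
    thus "(commutation_step (opposite G))\<^sup>*\<^sup>* xs ys" using opposite_commutes_to by fastforce
  qed
qed

lemma opposite_FC [simp]: "fully_commutative (opposite G) S = FC"
  using FC_subset_opposite coxeter_system.FC_subset_opposite[OF coxeter_system_opposite] by auto

lemma opposite_bruhat [simp]: "coxeter_system.bruhat (opposite G) S x = bruhat x"
proof -
  interpret op: coxeter_system "opposite G" S m by (rule coxeter_system_opposite)
  have sub: "op.subproducts (rev ws) = subproducts ws" if "ws \<in> lists S" for ws
  proof -
    have e: "op.wprod vs = wprod (rev vs)" if "subseq vs (rev ws)" for vs
      using op.subseq_lists[OF that] \<open>ws \<in> lists S\<close> by (intro opposite_word_prod) simp
    show ?thesis
    proof (rule subset_antisym; rule subsetI)
      fix x assume "x \<in> op.subproducts (rev ws)"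
      then obtain vs where "x = wprod (rev vs)" "subseq vs (rev ws)"
        unfolding op.subproducts_def using e by blast
      moreover have "subseq (rev vs) ws" using calculation subseq_rev by fastforce
      ultimately show "x \<in> subproducts ws" unfolding subproducts_def by blast
    next
      fix x assume "x \<in> subproducts ws"
      then obtain vs where vs: "x = wprod vs" "subseq (rev vs) (rev ws)"
        unfolding subproducts_def using subseq_rev by blast
      hence "x = op.wprod (rev vs)" using e by simp
      thus "x \<in> op.subproducts (rev ws)" using vs unfolding op.subproducts_def by blast
    qed
  qed
  show ?thesis
  proof (cases "x \<in> carrier G")
    case True
    then obtain ws where ws: "reduced ws" "wprod ws = x" using reduced_exists by blast
    have l: "ws \<in> lists S" using ws reduced_lists by blast
    have "op.reduced (rev ws)" "op.wprod (rev ws) = x"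
      using ws l by (simp_all add: opposite_reduced opposite_word_prod)
    hence "op.bruhat x = op.subproducts (rev ws)" using op.bruhat_eq by blast
    thus ?thesis using sub[OF l] bruhat_eq[OF ws(1)] ws(2) by simp
  next
    case False
    hence e: "{ws. reduced ws \<and> wprod ws = x} = {}" using reduced_lists wprod_closed by blast
    have "op.wprod ws \<noteq> x" if "op.reduced ws" for ws
      using op.wprod_closed[OF op.reduced_lists[OF that]] False by auto
    hence "{ws. op.reduced ws \<and> op.wprod ws = x} = {}" by blast
    thus ?thesis unfolding bruhat_def op.bruhat_def e by (simp only: image_empty)
  qed
qed

section \<open>Star reductions\<close>

lemma right_star_opposite:
  "right_star_reducible_to G S m = left_star_reducible_to (opposite G) S m"
proof -
  have 1: "no_right_descent G S I = no_left_descent (opposite G) S I" for I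
    by (simp add: no_right_descent_def no_left_descent_def)
  have 2: "right_string G m s t u = left_string (opposite G) m s t u" if "s \<in> S" "t \<in> S" for s t u
    using that alt_word_in_lists[OF that] unfolding right_string_def left_string_def
    by (simp add: opposite_word_prod)
  have 3: "s \<otimes>\<^bsub>opposite G\<^esub> t \<noteq> t \<otimes>\<^bsub>opposite G\<^esub> s \<longleftrightarrow> s \<otimes> t \<noteq> t \<otimes> s" for s t by auto
  show ?thesis
    by (intro ext) (simp add: right_star_reducible_to_def left_star_reducible_to_def 1 2 3
      del: opposite_simps(3) cong: bex_cong)
qed

lemma left_star_opposite:
  "left_star_reducible_to G S m = right_star_reducible_to (opposite G) S m"
  using coxeter_system.right_star_opposite[OF coxeter_system_opposite] by simp

lemma commuting_products_opposite:
  "commuting_products (opposite G) S = commuting_products G S"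
proof -
  have "commuting_products (opposite G) S = {wprod (rev ws) | ws. ws \<in> lists S \<and> distinct ws \<and>
    (\<forall>s \<in> set ws. \<forall>t \<in> set ws. s \<otimes> t = t \<otimes> s)}"
    unfolding commuting_products_def using opposite_word_prod by (metis (no_types, lifting) opposite_simps(3))
  also have "\<dots> = commuting_products G S"
    unfolding commuting_products_def
    by (intro Collect_cong iffI; elim exE conjE; rule_tac x = "rev ws" in exI) auto
  finally show ?thesis .
qed

lemma star_reducible_opposite:
  assumes "star_reducible G S m" shows "star_reducible (opposite G) S m"
proof -
  have "(\<lambda>y x. left_star_reducible_to (opposite G) S m y x \<or> right_star_reducible_to (opposite G) S m y x)
    = (\<lambda>y x. left_star_reducible_to G S m y x \<or> right_star_reducible_to G S m y x)"
    using left_star_opposite right_star_opposite by auto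
  thus ?thesis using assms by (simp add: star_reducible_def commuting_products_opposite)
qed

text \<open>An element that reduces within its string is not the first one of the string, so it
  starts with at least two alternating letters.\<close>

lemma left_star_reducible_ldesc:
  assumes "left_star_reducible_to G S m w x"
  shows "\<exists>s t. s \<otimes> t \<noteq> t \<otimes> s \<and> t \<in> ldesc w \<and> s \<in> ldesc (t \<otimes> w)"
proof -
  obtain s t u i j where st: "s \<in> S" "t \<in> S" "s \<otimes> t \<noteq> t \<otimes> s" and u: "u \<in> no_left_descent G S {s, t}"
    and i: "w = wprod (rev (alt_word s t i)) \<otimes> u" "1 \<le> i" "enat i < m s t"
    and j: "x = wprod (rev (alt_word s t j)) \<otimes> u" "1 \<le> j" "enat j < m s t"
    and l: "len w = len x + 1"
    using assms unfolding left_star_reducible_to_def left_string_def by blast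
  have ne: "s \<noteq> t" using st by auto
  have u': "left_reduced s t u" using u by (auto simp: no_left_descent_def ldesc_def)
  obtain a b where ab: "{a, b} = {s, t}" "rev (alt_word s t i) = alt_word a b i"
    using rev_alt_word[of s t i] by (cases "even i") (auto simp: insert_commute)
  obtain c d where cd: "{c, d} = {s, t}" "rev (alt_word s t j) = alt_word c d j"
    using rev_alt_word[of s t j] by (cases "even j") (auto simp: insert_commute)
  have "len w = i + len u"
    unfolding i(1) ab(2) by (rule len_altp_mult[OF st(1,2) ne u' ab(1)]) (use i in simp)
  moreover have "len x = j + len u"
    unfolding j(1) cd(2) by (rule len_altp_mult[OF st(1,2) ne u' cd(1)]) (use j in simp)
  \<comment> \<open>The target \<open>x\<close> has position \<open>j >= 1\<close> and
    \<open>w\<close> is longer by one, hence \<open>i = j + 1 >= 2\<close>.\<close>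
  ultimately obtain k where k: "i = Suc (Suc k)" using l j by (metis Suc_eq_plus1 Suc_le_D add_Suc add_right_cancel One_nat_def)
  have abS: "a \<in> S" "b \<in> S" "b \<otimes> a \<noteq> a \<otimes> b" "{b, a} = {s, t}"
    using ab st by (auto simp: doubleton_eq_iff)
  have w: "w = altp a b (Suc (Suc k)) \<otimes> u" using i ab k by simp
  have aw: "a \<otimes> w = altp b a (Suc k) \<otimes> u" using w abS u' by (simp add: m_assoc)
  have "a \<in> ldesc w" unfolding w
    by (rule ldesc_altp_mult[OF st(1,2) ne u' ab(1)]) (use i k in simp)
  moreover have "b \<in> ldesc (a \<otimes> w)" unfolding aw
    by (rule ldesc_altp_mult[OF st(1,2) ne u' abS(4)])
      (use i k in \<open>metis Suc_ile_eq enat_ord_simps(1) le_SucI less_imp_le order_trans order_refl\<close>)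
  ultimately show ?thesis using abS by blast
qed

text \<open>Read off from the first step of a reduction chain. In the induction it is applied afresh
  to each fully commutative element, so no chain has to be followed.\<close>

lemma star_reducible_cases:
  assumes "star_reducible G S m" "w \<in> FC"
  shows "w \<in> commuting_products G S
    \<or> (\<exists>s t. s \<otimes> t \<noteq> t \<otimes> s \<and> t \<in> ldesc w \<and> s \<in> ldesc (t \<otimes> w))
    \<or> (\<exists>s t. s \<otimes> t \<noteq> t \<otimes> s \<and> t \<in> coxeter_system.ldesc (opposite G) S w
        \<and> s \<in> coxeter_system.ldesc (opposite G) S (w \<otimes> t))"
proof -
  interpret op: coxeter_system "opposite G" S m by (rule coxeter_system_opposite)
  obtain z where z: "z \<in> commuting_products G S"
    "(\<lambda>y x. left_star_reducible_to G S m y x \<or> right_star_reducible_to G S m y x)\<^sup>*\<^sup>* w z"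
    using assms unfolding star_reducible_def by blast
  from z(2) show ?thesis
  proof (cases rule: converse_rtranclpE)
    case base thus ?thesis using z by simp
  next
    case (step y)
    from step(1) show ?thesis
    proof
      assume "left_star_reducible_to G S m w y"
      thus ?thesis using left_star_reducible_ldesc by blast
    next
      assume "right_star_reducible_to G S m w y"
      hence "left_star_reducible_to (opposite G) S m w y" by (simp add: right_star_opposite)
      then obtain s t where "t \<otimes> s \<noteq> s \<otimes> t" "t \<in> op.ldesc w" "s \<in> op.ldesc (w \<otimes> t)"
        using op.left_star_reducible_ldesc[of w y] by auto
      thus ?thesis by metis
    qed
  qed
qed

end

section \<open>Lattices in modules with a Hecke action\<close>

text \<open>Calculations modulo \<open>K\<close> replace calculations in the quotient.
  \<open>K\<close> admits all scalars, while \<open>Neg\<close> stands for the polynomials in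
  \<open>v^-1\<close>, so membership in \<open>lat\<close> is exactly the lattice condition modulo
  \<open>K\<close>.\<close>

locale lattice_module = Modules.module sc
  for sc :: "'a::comm_ring_1 \<Rightarrow> 'v::ab_group_add \<Rightarrow> 'v" +
  fixes Neg :: "'a set" and v vi :: 'a and t :: "'w \<Rightarrow> 'v" and K :: "'v set"
  assumes v_vi: "vi * v = 1"
    and Neg_vi: "vi \<in> Neg"
    and Neg_one: "1 \<in> Neg"
    and Neg_add: "a \<in> Neg \<Longrightarrow> b \<in> Neg \<Longrightarrow> a + b \<in> Neg"
    and Neg_mult: "a \<in> Neg \<Longrightarrow> b \<in> Neg \<Longrightarrow> a * b \<in> Neg"
    and Neg_uminus: "a \<in> Neg \<Longrightarrow> - a \<in> Neg"
    and K_zero: "0 \<in> K"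
    and K_add: "x \<in> K \<Longrightarrow> y \<in> K \<Longrightarrow> x + y \<in> K"
    and K_sc: "x \<in> K \<Longrightarrow> sc a x \<in> K"
begin

inductive_set lat :: "'w set \<Rightarrow> 'v set" for Z :: "'w set" where
  lat_K: "x \<in> K \<Longrightarrow> x \<in> lat Z"
| lat_gen: "z \<in> Z \<Longrightarrow> t z \<in> lat Z"
| lat_add: "x \<in> lat Z \<Longrightarrow> y \<in> lat Z \<Longrightarrow> x + y \<in> lat Z"
| lat_sc: "a \<in> Neg \<Longrightarrow> x \<in> lat Z \<Longrightarrow> sc a x \<in> lat Z"

lemma lat_zero: "0 \<in> lat Z"
  using lat_K K_zero by blast

lemma lat_uminus: "x \<in> lat Z \<Longrightarrow> - x \<in> lat Z"
  using lat_sc[OF Neg_uminus[OF Neg_one], of x Z] by simp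

lemma lat_diff: "x \<in> lat Z \<Longrightarrow> y \<in> lat Z \<Longrightarrow> x - y \<in> lat Z"
  using lat_add[of x Z "- y"] lat_uminus by simp

lemma lat_sum: "(\<And>i. i \<in> I \<Longrightarrow> f i \<in> lat Z) \<Longrightarrow> sum f I \<in> lat Z"
  by (induction I rule: infinite_finite_induct) (auto intro: lat_zero lat_add)

lemma lat_vi: "x \<in> lat Z \<Longrightarrow> sc vi x \<in> lat Z"
  by (rule lat_sc[OF Neg_vi])

lemma lat_of_v: "sc v x \<in> lat Z \<Longrightarrow> x \<in> lat Z"
  using lat_vi[of "sc v x" Z] by (simp add: v_vi)

lemma Neg_power: "vi ^ n \<in> Neg"
  by (induction n) (auto intro: Neg_one Neg_mult Neg_vi)

lemma lat_linear:
  assumes "x \<in> lat Z"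
    and "\<And>x y. f (x + y) = f x + f y" "\<And>a x. f (sc a x) = sc a (f x)"
    and "\<And>x. x \<in> K \<Longrightarrow> f x \<in> K" "\<And>z. z \<in> Z \<Longrightarrow> f (t z) \<in> lat Y"
  shows "f x \<in> lat Y"
  using assms(1) by induction (use assms(2-) in \<open>auto intro: lat.intros\<close>)

lemma lat_mono: "x \<in> lat Z \<Longrightarrow> Z \<subseteq> Y \<Longrightarrow> x \<in> lat Y"
  by (rule lat_linear[of x Z "\<lambda>x. x" Y]) (auto intro: lat.intros)

text \<open>The two parts are chosen, not determined, because the \<open>t z\<close> may be
  dependent modulo \<open>K\<close>.\<close>

lemma lat_split:
  assumes "x \<in> lat Z"
  shows "\<exists>a b. x = a + b \<and> a \<in> lat {z \<in> Z. \<not> P z} \<and> b \<in> lat {z \<in> Z. P z}"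
  using assms
proof induction
  case (lat_K x)
  thus ?case by (intro exI[of _ x] exI[of _ 0]) (auto intro: lat.lat_K lat_zero)
next
  case (lat_gen z)
  show ?case
  proof (cases "P z")
    case True
    thus ?thesis using lat_gen by (intro exI[of _ 0] exI[of _ "t z"]) (auto intro: lat.lat_gen lat_zero)
  next
    case False
    thus ?thesis using lat_gen by (intro exI[of _ "t z"] exI[of _ 0]) (auto intro: lat.lat_gen lat_zero)
  qed
next
  case (lat_add x y)
  then obtain a b a' b' where ab: "x = a + b" "y = a' + b'"
    "a \<in> lat {z \<in> Z. \<not> P z}" "a' \<in> lat {z \<in> Z. \<not> P z}" "b \<in> lat {z \<in> Z. P z}" "b' \<in> lat {z \<in> Z. P z}"
    by blast
  thus ?case by (intro exI[of _ "a + a'"] exI[of _ "b + b'"]) (auto intro: lat.lat_add)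
next
  case (lat_sc c x)
  then obtain a b where ab: "x = a + b" "a \<in> lat {z \<in> Z. \<not> P z}" "b \<in> lat {z \<in> Z. P z}" by blast
  thus ?case using lat_sc(1)
    by (intro exI[of _ "sc c a"] exI[of _ "sc c b"]) (auto intro: lat.lat_sc simp: scale_right_distrib)
qed

end

text \<open>\<open>lam s\<close> stands for left multiplication by \<open>t s\<close>; right
  multiplication is an instance over the opposite group. \<open>braid_sum\<close> is a generator of
  the ideal multiplied by \<open>t u\<close> and scaled so that the longest element has coefficient
  1.\<close>

locale hecke_lattice = coxeter_system G S m + lattice_module sc Neg v vi t K
  for G :: "('w, 'x) monoid_scheme" (structure) and S :: "'w set" and m :: "'w \<Rightarrow> 'w \<Rightarrow> enat"
    and sc :: "'a::comm_ring_1 \<Rightarrow> 'v::ab_group_add \<Rightarrow> 'v" and Neg :: "'a set" and v vi :: 'a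
    and t :: "'w \<Rightarrow> 'v" and K :: "'v set" +
  fixes lam :: "'w \<Rightarrow> 'v \<Rightarrow> 'v"
  assumes lam_add: "s \<in> S \<Longrightarrow> lam s (x + y) = lam s x + lam s y"
    and lam_sc: "s \<in> S \<Longrightarrow> lam s (sc c x) = sc c (lam s x)"
    and lam_K: "s \<in> S \<Longrightarrow> x \<in> K \<Longrightarrow> lam s x \<in> K"
    and lam_up: "\<lbrakk>s \<in> S; w \<in> carrier G; cox_length G S w < cox_length G S (s \<otimes> w)\<rbrakk>
      \<Longrightarrow> lam s (t w) = t (s \<otimes> w)"
    and lam_down: "\<lbrakk>s \<in> S; w \<in> carrier G; cox_length G S (s \<otimes> w) < cox_length G S w\<rbrakk>
      \<Longrightarrow> lam s (t w) = t (s \<otimes> w) + sc (v - vi) (t w)"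
    and braid_sum: "\<lbrakk>a \<in> S; b \<in> S; 3 \<le> n; m a b = enat n; u \<in> carrier G;
        \<And>y. y \<in> generate G {a, b} \<Longrightarrow> cox_length G S (y \<otimes> u) = cox_length G S y + cox_length G S u;
        w0 \<in> generate G {a, b}; cox_length G S w0 = n\<rbrakk>
      \<Longrightarrow> t (w0 \<otimes> u) + (\<Sum>y \<in> generate G {a, b} - {w0}. sc (vi ^ (n - cox_length G S y)) (t (y \<otimes> u))) \<in> K"
begin

abbreviation L :: "'w \<Rightarrow> 'v set" where
  "L x \<equiv> lat (bruhat x \<inter> FC)"

text \<open>
  Restricting the span to elements below \<open>x\<close> in the Bruhat order, instead of bounding their length,
  makes it stable under left descents of \<open>x\<close>.  The induction therefore does not need that the images
  of the fully commutative elements are linearly independent.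
\<close>

definition small :: "'w \<Rightarrow> bool" where
  "small x \<longleftrightarrow> sc v (t x) \<in> L x"

text \<open>The bound is on \<open>w\<close>, so the products it speaks of have length at most
  \<open>N\<close>.\<close>

definition small_below :: "nat \<Rightarrow> bool" where
  "small_below N \<longleftrightarrow> (\<forall>w \<in> FC. \<forall>s \<in> S. len w < N \<longrightarrow> s \<otimes> w \<notin> FC \<longrightarrow> small (s \<otimes> w))"

lemma small_belowD:
  "\<lbrakk>small_below N; w \<in> FC; s \<in> S; len w < N; s \<otimes> w \<notin> FC\<rbrakk> \<Longrightarrow> small (s \<otimes> w)"
  by (auto simp: small_below_def)

lemma L_mono: "\<lbrakk>x \<in> carrier G; y \<in> bruhat x; z \<in> L y\<rbrakk> \<Longrightarrow> z \<in> L x"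
  using bruhat_trans[of x y] by (auto intro: lat_mono)

lemma FC_or_small_L:
  assumes "x \<in> carrier G" "y \<in> bruhat x" "y \<in> FC \<or> small y" shows "t y \<in> L x"
proof (cases "y \<in> FC")
  case True thus ?thesis using assms by (intro lat_gen) auto
next
  case False
  hence "t y \<in> L y" using assms by (auto simp: small_def intro: lat_of_v)
  thus ?thesis using L_mono assms by blast
qed

section \<open>Effect of multiplication by a generator on the degree\<close>

lemma lam_mult:
  assumes "s \<in> S" "w \<in> carrier G"
  shows "s \<notin> ldesc w \<Longrightarrow> lam s (t w) = t (s \<otimes> w)"
    and "s \<in> ldesc w \<Longrightarrow> lam s (t w) = t (s \<otimes> w) + sc (v - vi) (t w)"
proof -
  show "lam s (t w) = t (s \<otimes> w)" if "s \<notin> ldesc w"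
    by (rule lam_up) (use assms len_not_ldesc[OF assms(2,1) that] in auto)
  show "lam s (t w) = t (s \<otimes> w) + sc (v - vi) (t w)" if "s \<in> ldesc w"
    by (rule lam_down) (use assms ldescD(2)[OF that] in auto)
qed

lemma lam_up_L:
  assumes "small_below N" "z \<in> FC" "len z < N" "q \<in> S" "q \<notin> ldesc z" "x \<in> carrier G"
    "q \<otimes> z \<in> bruhat x"
  shows "lam q (t z) \<in> L x"
proof -
  have "t (q \<otimes> z) \<in> L x"
    using assms small_belowD[of N z q] by (intro FC_or_small_L) auto
  thus ?thesis using lam_mult assms FC_closed by simp
qed

text \<open>The worst case is a descent \<open>q\<close> of \<open>z\<close>, where the factor
  \<open>v - v^-1\<close> is compensated by \<open>vi\<close>. Since \<open>x\<close> is not fully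
  commutative, every \<open>z\<close> in the interval differs from \<open>x\<close> and is shorter
  than \<open>N\<close>, so the induction hypothesis applies to \<open>q z\<close>.\<close>

lemma vi_lam_L:
  assumes N: "small_below N" and q: "q \<in> S" "x \<in> carrier G" "q \<notin> ldesc x" "x \<notin> FC" "len x \<le> N"
    and y: "y \<in> L x"
  shows "sc vi (lam q y) \<in> L (q \<otimes> x)"
proof (rule lat_linear[OF y, of "\<lambda>y. sc vi (lam q y)"])
  have qd: "q \<in> ldesc (q \<otimes> x)" "q \<otimes> x \<in> carrier G" using q ldesc_mult_iff by auto
  have sub: "bruhat x \<subseteq> bruhat (q \<otimes> x)" using bruhat_mult_subset[OF qd(2,1)] q by simp
  fix z assume z: "z \<in> bruhat x \<inter> FC"
  have zc: "z \<in> carrier G" using z FC_closed by blast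
  have "len z < len x" using bruhat_len[of x z] z q by auto
  hence lz: "len z < N" using q by simp
  have qz: "q \<otimes> z \<in> bruhat (q \<otimes> x)"
    using bruhat_mult_closed[OF qd(2,1)] z sub by blast
  show "sc vi (lam q (t z)) \<in> L (q \<otimes> x)"
  proof (cases "q \<in> ldesc z")
    case False
    thus ?thesis using lam_up_L[OF N _ lz q(1) False qd(2) qz] z by (intro lat_vi) blast
  next
    case True
    have 1: "t (q \<otimes> z) \<in> L (q \<otimes> x)" using FC_or_small_L[OF qd(2) qz] FC_ldesc z True by blast
    have 2: "t z \<in> L (q \<otimes> x)" using z sub by (intro lat_gen) blast
    have "sc vi (lam q (t z)) = sc vi (t (q \<otimes> z)) + sc (1 - vi * vi) (t z)"
      using lam_mult(2)[OF q(1) zc True] v_vi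
      by (simp add: scale_right_distrib right_diff_distrib)
    moreover have "1 - vi * vi \<in> Neg"
      using Neg_add[OF Neg_one Neg_uminus[OF Neg_mult[OF Neg_vi Neg_vi]]] by simp
    ultimately show ?thesis using 1 2 by (auto intro: lat_add lat_vi lat_sc)
  qed
qed (use q lam_K in \<open>auto simp: lam_add lam_sc scale_right_distrib mult.commute intro: K_sc\<close>)

text \<open>Smallness of \<open>x\<close> leaves no spare power of \<open>v\<close> for terms with
  descent \<open>q\<close>. These all lie in the part \<open>A\<close> without descent
  \<open>p\<close>, and the action of \<open>p\<close> shows \<open>A = v^-1 R - t (p x)\<close>
  with \<open>R\<close> in \<open>L x\<close>. The last hypothesis ensures that \<open>q\<close>
  does not raise the degree of the extra term \<open>t (p x)\<close>.\<close>

lemma small_lift: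
  assumes N: "small_below N"
    and x: "x \<in> carrier G" "x \<notin> FC" "len x \<le> N" "small x"
    and p: "p \<in> ldesc x" and q: "q \<in> S" "q \<notin> ldesc x" and pq: "p \<otimes> q \<noteq> q \<otimes> p"
    and px: "(p \<otimes> x \<in> FC \<and> q \<notin> ldesc (p \<otimes> x)) \<or> small (p \<otimes> x)"
  shows "small (q \<otimes> x)"
proof -
  let ?Z = "bruhat x \<inter> FC"
  have pS: "p \<in> S" using p ldescD by blast
  have qd: "q \<in> ldesc (q \<otimes> x)" "q \<otimes> x \<in> carrier G" using q x ldesc_mult_iff by auto
  have sub: "bruhat x \<subseteq> bruhat (q \<otimes> x)" using bruhat_mult_subset[OF qd(2,1)] q x by simp
  have qz: "q \<otimes> z \<in> bruhat (q \<otimes> x)" if "z \<in> bruhat x" for z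
    using bruhat_mult_closed[OF qd(2,1)] that sub by blast
  have lz: "len z < N" if "z \<in> ?Z" for z using bruhat_len[of x z] that x by auto
  have pxx: "p \<otimes> x \<in> bruhat x" using bruhat_mult_closed[OF x(1) p bruhat_refl[OF x(1)]] .
  obtain A B where AB: "sc v (t x) = A + B"
    and A: "A \<in> lat {z \<in> ?Z. p \<notin> ldesc z}" and B: "B \<in> lat {z \<in> ?Z. p \<in> ldesc z}"
    using lat_split[of "sc v (t x)" ?Z "\<lambda>z. p \<in> ldesc z"] x by (auto simp: small_def)
  have pA: "lam p A \<in> L x"
  proof (rule lat_linear[OF A])
    fix z assume z: "z \<in> {z \<in> ?Z. p \<notin> ldesc z}"
    thus "lam p (t z) \<in> L x"
      using lam_up_L[OF N _ lz pS _ x(1)] bruhat_mult_closed[OF x(1) p] by blast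
  qed (use pS in \<open>auto simp: lam_add lam_sc lam_K\<close>)
  \<comment> \<open>On terms with descent \<open>p\<close> the operator is \<open>v - v^-1\<close>
    up to the lattice, the same factor as in its action on \<open>t x\<close>.\<close>
  have pB: "lam p B - sc (v - vi) B \<in> L x"
  proof (rule lat_linear[OF B, of "\<lambda>y. lam p y - sc (v - vi) y"])
    fix z assume z: "z \<in> {z \<in> ?Z. p \<in> ldesc z}"
    hence "lam p (t z) - sc (v - vi) (t z) = t (p \<otimes> z)" using lam_mult(2)[OF pS] FC_closed by simp
    moreover have "p \<otimes> z \<in> ?Z" using z bruhat_mult_closed[OF x(1) p] FC_ldesc by blast
    ultimately show "lam p (t z) - sc (v - vi) (t z) \<in> L x" by (simp add: lat_gen)
  next
    fix y assume "y \<in> K"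
    hence "lam p y + sc (vi - v) y \<in> K" using pS by (intro K_add K_sc lam_K)
    thus "lam p y - sc (v - vi) y \<in> K" by (simp add: scale_left_diff_distrib algebra_simps)
  qed (use pS in \<open>auto simp: lam_add lam_sc scale_right_distrib scale_right_diff_distrib mult.commute\<close>)
  have xpx: "lam p (t x) = t (p \<otimes> x) + sc (v - vi) (t x)" using lam_mult(2)[OF pS x(1) p] .
  have "lam p A + lam p B = sc v (t (p \<otimes> x)) + sc (v - vi) (A + B)"
  proof -
    have "lam p A + lam p B = sc v (lam p (t x))"
      using AB lam_add[OF pS] lam_sc[OF pS] by metis
    also have "\<dots> = sc v (t (p \<otimes> x)) + sc (v - vi) (sc v (t x))"
      unfolding xpx by (simp add: scale_right_distrib mult.commute)
    finally show ?thesis using AB by simp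
  qed
  \<comment> \<open>The multiples of \<open>B\<close> cancel, whereas \<open>A\<close> lacks its
    factor \<open>v - v^-1\<close> on the left, so the equation can be solved for
    \<open>v A\<close>.\<close>
  hence "sc v A = sc vi A + lam p A + (lam p B - sc (v - vi) B) - sc v (t (p \<otimes> x))"
    by (simp add: scale_right_distrib scale_left_diff_distrib algebra_simps)
  moreover define R where "R = sc vi A + lam p A + (lam p B - sc (v - vi) B)"
  ultimately have "sc v A = R - sc v (t (p \<otimes> x))" by simp
  hence "sc vi (sc v A) = sc vi R - sc vi (sc v (t (p \<otimes> x)))" by (simp add: scale_right_diff_distrib)
  hence A': "A = sc vi R - t (p \<otimes> x)" by (simp add: v_vi)
  have "A \<in> L x" using A by (rule lat_mono) blast
  hence R: "R \<in> L x" unfolding R_def using pA pB by (intro lat_add lat_vi)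
  have qR: "sc vi (lam q R) \<in> L (q \<otimes> x)" by (rule vi_lam_L[OF N q(1) x(1) q(2) x(2,3) R])
  have qpx: "lam q (t (p \<otimes> x)) \<in> L (q \<otimes> x)"
    using px
  proof
    assume "p \<otimes> x \<in> FC \<and> q \<notin> ldesc (p \<otimes> x)"
    thus ?thesis using lam_up_L[OF N _ _ q(1) _ qd(2) qz[OF pxx]] lz pxx by blast
  next
    assume "small (p \<otimes> x)"
    hence "sc v (t (p \<otimes> x)) \<in> L x" using L_mono[OF x(1) pxx] by (simp add: small_def)
    hence "sc vi (lam q (sc v (t (p \<otimes> x)))) \<in> L (q \<otimes> x)" by (rule vi_lam_L[OF N q(1) x(1) q(2) x(2,3)])
    thus ?thesis using q by (simp add: lam_sc v_vi)
  qed
  have qB: "lam q B \<in> L (q \<otimes> x)"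
  proof (rule lat_linear[OF B])
    fix z assume z: "z \<in> {z \<in> ?Z. p \<in> ldesc z}"
    hence "q \<notin> ldesc z" using FC_ldesc_commute pq by blast
    thus "lam q (t z) \<in> L (q \<otimes> x)" using lam_up_L[OF N _ lz q(1) _ qd(2) qz] z by blast
  qed (use q in \<open>auto simp: lam_add lam_sc lam_K\<close>)
  have qA: "lam q A = sc vi (lam q R) - lam q (t (p \<otimes> x))"
  proof -
    have "A + t (p \<otimes> x) = sc vi R" using A' by simp
    hence "lam q A + lam q (t (p \<otimes> x)) = sc vi (lam q R)" using lam_add lam_sc q by metis
    thus ?thesis by (simp add: eq_diff_eq)
  qed
  have "sc v (t (q \<otimes> x)) = lam q A + lam q B"
    using lam_mult(1)[OF q(1) x(1) q(2)] AB lam_add lam_sc q by metis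
  thus ?thesis unfolding small_def using qA qB qR qpx by (simp add: lat_add lat_diff)
qed

text \<open>Supplies the shorter elements of a coset, which all occur in the braid relation. They
  are built letter by letter: while the element is fully commutative the next product falls under
  \<open>small_below\<close>; afterwards the preceding letter \<open>b\<close> and the new letter
  \<open>a\<close> are the \<open>p\<close> and \<open>q\<close> of the lifting argument.\<close>

lemma small_dihedral:
  assumes N: "small_below N"
    and ab: "a \<in> S" "b \<in> S" "a \<otimes> b \<noteq> b \<otimes> a" "left_reduced a b u" "u \<in> FC"
    and k: "enat (Suc k) \<le> m a b" "k + len u \<le> N"
  shows "altp a b k \<otimes> u \<in> FC \<or> small (altp a b k \<otimes> u)"
  using ab k
proof (induction k arbitrary: a b rule: less_induct)
  case (less k)
  have ne: "a \<noteq> b" using less.prems by auto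
  have km: "enat i \<le> m a b" if "i \<le> Suc k" for i
    using less.prems(6) that by (meson enat_ord_simps(1) order_trans)
  have sw: "{b, a} = {a, b}" by blast
  have mba: "m b a = m a b" using matrix_sym less.prems by simp
  show ?case
  proof (cases k)
    case 0 thus ?thesis using less.prems by simp
  next
    case (Suc i)
    define x where "x = altp b a i \<otimes> u"
    have xc: "x \<in> carrier G" using less.prems by (auto simp: x_def)
    have ax: "altp a b k \<otimes> u = a \<otimes> x" using Suc less.prems by (simp add: x_def m_assoc)
    have lx: "len x = i + len u" unfolding x_def
      by (rule len_altp_mult[OF less.prems(1,2) ne less.prems(4) sw]) (use km Suc in simp)
    have lax: "len (a \<otimes> x) = k + len u" unfolding ax[symmetric]
      by (rule len_altp_mult[OF less.prems(1,2) ne less.prems(4)]) (use km in auto)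
    have anx: "a \<notin> ldesc x" using lx lax Suc by (simp add: ldesc_def)
    show ?thesis
    proof (cases "x \<in> FC")
      case True
      have "len x < N" using lx less.prems(7) Suc by simp
      thus ?thesis using small_belowD[OF N True] less.prems ax by auto
    next
      case False
      have "x \<in> FC \<or> small x" unfolding x_def
        by (rule less.IH) (use less.prems Suc km mba in auto)
      hence sx: "small x" using False by blast
      obtain j where j: "i = Suc j" using False less.prems(4,5) by (cases i) (auto simp: x_def)
      have b: "b \<in> ldesc x" unfolding x_def j
        by (rule ldesc_altp_mult[OF less.prems(1,2) ne less.prems(4) sw]) (use km Suc j in simp)
      have bx: "b \<otimes> x = altp a b j \<otimes> u" using j less.prems by (simp add: x_def m_assoc)
      have "b \<otimes> x \<in> FC \<or> small (b \<otimes> x)" unfolding bx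
        by (rule less.IH) (use less.prems Suc j km in auto)
      \<comment> \<open>Otherwise \<open>a\<close> would be a descent of \<open>x\<close>, because
        multiplying the fully commutative \<open>b x\<close> by \<open>b\<close> leaves the fully
        commutative elements.\<close>
      moreover have "a \<notin> ldesc (b \<otimes> x)" if "b \<otimes> x \<in> FC"
        using ldesc_not_FC_mult[OF that, of b a] False anx less.prems xc by auto
      ultimately have "(b \<otimes> x \<in> FC \<and> a \<notin> ldesc (b \<otimes> x)) \<or> small (b \<otimes> x)" by blast
      moreover have "len x \<le> N" using lx less.prems(7) Suc by simp
      ultimately have "small (a \<otimes> x)"
        using small_lift[OF N xc False _ sx b _ anx] less.prems by metis
      thus ?thesis using ax by simp
    qed
  qed
qed

text \<open>Here the defining relation of the quotient expresses \<open>t x\<close> through shorter elements.\<close>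

lemma small_braid:
  assumes N: "small_below N" and x: "x \<in> carrier G" "len x \<le> Suc N"
    and ab: "a \<in> ldesc x" "b \<in> ldesc x" "a \<otimes> b \<noteq> b \<otimes> a" "a \<otimes> x \<in> FC"
  shows "small x"
    and "b \<otimes> x \<in> FC \<or> small (b \<otimes> x)"
proof -
  have S: "a \<in> S" "b \<in> S" "a \<noteq> b" using ab ldescD by auto
  obtain n u where d: "m a b = enat n" "left_reduced a b u" "x = altp a b n \<otimes> u"
    using two_ldesc[OF x(1) ab(1,2) S(3)] by blast
  have n: "3 \<le> n" using matrix_ge_3[OF S(1,2) ab(3) d(1)] .
  then obtain k where k: "n = Suc k" by (cases n) auto
  have sw: "{b, a} = {a, b}" "{a, b} = {a, b}" by blast+
  obtain us where us: "reduced us" "wprod us = u" using reduced_exists d by blast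
  have l: "alt_word b a k \<in> lists S" "us \<in> lists S"
    using us reduced_lists alt_word_in_lists S by blast+
  have "a \<otimes> x = altp b a k \<otimes> u" using d k S by (simp add: m_assoc)
  hence "wprod (alt_word b a k @ us) \<in> FC" using ab(4) us wprod_append[OF l] by simp
  moreover have "reduced (alt_word b a k @ us)"
    by (rule altp_mult_reduced[OF S _ sw(1)]) (use d us k in auto)
  ultimately have uFC: "u \<in> FC" using FC_suffix us by blast
  have lx: "len x = n + len u" unfolding d(3)
    by (rule len_altp_mult[OF S d(2) sw(2)]) (use d in simp)
  have one: "left_reduced a b \<one>" using S by (auto simp: ldesc_def)
  have ly: "len (altp c d i) = i" "len (altp c d i \<otimes> u) = i + len u"
    if "{c, d} = {a, b}" "i \<le> n" for c d i
  proof -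
    have "c \<in> S" "d \<in> S" using that S by (auto simp: doubleton_eq_iff)
    thus "len (altp c d i) = i"
      using len_altp_mult[OF S one that(1), of i] that d by simp
    show "len (altp c d i \<otimes> u) = i + len u"
      by (rule len_altp_mult[OF S d(2)]) (use that d in auto)
  qed
  have dih: "\<exists>c e i. {c, e} = {a, b} \<and> i \<le> n \<and> y = altp c e i" if "y \<in> generate G {a, b}" for y
    using that d(1) by (auto simp: generate_dihedral[OF S(1,2)] dihedral_def)
  have short: "altp c e i \<otimes> u \<in> FC \<or> small (altp c e i \<otimes> u)"
    if "{c, e} = {a, b}" "i < n" for c e i
  proof (rule small_dihedral[OF N])
    show "c \<in> S" "e \<in> S" "c \<otimes> e \<noteq> e \<otimes> c" "left_reduced c e u"
      using that S ab d by (auto simp: doubleton_eq_iff)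
    show "enat (Suc i) \<le> m c e" using that d(1) matrix_sym[OF S(1,2)] by (auto simp: doubleton_eq_iff)
  qed (use uFC that lx x in auto)
  let ?w = "altp a b n"
  have wg: "?w \<in> generate G {a, b}"
    using d(1) unfolding generate_dihedral[OF S(1,2)] dihedral_def by auto
  have "t (?w \<otimes> u) + (\<Sum>y \<in> generate G {a, b} - {?w}. sc (vi ^ (n - len y)) (t (y \<otimes> u))) \<in> K"
  proof (rule braid_sum[OF S(1,2) n d(1) _ _ wg])
    fix y assume "y \<in> generate G {a, b}"
    thus "len (y \<otimes> u) = len y + len u" using dih ly by metis
  qed (use ly d in auto)
  hence "sc v (t x) + (\<Sum>y \<in> generate G {a, b} - {?w}. sc v (sc (vi ^ (n - len y)) (t (y \<otimes> u)))) \<in> L x"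
    using K_sc[of _ v] by (simp only: d(3) scale_sum_right[symmetric] scale_right_distrib[symmetric] lat_K)
  moreover have "(\<Sum>y \<in> generate G {a, b} - {?w}. sc v (sc (vi ^ (n - len y)) (t (y \<otimes> u)))) \<in> L x"
  proof (rule lat_sum)
    fix y assume y: "y \<in> generate G {a, b} - {?w}"
    then obtain c e i where i: "{c, e} = {a, b}" "i \<le> n" "y = altp c e i" using dih by blast
    have "i \<noteq> n"
      using y i braid_relation[OF S(1,2) d(1)] by (auto simp: doubleton_eq_iff)
    hence i': "i < n" using i by simp
    have "y \<otimes> u \<in> bruhat x" unfolding d(3)
      by (rule altp_bruhat[OF S d(1,2)]) (use y generate_dihedral[OF S(1,2)] in blast)
    hence "t (y \<otimes> u) \<in> L x" using FC_or_small_L[OF x(1)] short[OF i(1) i'] i(3) by simp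
    \<comment> \<open>Every element other than the longest has length below \<open>n\<close>, so its
      coefficient contains at least one factor \<open>vi\<close>, which absorbs the \<open>v\<close>
      required by \<open>small\<close>.\<close>
    moreover obtain j where j: "n - len y = Suc j" using ly(1)[OF i(1,2)] i(3) i' by (cases "n - len y") auto
    have "sc v (sc (vi ^ (n - len y)) (t (y \<otimes> u))) = sc (vi ^ j) (t (y \<otimes> u))"
      unfolding j using v_vi by (simp add: mult.assoc[symmetric] mult.commute[of v])
    ultimately show "sc v (sc (vi ^ (n - len y)) (t (y \<otimes> u))) \<in> L x"
      using lat_sc[OF Neg_power] by simp
  qed
  ultimately show "small x" unfolding small_def using lat_diff by fastforce
  have "x = altp b a n \<otimes> u" using d braid_relation[OF S(1,2) d(1)] by simp
  hence "b \<otimes> x = altp a b k \<otimes> u" using k S d by (simp add: m_assoc)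
  thus "b \<otimes> x \<in> FC \<or> small (b \<otimes> x)" using short[OF sw(2), of k] k by simp
qed

end

section \<open>The induction on the length\<close>

locale hecke_bilattice =
  left: hecke_lattice G S m sc Neg v vi t K lam + right: hecke_lattice "opposite G" S m sc Neg v vi t K rho
  for G :: "('w, 'x) monoid_scheme" (structure) and S :: "'w set" and m :: "'w \<Rightarrow> 'w \<Rightarrow> enat"
    and sc :: "'a::comm_ring_1 \<Rightarrow> 'v::ab_group_add \<Rightarrow> 'v" and Neg :: "'a set" and v vi :: 'a
    and t :: "'w \<Rightarrow> 'v" and K :: "'v set" and lam rho :: "'w \<Rightarrow> 'v \<Rightarrow> 'v" +
  assumes star: "star_reducible G S m"
begin

lemma small_right: "right.small x \<longleftrightarrow> left.small x"
  by (simp add: left.small_def right.small_def)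

text \<open>The two sides interlock: after a right star reduction the shorter factor is small by the
  left hypothesis, and the removed letter is put back by the right-handed estimates.\<close>

lemma small_step:
  assumes NL: "left.small_below N" and NR: "right.small_below N"
  shows "left.small_below (Suc N)"
  unfolding left.small_below_def
proof (intro ballI impI)
  fix w s assume w: "w \<in> left.FC" and s: "s \<in> S" and lw: "left.len w < Suc N"
    and nFC: "s \<otimes> w \<notin> left.FC"
  have wc: "w \<in> carrier G" using w left.FC_closed by blast
  have sw: "s \<notin> left.ldesc w" "left.len (s \<otimes> w) = Suc (left.len w)" "s \<in> left.ldesc (s \<otimes> w)"
    using left.not_FC_ldesc[OF w s nFC] left.len_not_ldesc[OF wc s] left.ldesc_mult_iff[OF wc s] by auto
  have swc: "s \<otimes> w \<in> carrier G" using wc s by simp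
  show "left.small (s \<otimes> w)"
  proof -
    consider "w \<in> commuting_products G S"
      | (L) p q where "p \<otimes> q \<noteq> q \<otimes> p" "q \<in> left.ldesc w" "p \<in> left.ldesc (q \<otimes> w)"
      | (R) p q where "p \<otimes> q \<noteq> q \<otimes> p" "q \<in> right.ldesc w" "p \<in> right.ldesc (w \<otimes> q)"
      using left.star_reducible_cases[OF star w] by blast
    thus ?thesis
    proof cases
      case 1
      then obtain ws where "w = left.wprod ws" "ws \<in> lists S" "distinct ws"
        "\<And>s t. s \<in> set ws \<Longrightarrow> t \<in> set ws \<Longrightarrow> s \<otimes> t = t \<otimes> s"
        unfolding commuting_products_def by blast
      \<comment> \<open>This case is void, as such products stay fully commutative when multiplied
        by \<open>s\<close>.\<close>
      thus ?thesis using left.commuting_products_mult_FC[of ws s] w s nFC by blast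
    next
      case (L p q)
      have S: "p \<in> S" "q \<in> S" using L left.ldescD by auto
      show ?thesis
      proof (cases "s \<otimes> q = q \<otimes> s")
        case False
        have "q \<in> left.ldesc (s \<otimes> w)" by (rule left.ldesc_not_FC_mult[OF w s nFC L(2) False])
        thus ?thesis
          by (intro left.small_braid(1)[OF NL swc _ sw(3) _ False]) (use lw sw wc w s in auto)
      next
        case True
        have sq: "q \<noteq> s" using L(2) sw by blast
        define w' where "w' = q \<otimes> w"
        \<comment> \<open>As \<open>q\<close> commutes with \<open>s\<close>, it can be pulled out
          of \<open>s w = q x\<close>, and \<open>x\<close> still fails to be fully commutative; so
          \<open>x\<close> is small by induction and \<open>q\<close> is the letter to lift
          by.\<close>
        define x where "x = s \<otimes> w'"
        have w': "w' \<in> left.FC" unfolding w'_def by (rule left.FC_ldesc[OF w L(2)])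
        have w'c: "w' \<in> carrier G" using w' left.FC_closed by blast
        have xc: "x \<in> carrier G" using w'c s by (simp add: x_def)
        have lw': "left.len w = Suc (left.len w')" unfolding w'_def by (rule left.len_ldesc[OF wc L(2)])
        have xF: "x \<notin> left.FC" unfolding x_def w'_def
          by (rule left.not_FC_mult_ldesc[OF w s nFC L(2) True])
        have sw': "s \<notin> left.ldesc w'" using left.not_FC_ldesc[OF w' s] xF by (simp add: x_def)
        have lx: "left.len x = Suc (left.len w')" unfolding x_def using left.len_not_ldesc[OF w'c s sw'] .
        have qx: "q \<otimes> x = s \<otimes> w"
        proof -
          have "q \<otimes> x = (q \<otimes> s) \<otimes> (q \<otimes> w)" using S s wc by (simp add: x_def w'_def left.m_assoc)
          also have "\<dots> = s \<otimes> w" using True S s wc by (simp add: left.m_assoc flip: True)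
          finally show ?thesis .
        qed
        have qnx: "q \<notin> left.ldesc x" using qx sw lx lw' by (simp add: left.ldesc_def)
        have sx: "left.small x" unfolding x_def
          by (rule left.small_belowD[OF NL w' s]) (use lw lw' xF x_def in auto)
        have ps: "p \<noteq> s" using L(1) True by auto
        have pw': "p \<in> left.ldesc w'" using L(3) by (simp add: w'_def)
        have sdx: "s \<in> left.ldesc x" using left.ldesc_mult_iff[OF w'c s] sw' by (simp add: x_def)
        have px: "p \<in> left.ldesc x"
        proof (cases "s \<otimes> p = p \<otimes> s")
          case True
          thus ?thesis using left.ldesc_commute[OF w'c s S(1) True ps sw'] pw' by (simp add: x_def)
        next
          case False
          thus ?thesis using left.ldesc_not_FC_mult[OF w' s _ pw' False] xF by (simp add: x_def)
        qed
        have pxc: "p \<otimes> x \<in> carrier G" using xc S by simp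
        \<comment> \<open>If \<open>p\<close> commutes with \<open>s\<close>, then
          \<open>p x\<close> is \<open>s\<close> times the shorter fully commutative element
          \<open>p w'\<close>. If not, \<open>s\<close> and \<open>p\<close> are noncommuting
          descents of \<open>x\<close>, and \<open>p x\<close> lies in the coset treated by the
          braid relation.\<close>
        have "p \<otimes> x \<in> left.FC \<or> left.small (p \<otimes> x)"
        proof (cases "s \<otimes> p = p \<otimes> s")
          case True
          have e: "p \<otimes> x = s \<otimes> (p \<otimes> w')"
            using True S s w'c by (simp add: x_def flip: left.m_assoc)
          have "p \<otimes> w' \<in> left.FC" by (rule left.FC_ldesc[OF w' pw'])
          moreover have "left.len (p \<otimes> w') < N" using left.len_ldesc[OF w'c pw'] lw' lw by simp
          ultimately show ?thesis unfolding e using left.small_belowD[OF NL] s by blast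
        next
          case False
          show ?thesis
            by (rule left.small_braid(2)[OF NL xc _ sdx px False])
              (use lx lw' lw w' w'c s in \<open>auto simp: x_def\<close>)
        qed
        \<comment> \<open>Multiplying \<open>p x\<close> by \<open>p\<close> leaves the fully
          commutative elements, so a descent \<open>q\<close> there would persist in
          \<open>x\<close>.\<close>
        moreover have "q \<notin> left.ldesc (p \<otimes> x)" if "p \<otimes> x \<in> left.FC"
          using left.ldesc_not_FC_mult[OF that S(1) _ _ L(1)] xF qnx xc S by auto
        ultimately have "left.small (q \<otimes> x)"
          using left.small_lift[OF NL xc xF _ sx px S(2) qnx L(1)] lx lw' lw by linarith
        thus ?thesis using qx by simp
      qed
    next
      case (R p q)
      have S: "p \<in> S" "q \<in> S" using R right.ldescD by auto
      have pq: "p \<otimes>\<^bsub>opposite G\<^esub> q \<noteq> q \<otimes>\<^bsub>opposite G\<^esub> p" using R(1) by simp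
      have qp: "q \<otimes>\<^bsub>opposite G\<^esub> p \<noteq> p \<otimes>\<^bsub>opposite G\<^esub> q" using R(1) by simp
      define w' where "w' = w \<otimes> q"
      define x where "x = s \<otimes> w'"
      have w': "w' \<in> left.FC" using right.FC_ldesc[of w q] w R(2) by (simp add: w'_def)
      have w'c: "w' \<in> carrier G" using w' left.FC_closed by blast
      have xc: "x \<in> carrier G" using w'c s by (simp add: x_def)
      have lw': "left.len w = Suc (left.len w')" using right.len_ldesc[of w q] wc R(2) by (simp add: w'_def)
      have xq: "x \<otimes> q = s \<otimes> w" using S s wc by (simp add: x_def w'_def left.m_assoc)
      have "left.len (s \<otimes> w) \<le> Suc (left.len x)"
        using left.len_mult_le[OF xc, of q] S xq by simp
      hence lx: "left.len x = Suc (left.len w')" "s \<notin> left.ldesc w'"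
        using left.len_mult_gen[OF s w'c] sw lw' by (auto simp: x_def left.ldesc_def)
      have qnx: "q \<notin> right.ldesc x" using xq sw lx lw' by (simp add: right.ldesc_def)
      have pw': "p \<in> right.ldesc w'" using R(3) by (simp add: w'_def)
      have wpc: "w' \<otimes> p \<in> carrier G" using w'c S by simp
      have e: "x \<otimes> p = s \<otimes> (w' \<otimes> p)" using S s w'c by (simp add: x_def left.m_assoc)
      have lwp: "left.len w' = Suc (left.len (w' \<otimes> p))" using right.len_ldesc[of w' p] w'c pw' by simp
      have px: "p \<in> right.ldesc x"
      proof -
        have "left.len (x \<otimes> p) \<le> Suc (left.len (w' \<otimes> p))"
          unfolding e using left.len_mult_le[OF _ wpc, of s] s by simp
        thus ?thesis using lwp lx S by (simp add: right.ldesc_def)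
      qed
      show ?thesis
      proof (cases "x \<in> left.FC")
        case True
        \<comment> \<open>Appending \<open>q\<close> to the fully commutative \<open>x\<close>
          destroys full commutativity, so \<open>p\<close> persists next to \<open>q\<close> as a
          right descent and the braid relation applies on the right.\<close>
        have "p \<in> right.ldesc (q \<otimes>\<^bsub>opposite G\<^esub> x)"
          by (rule right.ldesc_not_FC_mult[OF _ S(2) _ px qp]) (use True nFC xq in auto)
        hence "p \<in> right.ldesc (s \<otimes> w)" using xq by simp
        moreover have "q \<in> right.ldesc (s \<otimes> w)"
          using right.ldesc_mult_iff[of x q] xc S qnx xq by simp
        moreover have "q \<otimes>\<^bsub>opposite G\<^esub> (s \<otimes> w) \<in> right.FC"
          using True xq xc S by (simp flip: xq)
        ultimately have "right.small (s \<otimes> w)"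
          using right.small_braid(1)[OF NR, of "s \<otimes> w" q p] swc sw lw qp by simp
        thus ?thesis by (simp add: small_right)
      next
        case False
        \<comment> \<open>Smallness does not depend on the side: the left hypothesis for
          \<open>s w'\<close> serves as input for the right-handed lift by \<open>q\<close>.\<close>
        have sx: "right.small x" unfolding small_right x_def
          by (rule left.small_belowD[OF NL w' s]) (use lw lw' False x_def in auto)
        have wpF: "w' \<otimes> p \<in> left.FC" using right.FC_ldesc[of w' p] w' pw' by simp
        have "x \<otimes> p \<in> left.FC \<or> left.small (x \<otimes> p)"
          unfolding e using left.small_belowD[OF NL wpF s] lwp lw' lw by linarith
        moreover have "q \<notin> right.ldesc (x \<otimes> p)" if "x \<otimes> p \<in> left.FC"
        proof
          assume "q \<in> right.ldesc (x \<otimes> p)"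
          moreover have "p \<otimes>\<^bsub>opposite G\<^esub> (x \<otimes> p) = x" using xc S by simp
          ultimately have "q \<in> right.ldesc x"
            using right.ldesc_not_FC_mult[of "x \<otimes> p" p q] that False S pq by simp
          thus False using qnx by blast
        qed
        ultimately have "(p \<otimes>\<^bsub>opposite G\<^esub> x \<in> right.FC \<and> q \<notin> right.ldesc (p \<otimes>\<^bsub>opposite G\<^esub> x))
            \<or> right.small (p \<otimes>\<^bsub>opposite G\<^esub> x)"
          by (auto simp: small_right)
        hence "right.small (q \<otimes>\<^bsub>opposite G\<^esub> x)"
          using right.small_lift[OF NR _ _ _ sx px S(2) qnx pq] xc False lx lw' lw by simp
        thus ?thesis using xq by (simp add: small_right)
      qed
    qed
  qed
qed

lemma swap: "hecke_bilattice (opposite G) S m sc Neg v vi t K rho lam"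
  using left.star_reducible_opposite[OF star] right.hecke_lattice_axioms left.hecke_lattice_axioms
  by (intro hecke_bilattice.intro hecke_bilattice_axioms.intro) simp_all

lemma small_all: "left.small_below N \<and> right.small_below N"
proof (induction N)
  case 0 thus ?case by (simp add: left.small_below_def right.small_below_def)
next
  case (Suc N)
  thus ?case using small_step hecke_bilattice.small_step[OF swap, of N] by simp
qed

theorem not_FC_mult_small:
  assumes "w \<in> fully_commutative G S" "s \<in> S" "s \<otimes> w \<notin> fully_commutative G S"
  shows "sc v (t (s \<otimes> w)) \<in> left.lat (fully_commutative G S)"
proof -
  have "left.small (s \<otimes> w)"
    using left.small_belowD[of "Suc (left.len w)" w s] small_all assms by simp
  thus ?thesis unfolding left.small_def by (rule left.lat_mono) blast
qed

end

section \<open>Evaluation of formal combinations\<close>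

lemma laurent_ring_simps [simp]:
  "carrier laurent_ring = UNIV" "a \<oplus>\<^bsub>laurent_ring\<^esub> b = a + b" "a \<otimes>\<^bsub>laurent_ring\<^esub> b = a * b"
  "\<one>\<^bsub>laurent_ring\<^esub> = 1" "\<zero>\<^bsub>laurent_ring\<^esub> = 0"
  by (simp_all add: laurent_ring_def ring_of_type_algebra_def)

lemma vpow_add: "vpow (a + b) = vpow a * vpow b"
  by (simp add: vpow_def mult_single)

lemma vpow_0 [simp]: "vpow 0 = 1"
  by (simp add: vpow_def)

lemma vpow_power: "vpow a ^ n = vpow (int n * a)"
  by (induction n) (simp_all add: algebra_simps vpow_add)

definition laurent_neg :: "laurent set" where
  "laurent_neg = carrier laurent_neg_ring"

lemma laurent_neg_iff: "a \<in> laurent_neg \<longleftrightarrow> (\<forall>k \<in> Poly_Mapping.keys a. k \<le> 0)"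
  by (simp add: laurent_neg_def laurent_neg_ring_def)

lemma laurent_neg_add: "a \<in> laurent_neg \<Longrightarrow> b \<in> laurent_neg \<Longrightarrow> a + b \<in> laurent_neg"
  using Poly_Mapping.keys_add[of a b] by (auto simp: laurent_neg_iff)

lemma laurent_neg_mult: "a \<in> laurent_neg \<Longrightarrow> b \<in> laurent_neg \<Longrightarrow> a * b \<in> laurent_neg"
  using keys_mult[of a b] by (force simp: laurent_neg_iff)

lemma laurent_neg_uminus: "a \<in> laurent_neg \<Longrightarrow> - a \<in> laurent_neg"
  by (simp add: laurent_neg_iff)

lemma laurent_neg_vpow: "k \<le> 0 \<Longrightarrow> vpow k \<in> laurent_neg"
  by (simp add: laurent_neg_iff vpow_def)

text \<open>
  Finitely supported functions stand for formal combinations of the basis elements; the quotient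
  algebra is reached by working modulo the combinations that evaluate into the ideal.
\<close>

definition fscale :: "laurent \<Rightarrow> ('w \<Rightarrow> laurent) \<Rightarrow> 'w \<Rightarrow> laurent" where
  "fscale a f = (\<lambda>w. a * f w)"

definition fsingle :: "'w \<Rightarrow> 'w \<Rightarrow> laurent" where
  "fsingle w = (\<lambda>x. if x = w then 1 else 0)"

interpretation fscale: Modules.module fscale
  by unfold_locales (auto simp: fscale_def fun_eq_iff algebra_simps)

section \<open>Finite dihedral subgroups\<close>

lemma (in coxeter_system) finite_generate:
  assumes "a \<in> S" "b \<in> S" "m a b = enat n" shows "finite (generate G {a, b})"
proof -
  have "dihedral a b \<subseteq> (\<lambda>(c, d, k). altp c d k) ` ({a, b} \<times> {a, b} \<times> {..n})"
  proof
    fix y assume "y \<in> dihedral a b"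
    then obtain c d k where "y = altp c d k" "{c, d} = {a, b}" "k \<le> n"
      using assms(3) by (auto simp: dihedral_def)
    moreover have "c \<in> {a, b}" "d \<in> {a, b}" using calculation(2) by blast+
    ultimately show "y \<in> (\<lambda>(c, d, k). altp c d k) ` ({a, b} \<times> {a, b} \<times> {..n})"
      by (intro image_eqI[of _ _ "(c, d, k)"]) auto
  qed
  thus ?thesis
    unfolding generate_dihedral[OF assms(1,2)] by (rule finite_subset) auto
qed

lemma (in coxeter_system) generate_opposite:
  assumes "a \<in> S" "b \<in> S" shows "generate (opposite G) {a, b} = generate G {a, b}"
proof -
  interpret op: coxeter_system "opposite G" S m by (rule coxeter_system_opposite)
  have "op.dihedral a b \<subseteq> dihedral a b"
  proof
    fix y assume "y \<in> op.dihedral a b"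
    then obtain c d k where y: "y = op.altp c d k" "{c, d} = {a, b}" unfolding op.dihedral_def by blast
    have "c \<in> S" "d \<in> S" using y(2) assms by (auto simp: doubleton_eq_iff)
    hence "y = wprod (rev (alt_word c d k))"
      using y(1) opposite_word_prod[OF alt_word_in_lists[of c d k]] by simp
    moreover have "rev (alt_word c d k) \<in> lists {a, b}" using set_alt_word[of c d k] unfolding y(2) by auto
    ultimately show "y \<in> dihedral a b" using wprod_dihedral[OF assms] by simp
  qed
  moreover have "dihedral a b \<subseteq> op.dihedral a b"
  proof
    fix y assume "y \<in> dihedral a b"
    then obtain c d k where y: "y = altp c d k" "{c, d} = {a, b}" unfolding dihedral_def by blast
    have "c \<in> S" "d \<in> S" using y(2) assms by (auto simp: doubleton_eq_iff)
    hence "y = op.wprod (rev (alt_word c d k))" using y alt_word_in_lists[of c d k] opposite_word_prod by simp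
    moreover have "rev (alt_word c d k) \<in> lists {a, b}" using set_alt_word[of c d k] unfolding y(2) by auto
    ultimately show "y \<in> op.dihedral a b" using op.wprod_dihedral[OF assms] by simp
  qed
  ultimately show ?thesis using generate_dihedral[OF assms] op.generate_dihedral[OF assms] by simp
qed

lemma (in coxeter_system) len_generate_le:
  assumes "a \<in> S" "b \<in> S" "m a b = enat n" "y \<in> generate G {a, b}" shows "len y \<le> n"
proof -
  obtain c d k where y: "y = altp c d k" "{c, d} = {a, b}" "k \<le> n"
    using assms(3,4) unfolding generate_dihedral[OF assms(1,2)] dihedral_def by auto
  have "c \<in> S" "d \<in> S" using y(2) assms by (auto simp: doubleton_eq_iff)
  hence "len y \<le> k" using y len_le[OF alt_word_in_lists[of c d k]] by simp
  thus ?thesis using y by simp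
qed

locale evaluation = module laurent_ring M
  for M :: "(laurent, 'h, 'y) module_scheme" (structure) +
  fixes C :: "'w set" and e :: "'w \<Rightarrow> 'h"
  assumes e_closed: "w \<in> C \<Longrightarrow> e w \<in> carrier M"
begin

lemma scale_closed [simp, intro]: "x \<in> carrier M \<Longrightarrow> a \<odot> x \<in> carrier M"
  by (simp add: smult_closed)

lemma scale_simps:
  "x \<in> carrier M \<Longrightarrow> (a + b) \<odot> x = a \<odot> x \<oplus> b \<odot> x"
  "x \<in> carrier M \<Longrightarrow> y \<in> carrier M \<Longrightarrow> a \<odot> (x \<oplus> y) = a \<odot> x \<oplus> a \<odot> y"
  "x \<in> carrier M \<Longrightarrow> (a * b) \<odot> x = a \<odot> (b \<odot> x)"
  "x \<in> carrier M \<Longrightarrow> 1 \<odot> x = x"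
  "x \<in> carrier M \<Longrightarrow> 0 \<odot> x = \<zero>"
  using smult_l_distr[of a b x] smult_r_distr[of a x y] smult_assoc1[of a b x] smult_one[of x]
    smult_l_null[of x] by simp_all

text \<open>A predicate and not a type: the module consists of all functions, and finiteness is
  imposed only on the set playing the role of \<open>K\<close>.\<close>

definition finite_supp :: "('w \<Rightarrow> laurent) \<Rightarrow> bool" where
  "finite_supp f \<longleftrightarrow> finite {w. f w \<noteq> 0} \<and> {w. f w \<noteq> 0} \<subseteq> C"

definition eval :: "('w \<Rightarrow> laurent) \<Rightarrow> 'h" where
  "eval f = (\<Oplus>w \<in> {w. f w \<noteq> 0}. f w \<odot> e w)"

lemma eval_superset:
  assumes "finite A" "{w. f w \<noteq> 0} \<subseteq> A" "A \<subseteq> C"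
  shows "eval f = (\<Oplus>w \<in> A. f w \<odot> e w)"
  unfolding eval_def
  by (rule M.add.finprod_mono_neutral_cong_left) (use assms e_closed in \<open>auto simp: scale_simps\<close>)

lemma eval_closed: "finite_supp f \<Longrightarrow> eval f \<in> carrier M"
  unfolding eval_def finite_supp_def by (intro M.finsum_closed) (auto simp: e_closed)

lemma finite_supp_zero: "finite_supp 0"
  by (simp add: finite_supp_def)

lemma eval_zero: "eval 0 = \<zero>"
  by (simp add: eval_def)

lemma finite_supp_single: "w \<in> C \<Longrightarrow> finite_supp (fsingle w)"
  by (simp add: finite_supp_def fsingle_def)

lemma eval_single: "w \<in> C \<Longrightarrow> eval (fsingle w) = e w"
  using e_closed[of w] by (simp add: eval_def fsingle_def scale_simps)

lemma finite_supp_scale: "finite_supp f \<Longrightarrow> finite_supp (fscale a f)"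
  unfolding finite_supp_def fscale_def
  by (auto intro: finite_subset[of _ "{w. f w \<noteq> 0}"] dest: subsetD)

lemma finite_supp_add: "finite_supp f \<Longrightarrow> finite_supp g \<Longrightarrow> finite_supp (f + g)"
  unfolding finite_supp_def
  by (auto intro: finite_subset[of _ "{w. f w \<noteq> 0} \<union> {w. g w \<noteq> 0}"] dest: subsetD)
    (metis (mono_tags, lifting) add_0 mem_Collect_eq subsetD)

lemma eval_scale:
  assumes "finite_supp f" shows "eval (fscale a f) = a \<odot> eval f"
proof -
  let ?A = "{w. f w \<noteq> 0}"
  have A: "finite ?A" "?A \<subseteq> C" using assms by (auto simp: finite_supp_def)
  have "eval (fscale a f) = (\<Oplus>w \<in> ?A. fscale a f w \<odot> e w)"
    by (rule eval_superset) (use A in \<open>auto simp: fscale_def\<close>)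
  also have "\<dots> = (\<Oplus>w \<in> ?A. a \<odot> (f w \<odot> e w))"
    by (rule M.finsum_cong') (use A e_closed in \<open>auto simp: fscale_def scale_simps\<close>)
  also have "\<dots> = a \<odot> eval f"
    unfolding eval_def
    by (rule finsum_smult_ldistr[symmetric]) (use A e_closed in auto)
  finally show ?thesis .
qed

lemma eval_add:
  assumes "finite_supp f" "finite_supp g" shows "eval (f + g) = eval f \<oplus> eval g"
proof -
  let ?A = "{w. f w \<noteq> 0} \<union> {w. g w \<noteq> 0}"
  have A: "finite ?A" "?A \<subseteq> C" using assms by (auto simp: finite_supp_def)
  have "eval (f + g) = (\<Oplus>w \<in> ?A. (f + g) w \<odot> e w)"
    by (rule eval_superset) (use A in auto)
  also have "\<dots> = (\<Oplus>w \<in> ?A. f w \<odot> e w \<oplus> g w \<odot> e w)"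
    by (rule M.finsum_cong') (use A e_closed in \<open>auto simp: scale_simps\<close>)
  also have "\<dots> = (\<Oplus>w \<in> ?A. f w \<odot> e w) \<oplus> (\<Oplus>w \<in> ?A. g w \<odot> e w)"
    by (rule M.finsum_addf) (use A e_closed in auto)
  also have "\<dots> = eval f \<oplus> eval g"
    using eval_superset[of ?A f] eval_superset[of ?A g] A by auto
  finally show ?thesis .
qed

lemma finite_supp_eval_sum:
  assumes "finite I" "\<And>i. i \<in> I \<Longrightarrow> finite_supp (f i)"
  shows "finite_supp (sum f I) \<and> eval (sum f I) = (\<Oplus>i \<in> I. eval (f i))"
  using assms
proof (induction I)
  case empty thus ?case using finite_supp_zero eval_zero by (simp add: zero_fun_def)
next
  case (insert i I)
  thus ?case using finite_supp_add[of "f i" "sum f I"] eval_add[of "f i" "sum f I"] eval_closed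
    by (auto simp: plus_fun_def)
qed

lemma finite_supp_induct [consumes 1, case_names zero add]:
  assumes "finite_supp f" "P 0"
    and "\<And>a w g. w \<in> C \<Longrightarrow> finite_supp g \<Longrightarrow> P g \<Longrightarrow> P (fscale a (fsingle w) + g)"
  shows "P f"
proof -
  have "P (\<Sum>w \<in> A. fscale (f w) (fsingle w))" if "finite A" "A \<subseteq> C" for A
    using that
  proof (induction A)
    case empty thus ?case using assms(2) by (simp add: zero_fun_def)
  next
    case (insert w A)
    have "P (fscale (f w) (fsingle w) + (\<Sum>w \<in> A. fscale (f w) (fsingle w)))"
      using insert finite_supp_eval_sum[of A "\<lambda>w. fscale (f w) (fsingle w)"]
      by (intro assms(3)) (auto intro: finite_supp_scale finite_supp_single)
    thus ?case using insert by (simp add: plus_fun_def)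
  qed
  moreover have "(\<Sum>w | f w \<noteq> 0. fscale (f w) (fsingle w)) = f"
  proof
    fix x
    have app: "(sum g A) x = (\<Sum>w \<in> A. g w x)" for g :: "'w \<Rightarrow> 'w \<Rightarrow> laurent" and A
      by (induction A rule: infinite_finite_induct) auto
    have "(\<Sum>w | f w \<noteq> 0. fscale (f w) (fsingle w)) x = (\<Sum>w | f w \<noteq> 0. if w = x then f w else 0)"
      unfolding app by (rule sum.cong) (auto simp: fscale_def fsingle_def)
    thus "(\<Sum>w | f w \<noteq> 0. fscale (f w) (fsingle w)) x = f x"
      using assms(1) by (simp add: finite_supp_def)
  qed
  ultimately show ?thesis using assms(1) by (metis finite_supp_def)
qed

end

text \<open>The coefficient of \<open>x\<close> after multiplication by the normalised generator:
  \<open>s x\<close> always contributes with coefficient 1, and \<open>x\<close> itself contributes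
  exactly when \<open>s\<close> is a descent of \<open>x\<close>. Written on coefficients, the
  operator is linear on all functions.\<close>

definition hecke_op :: "('w, 'x) monoid_scheme \<Rightarrow> 'w set \<Rightarrow> 'w \<Rightarrow> ('w \<Rightarrow> laurent) \<Rightarrow> 'w \<Rightarrow> laurent" where
  "hecke_op G S s f = (\<lambda>x. if x \<in> carrier G then f (s \<otimes>\<^bsub>G\<^esub> x)
    + (if cox_length G S (s \<otimes>\<^bsub>G\<^esub> x) < cox_length G S x then (vpow 1 - vpow (-1)) * f x else 0) else 0)"

text \<open>\<open>mu s\<close> is the actual multiplication in the algebra, on the left over
  \<open>G\<close> and on the right over the opposite group. Evaluation intertwines it with
  \<open>hecke_op\<close>, so preimages of \<open>J\<close> are preserved.\<close>

locale hecke_evaluation = coxeter_system G S m + evaluation M "carrier G" e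
  for G :: "('w, 'x) monoid_scheme" and S :: "'w set" and m :: "'w \<Rightarrow> 'w \<Rightarrow> enat"
    and M :: "(laurent, 'h, 'y) module_scheme" and e :: "'w \<Rightarrow> 'h" +
  fixes J :: "'h set" and mu :: "'w \<Rightarrow> 'h \<Rightarrow> 'h"
  assumes J_zero: "\<zero>\<^bsub>M\<^esub> \<in> J"
    and J_add: "x \<in> J \<Longrightarrow> y \<in> J \<Longrightarrow> x \<oplus>\<^bsub>M\<^esub> y \<in> J"
    and J_scale: "x \<in> J \<Longrightarrow> c \<odot>\<^bsub>M\<^esub> x \<in> J"
    and mu_closed: "s \<in> S \<Longrightarrow> x \<in> carrier M \<Longrightarrow> mu s x \<in> carrier M"
    and mu_add: "\<lbrakk>s \<in> S; x \<in> carrier M; y \<in> carrier M\<rbrakk> \<Longrightarrow> mu s (x \<oplus>\<^bsub>M\<^esub> y) = mu s x \<oplus>\<^bsub>M\<^esub> mu s y"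
    and mu_scale: "\<lbrakk>s \<in> S; x \<in> carrier M\<rbrakk> \<Longrightarrow> mu s (c \<odot>\<^bsub>M\<^esub> x) = c \<odot>\<^bsub>M\<^esub> mu s x"
    and mu_J: "s \<in> S \<Longrightarrow> x \<in> J \<Longrightarrow> mu s x \<in> J"
    and mu_up: "\<lbrakk>s \<in> S; w \<in> carrier G; cox_length G S w < cox_length G S (s \<otimes>\<^bsub>G\<^esub> w)\<rbrakk>
      \<Longrightarrow> mu s (e w) = e (s \<otimes>\<^bsub>G\<^esub> w)"
    and mu_down: "\<lbrakk>s \<in> S; w \<in> carrier G; cox_length G S (s \<otimes>\<^bsub>G\<^esub> w) < cox_length G S w\<rbrakk>
      \<Longrightarrow> mu s (e w) = e (s \<otimes>\<^bsub>G\<^esub> w) \<oplus>\<^bsub>M\<^esub> (vpow 1 - vpow (-1)) \<odot>\<^bsub>M\<^esub> e w"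
    and J_braid: "\<lbrakk>a \<in> S; b \<in> S; 3 \<le> n; m a b = enat n; u \<in> carrier G;
        \<And>y. y \<in> generate G {a, b} \<Longrightarrow>
          cox_length G S (y \<otimes>\<^bsub>G\<^esub> u) = cox_length G S y + cox_length G S u\<rbrakk>
      \<Longrightarrow> (\<Oplus>\<^bsub>M\<^esub>y \<in> generate G {a, b}. vpow (- int (n - cox_length G S y)) \<odot>\<^bsub>M\<^esub> e (y \<otimes>\<^bsub>G\<^esub> u)) \<in> J"
begin

lemma hecke_op_add: "hecke_op G S s (f + g) = hecke_op G S s f + hecke_op G S s g"
  by (auto simp: hecke_op_def fun_eq_iff algebra_simps)

lemma hecke_op_scale: "hecke_op G S s (fscale a f) = fscale a (hecke_op G S s f)"
  by (auto simp: hecke_op_def fscale_def fun_eq_iff algebra_simps)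

lemma hecke_op_zero: "hecke_op G S s 0 = 0"
  by (auto simp: hecke_op_def fun_eq_iff)

lemma hecke_op_single:
  assumes "s \<in> S" "w \<in> carrier G"
  shows "hecke_op G S s (fsingle w) = fsingle (s \<otimes>\<^bsub>G\<^esub> w)
    + (if len (s \<otimes>\<^bsub>G\<^esub> w) < len w then fscale (vpow 1 - vpow (-1)) (fsingle w) else 0)"
proof
  fix x
  have "s \<otimes>\<^bsub>G\<^esub> x = w \<longleftrightarrow> x = s \<otimes>\<^bsub>G\<^esub> w" if "x \<in> carrier G" using assms that by auto
  moreover have "s \<otimes>\<^bsub>G\<^esub> w \<in> carrier G" using assms by simp
  ultimately show "hecke_op G S s (fsingle w) x = (fsingle (s \<otimes>\<^bsub>G\<^esub> w)
      + (if len (s \<otimes>\<^bsub>G\<^esub> w) < len w then fscale (vpow 1 - vpow (-1)) (fsingle w) else 0)) x"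
    using assms by (auto simp: hecke_op_def fsingle_def fscale_def)
qed

lemma eval_hecke_op_single:
  assumes "s \<in> S" "w \<in> carrier G"
  shows "finite_supp (hecke_op G S s (fsingle w)) \<and> eval (hecke_op G S s (fsingle w)) = mu s (e w)"
proof (cases "len (s \<otimes>\<^bsub>G\<^esub> w) < len w")
  case True
  thus ?thesis using assms mu_down[OF assms True]
    by (simp add: hecke_op_single finite_supp_add finite_supp_single finite_supp_scale
        eval_add eval_single eval_scale)
next
  case False
  hence "len w < len (s \<otimes>\<^bsub>G\<^esub> w)" using len_mult_gen[OF assms] by auto
  thus ?thesis using assms mu_up[OF assms] False
    by (simp add: hecke_op_single finite_supp_single eval_single)
qed

lemma eval_hecke_op:
  assumes "finite_supp f" "s \<in> S"
  shows "finite_supp (hecke_op G S s f) \<and> eval (hecke_op G S s f) = mu s (eval f)"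
  using assms(1)
proof (induction rule: finite_supp_induct)
  case zero
  have z: "mu s \<zero>\<^bsub>M\<^esub> = \<zero>\<^bsub>M\<^esub>"
    using mu_scale[OF assms(2), of "\<zero>\<^bsub>M\<^esub>" 0] mu_closed[OF assms(2), of "\<zero>\<^bsub>M\<^esub>"]
    by (simp add: scale_simps)
  show ?case unfolding hecke_op_zero eval_zero z using finite_supp_zero by blast
next
  case (add a w g)
  note w = eval_hecke_op_single[OF assms(2) add(1)]
  have fw: "finite_supp (fscale a (fsingle w))"
    using add(1) by (simp add: finite_supp_scale finite_supp_single)
  have "eval (hecke_op G S s (fscale a (fsingle w) + g)) = a \<odot>\<^bsub>M\<^esub> mu s (e w) \<oplus>\<^bsub>M\<^esub> mu s (eval g)"
    unfolding hecke_op_add hecke_op_scale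
    using w add(3) by (subst eval_add) (simp_all add: finite_supp_scale eval_scale)
  also have "\<dots> = mu s (a \<odot>\<^bsub>M\<^esub> e w \<oplus>\<^bsub>M\<^esub> eval g)"
    using add(1,2) assms(2) by (simp add: mu_add mu_scale e_closed eval_closed)
  also have "a \<odot>\<^bsub>M\<^esub> e w \<oplus>\<^bsub>M\<^esub> eval g = eval (fscale a (fsingle w) + g)"
    using add(1) by (subst eval_add[OF fw add(2)]) (simp add: eval_scale eval_single finite_supp_single)
  finally show ?case
    unfolding hecke_op_add hecke_op_scale using w add(3) finite_supp_add finite_supp_scale by blast
qed

lemma hecke_lattice_hecke_op:
  "hecke_lattice G S m fscale laurent_neg (vpow 1) (vpow (-1)) fsingle {f. finite_supp f \<and> eval f \<in> J}
    (hecke_op G S)"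
proof (intro hecke_lattice.intro lattice_module.intro hecke_lattice_axioms.intro
    lattice_module_axioms.intro)
  show "coxeter_system G S m" by (rule coxeter_system_axioms)
  show "Modules.module fscale" by (rule fscale.module_axioms)
  show "vpow (-1) * vpow 1 = 1" by (simp flip: vpow_add)
  show "0 \<in> {f. finite_supp f \<and> eval f \<in> J}" by (simp add: finite_supp_zero eval_zero J_zero)
  show "hecke_op G S s (fsingle w) = fsingle (s \<otimes>\<^bsub>G\<^esub> w)"
    if "s \<in> S" "w \<in> carrier G" "len w < len (s \<otimes>\<^bsub>G\<^esub> w)" for s w
    using that by (simp add: hecke_op_single)
  show "hecke_op G S s (fsingle w) = fsingle (s \<otimes>\<^bsub>G\<^esub> w) + fscale (vpow 1 - vpow (-1)) (fsingle w)"
    if "s \<in> S" "w \<in> carrier G" "len (s \<otimes>\<^bsub>G\<^esub> w) < len w" for s w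
    using that by (simp add: hecke_op_single)
  fix a b n u w0
  assume ab: "a \<in> S" "b \<in> S" "3 \<le> n" "m a b = enat n" "u \<in> carrier G"
    "\<And>y. y \<in> generate G {a, b} \<Longrightarrow> len (y \<otimes>\<^bsub>G\<^esub> u) = len y + len u"
    and w0: "w0 \<in> generate G {a, b}" "len w0 = n"
  have gc: "generate G {a, b} \<subseteq> carrier G" using generate_incl[of "{a, b}"] ab by auto
  note fin = finite_generate[OF ab(1,2,4)]
  let ?f = "\<lambda>y. fscale (vpow (-1) ^ (n - len y)) (fsingle (y \<otimes>\<^bsub>G\<^esub> u))"
  \<comment> \<open>The longest element is the summand with exponent
    \<open>n - len w0 = 0\<close>.\<close>
  have "fsingle (w0 \<otimes>\<^bsub>G\<^esub> u) = ?f w0" using w0 by simp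
  hence eq: "fsingle (w0 \<otimes>\<^bsub>G\<^esub> u) + (\<Sum>y \<in> generate G {a, b} - {w0}. ?f y) = sum ?f (generate G {a, b})"
    using sum.remove[OF fin w0(1), of ?f] by simp
  have f: "finite_supp (?f y) \<and> eval (?f y) = vpow (- int (n - len y)) \<odot>\<^bsub>M\<^esub> e (y \<otimes>\<^bsub>G\<^esub> u)"
    if "y \<in> generate G {a, b}" for y
    using that gc ab(5)
    by (auto simp: finite_supp_scale finite_supp_single eval_scale eval_single vpow_power subset_iff)
  have "eval (sum ?f (generate G {a, b})) = (\<Oplus>\<^bsub>M\<^esub>y \<in> generate G {a, b}. eval (?f y))"
    using finite_supp_eval_sum[OF fin, of ?f] f by blast
  also have "\<dots> = (\<Oplus>\<^bsub>M\<^esub>y \<in> generate G {a, b}. vpow (- int (n - len y)) \<odot>\<^bsub>M\<^esub> e (y \<otimes>\<^bsub>G\<^esub> u))"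
    by (rule M.finsum_cong') (use f gc ab(5) e_closed in \<open>auto simp: subset_iff\<close>)
  finally have "eval (sum ?f (generate G {a, b})) \<in> J" using J_braid[OF ab] by simp
  moreover have "finite_supp (sum ?f (generate G {a, b}))"
    using finite_supp_eval_sum[OF fin, of ?f] f by blast
  ultimately show "fsingle (w0 \<otimes>\<^bsub>G\<^esub> u) + (\<Sum>y \<in> generate G {a, b} - {w0}. ?f y)
      \<in> {f. finite_supp f \<and> eval f \<in> J}"
    unfolding eq by simp
qed (auto simp: laurent_neg_add laurent_neg_mult laurent_neg_uminus laurent_neg_vpow
    finite_supp_add eval_add J_add finite_supp_scale eval_scale J_scale
    hecke_op_add hecke_op_scale eval_hecke_op mu_J simp flip: vpow_0)

end

section \<open>The generalized Temperley--Lieb algebra\<close>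

locale hecke_coxeter = coxeter_system G S m + A: ring H + hecke_algebra G S H T
  for G :: "('w, 'x) monoid_scheme" and S :: "'w set" and m :: "'w \<Rightarrow> 'w \<Rightarrow> enat"
    and H :: "(laurent, 'h, 'y) module_scheme" and T :: "'w \<Rightarrow> 'h"
begin

abbreviation J :: "'h set" where "J \<equiv> TL_ideal G S m H T"
abbreviation tilde :: "'w \<Rightarrow> 'h" where "tilde \<equiv> T_tilde G S H T"

sublocale evaluation H "carrier G" tilde
  by unfold_locales (simp add: T_tilde_def T_closed H.smult_closed)

text \<open>The axioms describe left multiplication by a generator. Induction along a reduced word
  of \<open>x\<close> extends this to all products with additive length, including right
  multiplication by a generator that lengthens the element.\<close>

lemma T_mult_add:
  assumes "x \<in> carrier G" "y \<in> carrier G" "len (x \<otimes>\<^bsub>G\<^esub> y) = len x + len y"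
  shows "T x \<otimes>\<^bsub>H\<^esub> T y = T (x \<otimes>\<^bsub>G\<^esub> y)"
proof -
  have "wprod ws \<otimes>\<^bsub>G\<^esub> y \<in> carrier G \<longrightarrow> len (wprod ws \<otimes>\<^bsub>G\<^esub> y) = length ws + len y \<longrightarrow>
      T (wprod ws) \<otimes>\<^bsub>H\<^esub> T y = T (wprod ws \<otimes>\<^bsub>G\<^esub> y)" if "reduced ws" for ws
    using that
  proof (induction ws)
    case Nil thus ?case using assms T_one T_closed by simp
  next
    case (Cons s ws)
    note s = reduced_ConsD[OF Cons.prems]
    have wc: "wprod ws \<in> carrier G" using s reduced_lists by blast
    show ?case
    proof (intro impI)
      assume l: "len (wprod (s # ws) \<otimes>\<^bsub>G\<^esub> y) = length (s # ws) + len y"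
      have e: "wprod (s # ws) \<otimes>\<^bsub>G\<^esub> y = s \<otimes>\<^bsub>G\<^esub> (wprod ws \<otimes>\<^bsub>G\<^esub> y)"
        using s wc assms by (simp add: m_assoc)
      have "len (wprod ws \<otimes>\<^bsub>G\<^esub> y) \<le> length ws + len y"
        using len_mult_le[OF wc assms(2)] reduced_len[OF s(2)] by simp
      moreover have "len (s \<otimes>\<^bsub>G\<^esub> (wprod ws \<otimes>\<^bsub>G\<^esub> y)) \<le> Suc (len (wprod ws \<otimes>\<^bsub>G\<^esub> y))"
        using len_mult_le[of s "wprod ws \<otimes>\<^bsub>G\<^esub> y"] s wc assms by simp
      ultimately have l': "len (wprod ws \<otimes>\<^bsub>G\<^esub> y) = length ws + len y" using l e by simp
      have IH: "T (wprod ws) \<otimes>\<^bsub>H\<^esub> T y = T (wprod ws \<otimes>\<^bsub>G\<^esub> y)"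
        using Cons.IH s(2) l' wc assms by simp
      have up: "T s \<otimes>\<^bsub>H\<^esub> T (wprod ws) = T (wprod (s # ws))"
        using T_mult_up[OF s(1) wc] reduced_len[OF Cons.prems] reduced_len[OF s(2)] by simp
      have "T (wprod (s # ws)) \<otimes>\<^bsub>H\<^esub> T y = T s \<otimes>\<^bsub>H\<^esub> (T (wprod ws) \<otimes>\<^bsub>H\<^esub> T y)"
        unfolding up[symmetric] using s wc assms T_closed by (simp add: A.m_assoc)
      also have "\<dots> = T (wprod (s # ws) \<otimes>\<^bsub>G\<^esub> y)"
        unfolding IH e using s wc assms l l' e by (intro T_mult_up) auto
      finally show "T (wprod (s # ws)) \<otimes>\<^bsub>H\<^esub> T y = T (wprod (s # ws) \<otimes>\<^bsub>G\<^esub> y)" .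
    qed
  qed
  moreover obtain ws where "reduced ws" "wprod ws = x" using reduced_exists assms by blast
  ultimately show ?thesis using assms reduced_len by fastforce
qed

lemma T_square:
  assumes "s \<in> S"
  shows "T s \<otimes>\<^bsub>H\<^esub> T s = vpow 2 \<odot>\<^bsub>H\<^esub> \<one>\<^bsub>H\<^esub> \<oplus>\<^bsub>H\<^esub> (vpow 2 - 1) \<odot>\<^bsub>H\<^esub> T s"
  using T_mult_down[of s s] assms T_one by simp

lemma tilde_mult_scale:
  assumes "x \<in> carrier G" "y \<in> carrier G"
  shows "tilde x \<otimes>\<^bsub>H\<^esub> tilde y = vpow (- int (len x) - int (len y)) \<odot>\<^bsub>H\<^esub> (T x \<otimes>\<^bsub>H\<^esub> T y)"
proof -
  have "vpow (- int (len x) - int (len y)) = vpow (- int (len y)) * vpow (- int (len x))"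
    by (metis add.commute add_uminus_conv_diff vpow_add)
  thus ?thesis using assms T_closed[of x] T_closed[of y]
    by (simp add: T_tilde_def smult_mult_left smult_mult_right scale_simps)
qed

lemma tilde_mult_add:
  assumes "x \<in> carrier G" "y \<in> carrier G" "len (x \<otimes>\<^bsub>G\<^esub> y) = len x + len y"
  shows "tilde x \<otimes>\<^bsub>H\<^esub> tilde y = tilde (x \<otimes>\<^bsub>G\<^esub> y)"
  using tilde_mult_scale[OF assms(1,2)] T_mult_add[OF assms] assms(3) by (simp add: T_tilde_def)

text \<open>With \<open>q = v^2\<close> the normalisation moves the roots of the quadratic relation
  from \<open>q\<close> and \<open>-1\<close> to \<open>v\<close> and \<open>- v^-1\<close>.\<close>

lemma tilde_square:
  assumes "s \<in> S"
  shows "tilde s \<otimes>\<^bsub>H\<^esub> tilde s = \<one>\<^bsub>H\<^esub> \<oplus>\<^bsub>H\<^esub> (vpow 1 - vpow (-1)) \<odot>\<^bsub>H\<^esub> tilde s"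
proof -
  have s: "s \<in> carrier G" "T s \<in> carrier H" using assms T_closed by auto
  have "tilde s \<otimes>\<^bsub>H\<^esub> tilde s = vpow (-2) \<odot>\<^bsub>H\<^esub> (vpow 2 \<odot>\<^bsub>H\<^esub> \<one>\<^bsub>H\<^esub> \<oplus>\<^bsub>H\<^esub> (vpow 2 - 1) \<odot>\<^bsub>H\<^esub> T s)"
    using tilde_mult_scale[OF s(1) s(1)] T_square[OF assms] assms by simp
  also have "\<dots> = (vpow (-2) * vpow 2) \<odot>\<^bsub>H\<^esub> \<one>\<^bsub>H\<^esub> \<oplus>\<^bsub>H\<^esub> (vpow (-2) * (vpow 2 - 1)) \<odot>\<^bsub>H\<^esub> T s"
    using s by (simp add: scale_simps)
  also have "vpow (-2) * vpow 2 = 1" by (simp flip: vpow_add)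
  also have "vpow (-2) * (vpow 2 - 1) = (vpow 1 - vpow (-1)) * vpow (-1)"
    by (simp add: right_diff_distrib left_diff_distrib flip: vpow_add)
  also have "(vpow 1 - vpow (-1)) * vpow (-1) \<odot>\<^bsub>H\<^esub> T s = (vpow 1 - vpow (-1)) \<odot>\<^bsub>H\<^esub> tilde s"
    using s assms by (simp add: T_tilde_def scale_simps)
  finally show ?thesis by (simp add: scale_simps)
qed

lemma tilde_mult_down:
  assumes "s \<in> S" "w \<in> carrier G" "len (s \<otimes>\<^bsub>G\<^esub> w) < len w"
  shows "tilde s \<otimes>\<^bsub>H\<^esub> tilde w = tilde (s \<otimes>\<^bsub>G\<^esub> w) \<oplus>\<^bsub>H\<^esub> (vpow 1 - vpow (-1)) \<odot>\<^bsub>H\<^esub> tilde w"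
proof -
  let ?w = "s \<otimes>\<^bsub>G\<^esub> w"
  have c: "s \<in> carrier G" "?w \<in> carrier G" using assms by auto
  have l: "len w = len s + len ?w" using assms len_mult_gen[OF assms(1,2)] by auto
  have w: "tilde s \<otimes>\<^bsub>H\<^esub> tilde ?w = tilde w"
    using tilde_mult_add[of s ?w] c l assms by simp
  have "tilde s \<otimes>\<^bsub>H\<^esub> tilde w = (tilde s \<otimes>\<^bsub>H\<^esub> tilde s) \<otimes>\<^bsub>H\<^esub> tilde ?w"
    unfolding w[symmetric] using c e_closed[of s] e_closed[of ?w] by (simp add: A.m_assoc)
  also have "\<dots> = tilde ?w \<oplus>\<^bsub>H\<^esub> ((vpow 1 - vpow (-1)) \<odot>\<^bsub>H\<^esub> tilde s) \<otimes>\<^bsub>H\<^esub> tilde ?w"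
    unfolding tilde_square[OF assms(1)] using c e_closed[of s] e_closed[of ?w] by (simp add: A.l_distr)
  also have "\<dots> = tilde ?w \<oplus>\<^bsub>H\<^esub> (vpow 1 - vpow (-1)) \<odot>\<^bsub>H\<^esub> tilde w"
    using c e_closed[of s] e_closed[of ?w] w by (simp add: smult_mult_left)
  finally show ?thesis .
qed

text \<open>Splitting \<open>s\<close> off the right end of \<open>w\<close> reduces the claim to
  the square of the generator.\<close>

lemma tilde_mult_down_right:
  assumes "s \<in> S" "w \<in> carrier G" "len (w \<otimes>\<^bsub>G\<^esub> s) < len w"
  shows "tilde w \<otimes>\<^bsub>H\<^esub> tilde s = tilde (w \<otimes>\<^bsub>G\<^esub> s) \<oplus>\<^bsub>H\<^esub> (vpow 1 - vpow (-1)) \<odot>\<^bsub>H\<^esub> tilde w"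
proof -
  let ?w = "w \<otimes>\<^bsub>G\<^esub> s"
  have c: "s \<in> carrier G" "?w \<in> carrier G" using assms by auto
  have "len w \<le> len ?w + len s" using len_mult_le[OF c(2,1)] assms by simp
  hence l: "len w = len ?w + len s" using assms by simp
  have w: "tilde ?w \<otimes>\<^bsub>H\<^esub> tilde s = tilde w"
    using tilde_mult_add[of ?w s] c l assms by simp
  have "tilde w \<otimes>\<^bsub>H\<^esub> tilde s = tilde ?w \<otimes>\<^bsub>H\<^esub> (tilde s \<otimes>\<^bsub>H\<^esub> tilde s)"
    unfolding w[symmetric] using c e_closed[of s] e_closed[of ?w] by (simp add: A.m_assoc)
  also have "\<dots> = tilde ?w \<oplus>\<^bsub>H\<^esub> tilde ?w \<otimes>\<^bsub>H\<^esub> ((vpow 1 - vpow (-1)) \<odot>\<^bsub>H\<^esub> tilde s)"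
    unfolding tilde_square[OF assms(1)] using c e_closed[of s] e_closed[of ?w] by (simp add: A.r_distr)
  also have "\<dots> = tilde ?w \<oplus>\<^bsub>H\<^esub> (vpow 1 - vpow (-1)) \<odot>\<^bsub>H\<^esub> tilde w"
    using c e_closed[of s] e_closed[of ?w] w by (simp add: smult_mult_right)
  finally show ?thesis .
qed

section \<open>The Temperley--Lieb ideal and its relations\<close>

lemma J_ideal: "ideal J H"
  unfolding TL_ideal_def
proof (rule A.genideal_ideal, rule subsetI)
  fix x assume "x \<in> {\<Oplus>\<^bsub>H\<^esub>u \<in> generate G {s, t}. T u | s t. s \<in> S \<and> t \<in> S \<and> 3 \<le> m s t \<and> m s t < \<infinity>}"
  then obtain s t where "x = (\<Oplus>\<^bsub>H\<^esub>u \<in> generate G {s, t}. T u)" "s \<in> S" "t \<in> S" by blast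
  moreover have "generate G {s, t} \<subseteq> carrier G" using generate_incl[of "{s, t}"] calculation by auto
  ultimately show "x \<in> carrier H" by (auto intro!: A.finsum_closed T_closed)
qed

sublocale J: ideal J H by (rule J_ideal)

lemma J_braid_sum:
  assumes "s \<in> S" "t \<in> S" "3 \<le> n" "m s t = enat n"
  shows "(\<Oplus>\<^bsub>H\<^esub>u \<in> generate G {s, t}. T u) \<in> J"
proof -
  let ?X = "{\<Oplus>\<^bsub>H\<^esub>u \<in> generate G {s, t}. T u | s t. s \<in> S \<and> t \<in> S \<and> 3 \<le> m s t \<and> m s t < \<infinity>}"
  have "?X \<subseteq> carrier H"
  proof
    fix x assume "x \<in> ?X"
    then obtain s t where "x = (\<Oplus>\<^bsub>H\<^esub>u \<in> generate G {s, t}. T u)" "s \<in> S" "t \<in> S" by blast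
    moreover have "generate G {s, t} \<subseteq> carrier G" using generate_incl[of "{s, t}"] calculation by auto
    ultimately show "x \<in> carrier H" by (auto intro!: A.finsum_closed T_closed)
  qed
  hence "?X \<subseteq> J" unfolding TL_ideal_def by (rule A.genideal_self)
  moreover have "3 \<le> m s t" "m s t < \<infinity>" using assms by (simp_all add: numeral_eq_enat)
  ultimately show ?thesis using assms by blast
qed

text \<open>A scalar acts as multiplication by \<open>c\<close> times the unit, so the ring ideal is
  also a submodule.\<close>

lemma J_smult:
  assumes "x \<in> J" shows "c \<odot>\<^bsub>H\<^esub> x \<in> J"
proof -
  have x: "x \<in> carrier H" using assms by (rule J.Icarr)
  have "(c \<odot>\<^bsub>H\<^esub> \<one>\<^bsub>H\<^esub>) \<otimes>\<^bsub>H\<^esub> x = c \<odot>\<^bsub>H\<^esub> x"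
    using smult_mult_left[OF A.one_closed x, of c] A.l_one[OF x] by argo
  thus ?thesis using J.I_l_closed[OF assms scale_closed[OF A.one_closed], of c] by argo
qed

text \<open>The ideal generator is scaled by \<open>v^-n\<close>: of this power,
  \<open>v^-(len y)\<close> normalises \<open>T y\<close>, leaving \<open>v^-(n - len y)\<close> as
  coefficient.\<close>

lemma J_braid_tilde:
  assumes ab: "a \<in> S" "b \<in> S" "3 \<le> n" "m a b = enat n"
  shows "(\<Oplus>\<^bsub>H\<^esub>y \<in> generate G {a, b}. vpow (- int (n - len y)) \<odot>\<^bsub>H\<^esub> tilde y) \<in> J"
proof -
  have gc: "generate G {a, b} \<subseteq> carrier G" using generate_incl[of "{a, b}"] ab by auto
  have "vpow (- int (n - len y)) \<odot>\<^bsub>H\<^esub> tilde y = vpow (- int n) \<odot>\<^bsub>H\<^esub> T y"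
    if y: "y \<in> generate G {a, b}" for y
  proof -
    have "- int (n - len y) + - int (len y) = - int n" using len_generate_le[OF ab(1,2,4) y] by simp
    hence "vpow (- int (n - len y)) * vpow (- int (len y)) = vpow (- int n)" by (metis vpow_add)
    thus ?thesis using scale_simps(3)[of "T y"] T_closed gc y by (metis T_tilde_def subsetD)
  qed
  hence "(\<Oplus>\<^bsub>H\<^esub>y \<in> generate G {a, b}. vpow (- int (n - len y)) \<odot>\<^bsub>H\<^esub> tilde y)
    = (\<Oplus>\<^bsub>H\<^esub>y \<in> generate G {a, b}. vpow (- int n) \<odot>\<^bsub>H\<^esub> T y)"
    by (intro A.finsum_cong') (use gc T_closed in \<open>auto simp: subset_iff\<close>)
  also have "\<dots> = vpow (- int n) \<odot>\<^bsub>H\<^esub> (\<Oplus>\<^bsub>H\<^esub>y \<in> generate G {a, b}. T y)"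
    by (rule H.finsum_smult_ldistr[symmetric]) (use gc T_closed finite_generate[OF ab(1,2,4)] in auto)
  finally show ?thesis using J_smult J_braid_sum[OF ab] by simp
qed

lemma hecke_evaluation_left:
  "hecke_evaluation G S m H tilde J (\<lambda>s x. tilde s \<otimes>\<^bsub>H\<^esub> x)"
proof unfold_locales
  fix a b n u assume ab: "a \<in> S" "b \<in> S" "3 \<le> n" "m a b = enat n" and u: "u \<in> carrier G"
    and l: "\<And>y. y \<in> generate G {a, b} \<Longrightarrow> len (y \<otimes>\<^bsub>G\<^esub> u) = len y + len u"
  have gc: "generate G {a, b} \<subseteq> carrier G" using generate_incl[of "{a, b}"] ab by auto
  have "(\<Oplus>\<^bsub>H\<^esub>y \<in> generate G {a, b}. vpow (- int (n - len y)) \<odot>\<^bsub>H\<^esub> tilde (y \<otimes>\<^bsub>G\<^esub> u))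
    = (\<Oplus>\<^bsub>H\<^esub>y \<in> generate G {a, b}. (vpow (- int (n - len y)) \<odot>\<^bsub>H\<^esub> tilde y) \<otimes>\<^bsub>H\<^esub> tilde u)"
    by (rule A.finsum_cong')
      (use gc u l e_closed tilde_mult_add smult_mult_left in \<open>auto simp: subset_iff\<close>)
  also have "\<dots> = (\<Oplus>\<^bsub>H\<^esub>y \<in> generate G {a, b}. vpow (- int (n - len y)) \<odot>\<^bsub>H\<^esub> tilde y) \<otimes>\<^bsub>H\<^esub> tilde u"
    by (rule A.finsum_ldistr[symmetric]) (use gc u e_closed finite_generate[OF ab(1,2,4)] in auto)
  finally show "(\<Oplus>\<^bsub>H\<^esub>y \<in> generate G {a, b}. vpow (- int (n - len y)) \<odot>\<^bsub>H\<^esub> tilde (y \<otimes>\<^bsub>G\<^esub> u)) \<in> J"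
    using J.I_r_closed[OF J_braid_tilde[OF ab] e_closed[OF u]] by simp
next
  fix s w assume "s \<in> S" "w \<in> carrier G" "len w < len (s \<otimes>\<^bsub>G\<^esub> w)"
  thus "tilde s \<otimes>\<^bsub>H\<^esub> tilde w = tilde (s \<otimes>\<^bsub>G\<^esub> w)"
    using len_mult_gen[of s w] by (intro tilde_mult_add) auto
qed (auto simp: J.zero_closed J.a_closed J_smult e_closed A.r_distr smult_mult_right J.I_l_closed
    tilde_mult_down)

lemma hecke_evaluation_right:
  "hecke_evaluation (opposite G) S m H tilde J (\<lambda>s x. x \<otimes>\<^bsub>H\<^esub> tilde s)"
proof -
  interpret op: coxeter_system "opposite G" S m by (rule coxeter_system_opposite)
  interpret op: evaluation H "carrier (opposite G)" tilde by unfold_locales (simp add: e_closed)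
  show ?thesis
  proof unfold_locales
    fix a b n u assume ab: "a \<in> S" "b \<in> S" "3 \<le> n" "m a b = enat n" and u: "u \<in> carrier (opposite G)"
      and l: "\<And>y. y \<in> generate (opposite G) {a, b} \<Longrightarrow>
        op.len (y \<otimes>\<^bsub>opposite G\<^esub> u) = op.len y + op.len u"
    have gc: "generate G {a, b} \<subseteq> carrier G" using generate_incl[of "{a, b}"] ab by auto
    have u: "u \<in> carrier G" using u by simp
    have l: "len (u \<otimes>\<^bsub>G\<^esub> y) = len u + len y" if "y \<in> generate G {a, b}" for y
      using l[of y] that generate_opposite[OF ab(1,2)] by simp
    have "(\<Oplus>\<^bsub>H\<^esub>y \<in> generate G {a, b}. vpow (- int (n - len y)) \<odot>\<^bsub>H\<^esub> tilde (u \<otimes>\<^bsub>G\<^esub> y))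
      = (\<Oplus>\<^bsub>H\<^esub>y \<in> generate G {a, b}. tilde u \<otimes>\<^bsub>H\<^esub> (vpow (- int (n - len y)) \<odot>\<^bsub>H\<^esub> tilde y))"
      by (rule A.finsum_cong')
        (use gc u l e_closed tilde_mult_add smult_mult_right in \<open>auto simp: subset_iff\<close>)
    also have "\<dots> = tilde u \<otimes>\<^bsub>H\<^esub> (\<Oplus>\<^bsub>H\<^esub>y \<in> generate G {a, b}. vpow (- int (n - len y)) \<odot>\<^bsub>H\<^esub> tilde y)"
      by (rule A.finsum_rdistr[symmetric]) (use gc u e_closed finite_generate[OF ab(1,2,4)] in auto)
    finally show "(\<Oplus>\<^bsub>H\<^esub>y \<in> generate (opposite G) {a, b}.
        vpow (- int (n - op.len y)) \<odot>\<^bsub>H\<^esub> tilde (y \<otimes>\<^bsub>opposite G\<^esub> u)) \<in> J"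
      using J.I_l_closed[OF J_braid_tilde[OF ab] e_closed[OF u]] generate_opposite[OF ab(1,2)] by simp
  next
    fix s w assume "s \<in> S" "w \<in> carrier (opposite G)" "op.len w < op.len (s \<otimes>\<^bsub>opposite G\<^esub> w)"
    thus "tilde w \<otimes>\<^bsub>H\<^esub> tilde s = tilde (s \<otimes>\<^bsub>opposite G\<^esub> w)"
      using op.len_mult_gen[of s w] tilde_mult_add[of w s] by auto
  qed (auto simp: J.zero_closed J.a_closed J_smult e_closed A.l_distr smult_mult_left J.I_r_closed
      tilde_mult_down_right)
qed

section \<open>Passage to the quotient\<close>

abbreviation kernel :: "('w \<Rightarrow> laurent) set" where
  "kernel \<equiv> {f. finite_supp f \<and> eval f \<in> J}"

lemma hecke_bilattice_hecke:
  assumes "star_reducible G S m"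
  shows "hecke_bilattice G S m fscale laurent_neg (vpow 1) (vpow (-1)) fsingle kernel
    (hecke_op G S) (hecke_op (opposite G) S)"
  using hecke_evaluation.hecke_lattice_hecke_op[OF hecke_evaluation_left]
    hecke_evaluation.hecke_lattice_hecke_op[OF hecke_evaluation_right] assms
  by (intro hecke_bilattice.intro hecke_bilattice_axioms.intro) simp_all

lemma TL_simps:
  "\<zero>\<^bsub>TL G S m H T\<^esub> = J" "add (TL G S m H T) = add (H Quot J)"
  "x \<in> carrier H \<Longrightarrow> a \<odot>\<^bsub>TL G S m H T\<^esub> (J +>\<^bsub>H\<^esub> x) = J +>\<^bsub>H\<^esub> (a \<odot>\<^bsub>H\<^esub> x)"
  using quotient_algebra_smult[OF J_ideal] by (simp_all add: TL_def quotient_algebra_def FactRing_def)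

text \<open>The lattice is an intersection, so it is tested against one submodule \<open>N\<close>
  at a time. Elements of \<open>kernel\<close> evaluate into the zero coset.\<close>

lemma eval_lat_submodule:
  assumes "lattice_module fscale laurent_neg (vpow 1) (vpow (-1)) kernel"
    and N: "submodule N laurent_neg_ring (TL G S m H T)" "t_tilde G S m H T ` FC \<subseteq> N"
    and f: "f \<in> lattice_module.lat fscale laurent_neg fsingle kernel FC"
  shows "finite_supp f \<and> J +>\<^bsub>H\<^esub> eval f \<in> N"
proof -
  interpret lattice_module fscale laurent_neg "vpow 1" "vpow (-1)" fsingle kernel by (rule assms)
  interpret N: submodule N laurent_neg_ring "TL G S m H T" by (rule N)
  have N0: "J \<in> N" using N.one_closed by (simp add: TL_simps)
  have Nadd: "J +>\<^bsub>H\<^esub> (x \<oplus>\<^bsub>H\<^esub> y) \<in> N"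
    if "J +>\<^bsub>H\<^esub> x \<in> N" "J +>\<^bsub>H\<^esub> y \<in> N" "x \<in> carrier H" "y \<in> carrier H" for x y
    using N.m_closed[OF that(1,2)] J.a_rcos_sum[OF that(3,4)] by (simp add: TL_simps FactRing_def)
  show ?thesis using f
  proof induction
    case (lat_K f)
    thus ?case using N0 J.a_rcos_const by auto
  next
    case (lat_gen z)
    hence z: "z \<in> carrier G" using FC_closed by blast
    have "t_tilde G S m H T z \<in> N" using N(2) lat_gen by blast
    thus ?case using z by (simp add: t_tilde_def finite_supp_single eval_single)
  next
    case (lat_add f g)
    thus ?case using Nadd finite_supp_add[of f g] eval_add[of f g] eval_closed by (simp add: plus_fun_def)
  next
    case (lat_sc a f)
    hence "a \<odot>\<^bsub>TL G S m H T\<^esub> (J +>\<^bsub>H\<^esub> eval f) \<in> N" by (intro N.smult_closed) (auto simp: laurent_neg_def)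
    thus ?case using lat_sc by (simp add: finite_supp_scale eval_scale eval_closed TL_simps)
  qed
qed

lemma t_tilde_in_lattice:
  assumes star: "star_reducible G S m" and w: "w \<in> FC" "s \<in> S" "s \<otimes>\<^bsub>G\<^esub> w \<notin> FC"
  shows "t_tilde G S m H T (s \<otimes>\<^bsub>G\<^esub> w)
    \<in> {vpow (- 1) \<odot>\<^bsub>TL G S m H T\<^esub> y | y. y \<in> TL_lattice G S m H T}"
proof -
  interpret hl: hecke_bilattice G S m fscale laurent_neg "vpow 1" "vpow (-1)" fsingle kernel
    "hecke_op G S" "hecke_op (opposite G) S" by (rule hecke_bilattice_hecke[OF star])
  let ?x = "s \<otimes>\<^bsub>G\<^esub> w" and ?f = "fscale (vpow 1) (fsingle (s \<otimes>\<^bsub>G\<^esub> w))"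
  have x: "?x \<in> carrier G" using w FC_closed by simp
  have "?f \<in> hl.left.lat FC" using hl.not_FC_mult_small[OF w] .
  hence "J +>\<^bsub>H\<^esub> eval ?f \<in> N"
    if "submodule N laurent_neg_ring (TL G S m H T)" "t_tilde G S m H T ` FC \<subseteq> N" for N
    using eval_lat_submodule[OF hl.left.lattice_module_axioms that] by blast
  \<comment> \<open>The witness is the coset of \<open>v\<close> times the normalised basis element;
    multiplying by \<open>v^-1\<close> in the quotient recovers the element itself.\<close>
  hence lattice: "J +>\<^bsub>H\<^esub> eval ?f \<in> TL_lattice G S m H T" unfolding TL_lattice_def by blast
  have ev: "eval ?f = vpow 1 \<odot>\<^bsub>H\<^esub> tilde ?x"
    using x by (simp add: eval_scale eval_single finite_supp_single)
  have "vpow (-1) \<odot>\<^bsub>TL G S m H T\<^esub> (J +>\<^bsub>H\<^esub> eval ?f) = J +>\<^bsub>H\<^esub> (vpow (-1) \<odot>\<^bsub>H\<^esub> (vpow 1 \<odot>\<^bsub>H\<^esub> tilde ?x))"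
    using x e_closed unfolding ev by (simp add: TL_simps)
  also have "vpow (-1) \<odot>\<^bsub>H\<^esub> (vpow 1 \<odot>\<^bsub>H\<^esub> tilde ?x) = tilde ?x"
    using x e_closed scale_simps(3)[of "tilde ?x" "vpow (-1)" "vpow 1", symmetric]
    by (simp add: scale_simps flip: vpow_add)
  finally have "t_tilde G S m H T ?x = vpow (-1) \<odot>\<^bsub>TL G S m H T\<^esub> (J +>\<^bsub>H\<^esub> eval ?f)"
    by (simp add: t_tilde_def)
  thus ?thesis using lattice by blast
qed

end

theorem theorem4p4p8:
  fixes G :: "('w, 'x) monoid_scheme" and S :: "'w set" and m :: "'w \<Rightarrow> 'w \<Rightarrow> enat"
    and H :: "(laurent, 'h, 'y) module_scheme" and T :: "'w \<Rightarrow> 'h" and w s :: 'w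
  assumes "coxeter_system G S m"
    and "star_reducible G S m"
    and "hecke_algebra G S H T"
    and "w \<in> fully_commutative G S"
    and "s \<in> S"
    and "s \<otimes>\<^bsub>G\<^esub> w \<notin> fully_commutative G S"
  shows "t_tilde G S m H T (s \<otimes>\<^bsub>G\<^esub> w)
    \<in> {vpow (- 1) \<odot>\<^bsub>TL G S m H T\<^esub> y | y. y \<in> TL_lattice G S m H T}"
proof -
  interpret hecke_coxeter G S m H T
    using assms by (intro hecke_coxeter.intro) (auto dest: hecke_algebra.axioms)
  show ?thesis by (rule t_tilde_in_lattice) (use assms in auto)
qed

end
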